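(* Let $N\ge 1$, $0<s<1$, and let $\Omega\subset\mathbb{R}^N$ be a bounded Lipschitz domain satisfying the exterior cone condition. Let $p$ be a real number satisfying $p>\frac{N}{2s}$ if $N>2s$, $p>1$ if $N=2s$, and $p=1$ if $N<2s$. Then there is a constant $C=C(N,s,p,\Omega)>0$ such that for every $z\in L^p(\Omega)$, every weak solution $u$ of the Dirichlet problem $$(-\Delta)^s u=z \ \text{ in }\Omega,\qquad u=0\ \text{ in }\mathbb{R}^N\setminus\Omega,$$ belongs to $C_0(\Omega)$ and satisfies $$\|u\|_{C_0(\Omega)}\le C\|z\|_{L^p(\Omega)} .$$
   Context: All functions are real valued. $C_0(\Omega)$ is the space of continuous functions on $\overline\Omega$ that vanish on $\partial\Omega$, with the sup norm; extending by zero, such functions are identified with continuous functions on $\mathbb{R}^N$ vanishing outside $\Omega$. $W^{s,2}(\mathbb{R}^N)$ is the space of $u\in L^2(\mathbb{R}^N)$ with $\int_{\mathbb{R}^N}\int_{\mathbb{R}^N}\frac{|u(x)-u(y)|^2}{|x-y|^{N+2s}}\,dx\,dy<\infty$, and $\widetilde W_0^{s,2}(\Omega):=\{u\in W^{s,2}(\mathbb{R}^N): u=0 \text{ on }\mathbb{R}^N\setminus\Omega\}$, with dual space $\widetilde W^{-s,2}(\Omega)$. Let $C_{N,s}:=\frac{s2^{2s}\Gamma(\frac{2s+N}{2})}{\pi^{N/2}\Gamma(1-s)}$. For $z\in\widetilde W^{-s,2}(\Omega)$, a weak solution of the Dirichlet problem is a function $u\in\widetilde W_0^{s,2}(\Omega)$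 with $$\frac{C_{N,s}}{2}\int_{\mathbb{R}^N}\int_{\mathbb{R}^N}\frac{(u(x)-u(y))(v(x)-v(y))}{|x-y|^{N+2s}}\,dx\,dy=\langle z,v\rangle\quad\text{for all } v\in\widetilde W_0^{s,2}(\Omega).$$ A function $z\in L^p(\Omega)$ with $p$ as in the claim acts as the functional $v\mapsto\int_\Omega zv\,dx$ (well defined since $\widetilde W_0^{s,2}(\Omega)\hookrightarrow L^{p'}(\Omega)$, $\frac1p+\frac1{p'}=1$). *)

theory Defs
  imports "HOL-Analysis.Analysis"
begin

text \<open>
  The space \<open>\<real>\<^sup>N\<close> is an arbitrary type of class \<open>euclidean_space\<close>, with \<open>N = DIM('a)\<close>.
\<close>

definition domain :: "'a::euclidean_space set \<Rightarrow> bool" where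
  "domain \<Omega> \<longleftrightarrow> open \<Omega> \<and> connected \<Omega> \<and> \<Omega> \<noteq> {}"

text \<open>
  Near each boundary point the set is, in rotated coordinates, the strict epigraph of a Lipschitz
  function of \<open>N - 1\<close> variables. The unit vector \<open>e\<close> is the last coordinate direction, and the
  first \<open>N - 1\<close> coordinates of \<open>x\<close> are represented by its projection \<open>x - (x \<bullet> e) *\<^sub>R e\<close> to the
  hyperplane orthogonal to \<open>e\<close>; only the values of \<open>\<gamma>\<close> on that hyperplane matter.
\<close>

definition lipschitz_boundary :: "'a::euclidean_space set \<Rightarrow> bool" where
  "lipschitz_boundary \<Omega> \<longleftrightarrow>
     (\<forall>a\<in>frontier \<Omega>. \<exists>r>0. \<exists>e. \<exists>\<gamma>::'a \<Rightarrow> real. \<exists>L.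
        norm e = 1 \<and> L-lipschitz_on {y. y \<bullet> e = 0} \<gamma> \<and>
        \<Omega> \<inter> ball a r = {x \<in> ball a r. \<gamma> (x - (x \<bullet> e) *\<^sub>R e) < x \<bullet> e})"

definition bounded_lipschitz_domain :: "'a::euclidean_space set \<Rightarrow> bool" where
  "bounded_lipschitz_domain \<Omega> \<longleftrightarrow> bounded \<Omega> \<and> domain \<Omega> \<and> lipschitz_boundary \<Omega>"

text \<open>
  Closed finite right circular cone with vertex \<open>a\<close>, axis direction \<open>e\<close> (a unit vector),
  half-opening angle \<open>\<theta>\<close> and radius \<open>h\<close>.
\<close>

definition finite_cone :: "'a::euclidean_space \<Rightarrow> 'a \<Rightarrow> real \<Rightarrow> real \<Rightarrow> 'a set" where
  "finite_cone a e \<theta> h = {x. norm (x - a) \<le> h \<and> cos \<theta> * norm (x - a) \<le> (x - a) \<bullet> e}"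

definition exterior_cone_condition :: "'a::euclidean_space set \<Rightarrow> bool" where
  "exterior_cone_condition \<Omega> \<longleftrightarrow>
     (\<forall>a\<in>frontier \<Omega>. \<exists>e \<theta> h. norm e = 1 \<and> 0 < \<theta> \<and> \<theta> < pi / 2 \<and> 0 < h \<and>
        finite_cone a e \<theta> h \<inter> closure \<Omega> = {a})"

text \<open>
  The elements of \<open>L\<^sup>p\<close> and of the Sobolev spaces are represented by functions, not by classes of
  functions that agree almost everywhere. The exponent \<open>p\<close> is finite.
\<close>

definition Lp_space :: "real \<Rightarrow> 'a::euclidean_space set \<Rightarrow> ('a \<Rightarrow> real) set" where
  "Lp_space p \<Omega> =
     {f \<in> borel_measurable (lebesgue_on \<Omega>). integrable (lebesgue_on \<Omega>) (\<lambda>x. \<bar>f x\<bar> powr p)}"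

definition Lp_norm :: "real \<Rightarrow> 'a::euclidean_space set \<Rightarrow> ('a \<Rightarrow> real) \<Rightarrow> real" where
  "Lp_norm p \<Omega> f = (LINT x|lebesgue_on \<Omega>. \<bar>f x\<bar> powr p) powr (1 / p)"

text \<open>
  A function on the closure of \<open>\<Omega>\<close> that vanishes on the boundary is represented by its extension
  by zero.
\<close>

definition C0 :: "'a::euclidean_space set \<Rightarrow> ('a \<Rightarrow> real) set" where
  "C0 \<Omega> = {g. continuous_on UNIV g \<and> (\<forall>x. x \<notin> \<Omega> \<longrightarrow> g x = 0)}"

definition C0_norm :: "'a::euclidean_space set \<Rightarrow> ('a \<Rightarrow> real) \<Rightarrow> real" where
  "C0_norm \<Omega> g = (SUP x\<in>closure \<Omega>. \<bar>g x\<bar>)"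

text \<open>
  In the two double integrals below the integrand is 0 on the diagonal, because \<open>0 powr a = 0\<close> and
  \<open>t / 0 = 0\<close>.
\<close>

definition Ws2 :: "real \<Rightarrow> ('a::euclidean_space \<Rightarrow> real) set" where
  "Ws2 s = {u \<in> Lp_space 2 UNIV.
     (\<integral>\<^sup>+y. \<integral>\<^sup>+x. ennreal (\<bar>u x - u y\<bar>\<^sup>2 / norm (x - y) powr (real DIM('a) + 2 * s))
        \<partial>lebesgue \<partial>lebesgue) < \<infinity>}"

definition Ws2_0 :: "real \<Rightarrow> 'a::euclidean_space set \<Rightarrow> ('a \<Rightarrow> real) set" where
  "Ws2_0 s \<Omega> = {u \<in> Ws2 s. AE x in lebesgue. x \<notin> \<Omega> \<longrightarrow> u x = 0}"

definition C_frac :: "nat \<Rightarrow> real \<Rightarrow> real" where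
  "C_frac N s =
     s * 2 powr (2 * s) * Gamma ((2 * s + real N) / 2) / (pi powr (real N / 2) * Gamma (1 - s))"

definition frac_form :: "real \<Rightarrow> ('a::euclidean_space \<Rightarrow> real) \<Rightarrow> ('a \<Rightarrow> real) \<Rightarrow> real" where
  "frac_form s u v =
     C_frac DIM('a) s / 2 *
     (LINT y|lebesgue. LINT x|lebesgue.
        (u x - u y) * (v x - v y) / norm (x - y) powr (real DIM('a) + 2 * s))"

text \<open>
  The right-hand side \<open>F\<close> is a functional \<open>v \<mapsto> \<langle>z, v\<rangle>\<close> on \<open>Ws2_0 s \<Omega>\<close>. The definition does not
  itself demand that \<open>F\<close> be bounded and linear.
\<close>

definition weak_solution ::
  "real \<Rightarrow> 'a::euclidean_space set \<Rightarrow> (('a \<Rightarrow> real) \<Rightarrow> real) \<Rightarrow> ('a \<Rightarrow> real) \<Rightarrow> bool" where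
  "weak_solution s \<Omega> F u \<longleftrightarrow> u \<in> Ws2_0 s \<Omega> \<and> (\<forall>v\<in>Ws2_0 s \<Omega>. frac_form s u v = F v)"

definition Lp_functional :: "'a::euclidean_space set \<Rightarrow> ('a \<Rightarrow> real) \<Rightarrow> ('a \<Rightarrow> real) \<Rightarrow> real" where
  "Lp_functional \<Omega> z v = (LINT x|lebesgue_on \<Omega>. z x * v x)"

end

theory Submission
  imports Defs
begin

text \<open>
  In all three cases \<open>p \<ge> 1\<close> and \<open>\<kappa> = 2 s / N - 1 / p\<close> is positive. Testing the equation with the
  two-sided truncation \<open>min (max (u - \<phi> - k) 0) (h - k)\<close> and bounding its energy from below by the
  Faber--Krahn inequality shows that \<open>A k = |{u - \<phi> > k}|\<close> satisfies
  \<open>(h - k) A h \<le> B \<parallel>z\<parallel>\<^sub>p (A k)\<^bsup>1 + \<kappa>\<^esup>\<close>, so that \<open>u - \<phi> \<le> C \<parallel>z\<parallel>\<^sub>p |D|\<^bsup>\<kappa>\<^esup>\<close> when \<open>u \<le> \<phi>\<close> off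
  \<open>D\<close>. With \<open>\<phi> = 0\<close> this is the sup bound. With \<open>D\<close> a small ball and a suitable \<open>\<phi>\<close> it shows
  that \<open>u\<close> drops below its essential limsup at a point by a fixed amount if it lies well below that
  limsup on a fixed fraction of a small ball, which is absurd. Inside \<open>\<Omega>\<close> the fraction is provided by
  \<open>u\<close> or \<open>- u\<close> if the essential limsup and liminf differ; outside \<open>\<Omega>\<close> it is provided by the
  exterior cone, on which \<open>u = 0\<close>.
\<close>

section \<open>The Gagliardo energy on Borel functions\<close>

text \<open>The function \<phi> does not solve the equation: paired with a test function v it costs
  up to a constant times \<rho>^(-2s) times the integral of v. Nonlocality pays for this. The test
  function lives in the small ball, and a set S in that ball on which u lies well below \<phi>
  interacts with v at distance at most 2\<rho>, which gains a multiple of \<rho>^(-N-2s) |S| times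
  the integral of v. If |S| is at least \<mu>\<rho>^N, cost and gain scale alike, and a small
  multiple of the cutoff is absorbed. The relative drop \<theta> depends on \<mu>, N, s only, not on
  the levels; hence no modulus of continuity is needed, and starting slightly above the essential
  limsup already contradicts its definition.

  The exponent \<kappa> is the Faber--Krahn factor |A|^(-2s/N) set against the Hoelder factor
  |A|^(1-1/p). Capping the test function keeps it bounded, so that z may be merely integrable, and
  makes it constant on the higher level set.

  Borel representatives are used throughout, so that the substitution (x, h) -> (x, x + h) stays
  measurable.\<close>

definition frac_kernel :: "real \<Rightarrow> 'a::euclidean_space \<Rightarrow> real" where
  "frac_kernel s h = 1 / norm h powr (real DIM('a) + 2 * s)"

text \<open>Square integrability is not demanded: constants, and with them the comparison functions,
  have finite energy although nonzero constants are not in \<open>Ws2 s\<close>.\<close>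

definition finite_energy :: "real \<Rightarrow> ('a::euclidean_space \<Rightarrow> real) \<Rightarrow> bool" where
  "finite_energy s u \<longleftrightarrow> u \<in> borel_measurable borel \<and>
     integrable (lborel \<Otimes>\<^sub>M lborel)
       (\<lambda>p. (u (fst p) - u (snd p))\<^sup>2 * frac_kernel s (fst p - snd p))"

definition frac_bilinear :: "real \<Rightarrow> ('a::euclidean_space \<Rightarrow> real) \<Rightarrow> ('a \<Rightarrow> real) \<Rightarrow> real" where
  "frac_bilinear s u v =
     (LINT p|(lborel \<Otimes>\<^sub>M lborel).
        (u (fst p) - u (snd p)) * (v (fst p) - v (snd p)) * frac_kernel s (fst p - snd p))"

lemma frac_kernel_nonneg [simp]: "0 \<le> frac_kernel s h"
  by (simp add: frac_kernel_def)

lemma frac_kernel_measurable [measurable]: "frac_kernel s \<in> borel_measurable borel"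
  unfolding frac_kernel_def by measurable

lemma integrable_frac_bilinear:
  assumes "finite_energy s u" "finite_energy s v"
  shows "integrable (lborel \<Otimes>\<^sub>M lborel)
    (\<lambda>p. (u (fst p) - u (snd p)) * (v (fst p) - v (snd p)) * frac_kernel s (fst p - snd p))"
proof (rule Bochner_Integration.integrable_bound)
  have [measurable]: "u \<in> borel_measurable borel" "v \<in> borel_measurable borel"
    using assms by (auto simp: finite_energy_def)
  show "integrable (lborel \<Otimes>\<^sub>M lborel)
     (\<lambda>p. (u (fst p) - u (snd p))\<^sup>2 * frac_kernel s (fst p - snd p) +
          (v (fst p) - v (snd p))\<^sup>2 * frac_kernel s (fst p - snd p))"
    using assms by (intro Bochner_Integration.integrable_add) (auto simp: finite_energy_def)
  show "(\<lambda>p. (u (fst p) - u (snd p)) * (v (fst p) - v (snd p)) * frac_kernel s (fst p - snd p))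
      \<in> borel_measurable (lborel \<Otimes>\<^sub>M lborel)"
    by measurable
  have *: "\<bar>a * b\<bar> \<le> a\<^sup>2 + b\<^sup>2" for a b :: real
  proof -
    have "2 * (\<bar>a\<bar> * \<bar>b\<bar>) \<le> \<bar>a\<bar>\<^sup>2 + \<bar>b\<bar>\<^sup>2"
      using sum_squares_bound[of "\<bar>a\<bar>" "\<bar>b\<bar>"] by simp
    moreover have "0 \<le> \<bar>a\<bar> * \<bar>b\<bar>" by simp
    ultimately show ?thesis unfolding abs_mult power2_abs by linarith
  qed
  have "norm (a * b * k) \<le> norm (a\<^sup>2 * k + b\<^sup>2 * k)" if "0 \<le> k" for a b k :: real
  proof -
    have "norm (a * b * k) = \<bar>a * b\<bar> * k"
      using that by (simp add: abs_mult)
    also have "\<dots> \<le> (a\<^sup>2 + b\<^sup>2) * k"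
      by (intro mult_right_mono * that)
    finally show ?thesis
      using that by (simp add: distrib_right)
  qed
  then show "AE p in lborel \<Otimes>\<^sub>M lborel.
      norm ((u (fst p) - u (snd p)) * (v (fst p) - v (snd p)) * frac_kernel s (fst p - snd p))
      \<le> norm ((u (fst p) - u (snd p))\<^sup>2 * frac_kernel s (fst p - snd p) +
          (v (fst p) - v (snd p))\<^sup>2 * frac_kernel s (fst p - snd p))"
    by (intro AE_I2) simp
qed

text \<open>The integrand for \<open>v\<close> is dominated pointwise by that for \<open>u\<close>.
  Truncations of \<open>u\<close>, being contractions, are the intended \<open>v\<close>.\<close>

lemma finite_energy_bound:
  assumes "finite_energy s u" "v \<in> borel_measurable borel"
    and "\<And>x y. \<bar>v x - v y\<bar> \<le> \<bar>u x - u y\<bar>"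
  shows "finite_energy s v"
  unfolding finite_energy_def
proof (intro conjI)
  show "v \<in> borel_measurable borel" by fact
  have [measurable]: "u \<in> borel_measurable borel" "v \<in> borel_measurable borel"
    using assms by (auto simp: finite_energy_def)
  show "integrable (lborel \<Otimes>\<^sub>M lborel)
     (\<lambda>p. (v (fst p) - v (snd p))\<^sup>2 * frac_kernel s (fst p - snd p))"
  proof (rule Bochner_Integration.integrable_bound)
    show "integrable (lborel \<Otimes>\<^sub>M lborel)
       (\<lambda>p. (u (fst p) - u (snd p))\<^sup>2 * frac_kernel s (fst p - snd p))"
      using assms by (simp add: finite_energy_def)
    show "AE p in lborel \<Otimes>\<^sub>M lborel.
       norm ((v (fst p) - v (snd p))\<^sup>2 * frac_kernel s (fst p - snd p))
       \<le> norm ((u (fst p) - u (snd p))\<^sup>2 * frac_kernel s (fst p - snd p))"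
      using assms(3) unfolding abs_le_square_iff
      by (intro AE_I2) (simp add: abs_mult mult_right_mono)
  qed measurable
qed

lemma finite_energy_const [simp]: "finite_energy s (\<lambda>_. c)"
  by (simp add: finite_energy_def)

lemma finite_energy_add:
  assumes "finite_energy s u" "finite_energy s v"
  shows "finite_energy s (\<lambda>x. u x + v x)"
proof -
  have [measurable]: "u \<in> borel_measurable borel" "v \<in> borel_measurable borel"
    using assms by (auto simp: finite_energy_def)
  have "(\<lambda>p. (u (fst p) + v (fst p) - (u (snd p) + v (snd p)))\<^sup>2 * frac_kernel s (fst p - snd p))
      = (\<lambda>p. (u (fst p) - u (snd p))\<^sup>2 * frac_kernel s (fst p - snd p)
           + (v (fst p) - v (snd p))\<^sup>2 * frac_kernel s (fst p - snd p)
           + 2 * ((u (fst p) - u (snd p)) * (v (fst p) - v (snd p)) * frac_kernel s (fst p - snd p)))"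
    by (auto simp: fun_eq_iff power2_eq_square algebra_simps)
  moreover have "integrable (lborel \<Otimes>\<^sub>M lborel) \<dots>"
    using assms integrable_frac_bilinear[OF assms]
    by (intro Bochner_Integration.integrable_add integrable_mult_right) (auto simp: finite_energy_def)
  ultimately show ?thesis
    unfolding finite_energy_def by auto
qed

lemma finite_energy_cmult:
  assumes "finite_energy s u"
  shows "finite_energy s (\<lambda>x. c * u x)"
proof -
  have [measurable]: "u \<in> borel_measurable borel"
    using assms by (auto simp: finite_energy_def)
  have "(\<lambda>p. (c * u (fst p) - c * u (snd p))\<^sup>2 * frac_kernel s (fst p - snd p))
      = (\<lambda>p. c\<^sup>2 * ((u (fst p) - u (snd p))\<^sup>2 * frac_kernel s (fst p - snd p)))"
    by (auto simp: fun_eq_iff power2_eq_square algebra_simps)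
  moreover have "integrable (lborel \<Otimes>\<^sub>M lborel) \<dots>"
    using assms by (intro integrable_mult_right) (simp add: finite_energy_def)
  ultimately show ?thesis
    unfolding finite_energy_def by simp
qed

lemma finite_energy_uminus: "finite_energy s u \<Longrightarrow> finite_energy s (\<lambda>x. - u x)"
  using finite_energy_cmult[of s u "-1"] by simp

lemma finite_energy_diff:
  "finite_energy s u \<Longrightarrow> finite_energy s v \<Longrightarrow> finite_energy s (\<lambda>x. u x - v x)"
  using finite_energy_add[of s u "\<lambda>x. - v x"] finite_energy_uminus[of s v] by simp

lemma frac_bilinear_add:
  assumes "finite_energy s u" "finite_energy s u'" "finite_energy s v"
  shows "frac_bilinear s (\<lambda>x. u x + u' x) v = frac_bilinear s u v + frac_bilinear s u' v"
proof -
  have "frac_bilinear s (\<lambda>x. u x + u' x) v =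
    (LINT p|(lborel \<Otimes>\<^sub>M lborel).
        (u (fst p) - u (snd p)) * (v (fst p) - v (snd p)) * frac_kernel s (fst p - snd p) +
        (u' (fst p) - u' (snd p)) * (v (fst p) - v (snd p)) * frac_kernel s (fst p - snd p))"
    unfolding frac_bilinear_def
    by (rule Bochner_Integration.integral_cong) (auto simp: algebra_simps)
  then show ?thesis
    unfolding frac_bilinear_def
    using integrable_frac_bilinear[OF assms(1,3)] integrable_frac_bilinear[OF assms(2,3)]
    by simp
qed

lemma frac_bilinear_cmult:
  "frac_bilinear s (\<lambda>x. c * u x) v = c * frac_bilinear s u v"
  unfolding frac_bilinear_def
  by (subst integral_mult_right_zero[symmetric])
    (auto intro!: Bochner_Integration.integral_cong simp: algebra_simps)

lemma frac_bilinear_const [simp]: "frac_bilinear s (\<lambda>_. c) v = 0"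
  by (simp add: frac_bilinear_def)

lemma frac_bilinear_uminus: "frac_bilinear s (\<lambda>x. - u x) v = - frac_bilinear s u v"
  using frac_bilinear_cmult[of s "-1" u v] by simp

section \<open>Iterated Lebesgue integrals as integrals over the Borel product\<close>

lemma AE_lborel_iff_lebesgue: "(AE x in lebesgue. P x) \<longleftrightarrow> (AE x in lborel. P x)"
  by (rule AE_completion_iff)

text \<open>The nonnegative integral, a supremum over simple functions below, is the same for a
  measure and its completion; null sets are then discarded in the inner and the outer variable
  separately. The inner variable is the first component of the pair.\<close>

lemma nn_integral_lebesgue_twice:
  fixes f :: "'a::euclidean_space \<times> 'a \<Rightarrow> ennreal"
  assumes f[measurable]: "f \<in> borel_measurable (lborel \<Otimes>\<^sub>M lborel)"
    and ae: "AE y in lborel. AE x in lborel. g x y = f (x, y)"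
  shows "(\<integral>\<^sup>+y. \<integral>\<^sup>+x. g x y \<partial>lebesgue \<partial>lebesgue) = integral\<^sup>N (lborel \<Otimes>\<^sub>M lborel) f"
proof -
  have "(\<integral>\<^sup>+y. \<integral>\<^sup>+x. g x y \<partial>lebesgue \<partial>lebesgue) = (\<integral>\<^sup>+y. \<integral>\<^sup>+x. g x y \<partial>lborel \<partial>lborel)"
    by (simp add: nn_integral_completion)
  also have "\<dots> = (\<integral>\<^sup>+y. \<integral>\<^sup>+x. f (x, y) \<partial>lborel \<partial>lborel)"
  proof (rule nn_integral_cong_AE)
    show "AE y in lborel. (\<integral>\<^sup>+x. g x y \<partial>lborel) = (\<integral>\<^sup>+x. f (x, y) \<partial>lborel)"
      using ae by eventually_elim (rule nn_integral_cong_AE)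
  qed
  also have "\<dots> = integral\<^sup>N (lborel \<Otimes>\<^sub>M lborel) f"
    by (rule lborel_pair.nn_integral_snd) measurable
  finally show ?thesis .
qed

text \<open>The Bochner integral of a nonmeasurable function is 0 by convention, so measurability
  has to be carried along: for the inner integrals it is \<open>gm\<close>, for the outer one it
  follows from completeness of \<open>lebesgue\<close>, since the inner integral agrees almost
  everywhere with a Borel function.\<close>

lemma integral_lebesgue_twice:
  fixes f :: "'a::euclidean_space \<times> 'a \<Rightarrow> real"
  assumes f: "integrable (lborel \<Otimes>\<^sub>M lborel) f"
    and gm: "\<And>y. (\<lambda>x. g x y) \<in> borel_measurable lebesgue"
    and ae: "AE y in lborel. AE x in lborel. g x y = f (x, y)"
  shows "(LINT y|lebesgue. LINT x|lebesgue. g x y) = integral\<^sup>L (lborel \<Otimes>\<^sub>M lborel) f"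
proof -
  have [measurable]: "f \<in> borel_measurable (lborel \<Otimes>\<^sub>M lborel)" using f by auto
  have inner: "AE y in lborel. (LINT x|lebesgue. g x y) = (LINT x|lborel. f (x, y))"
    using ae
  proof eventually_elim
    case (elim y)
    have "(LINT x|lebesgue. g x y) = (LINT x|lebesgue. f (x, y))"
    proof (rule integral_cong_AE)
      show "(\<lambda>x. f (x, y)) \<in> borel_measurable lebesgue"
        by (rule measurable_completion) measurable
      show "AE x in lebesgue. g x y = f (x, y)"
        using elim unfolding AE_lborel_iff_lebesgue .
    qed (rule gm)
    also have "\<dots> = (LINT x|lborel. f (x, y))"
      by (rule integral_completion) measurable
    finally show ?case .
  qed
  define F where "F = (\<lambda>y. LINT x|lborel. f (x, y))"
  have Fm: "F \<in> borel_measurable lborel" unfolding F_def by measurable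
  have "(LINT y|lebesgue. LINT x|lebesgue. g x y) = (LINT y|lebesgue. F y)"
  proof (rule integral_cong_AE)
    show Fm': "F \<in> borel_measurable lebesgue" using Fm by (rule measurable_completion)
    show ae': "AE y in lebesgue. (LINT x|lebesgue. g x y) = F y"
      using inner unfolding AE_lborel_iff_lebesgue F_def .
    show "(\<lambda>y. LINT x|lebesgue. g x y) \<in> borel_measurable lebesgue"
    proof (rule borel_measurable_AE[OF Fm'])
      show "AE y in lebesgue. F y = (LINT x|lebesgue. g x y)"
        using ae' by eventually_elim (rule sym)
    qed
  qed
  also have "\<dots> = (LINT y|lborel. F y)"
    using Fm by (rule integral_completion)
  also have "\<dots> = integral\<^sup>L (lborel \<Otimes>\<^sub>M lborel) f"
    unfolding F_def using lborel_pair.integral_snd[of "\<lambda>x y. f (x, y)"] f by simp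
  finally show ?thesis .
qed

section \<open>Passage from Lebesgue to Borel representatives\<close>

text \<open>A Borel representative is multiplied by the indicator of \<open>\<Omega>\<close>: the
  exterior condition, known almost everywhere, then holds everywhere and can be used
  pointwise.\<close>

lemma Ws2_0_representative:
  fixes u :: "'a::euclidean_space \<Rightarrow> real"
  assumes u: "u \<in> Ws2_0 s \<Omega>" and "open \<Omega>"
  obtains u' where "finite_energy s u'" "AE x in lborel. u x = u' x" "\<And>x. x \<notin> \<Omega> \<Longrightarrow> u' x = 0"
proof -
  have um: "u \<in> borel_measurable lebesgue"
    using u by (auto simp: Ws2_0_def Ws2_def Lp_space_def lebesgue_on_UNIV_eq)
  obtain v where v: "v \<in> borel_measurable lborel" "AE x in lborel. u x = v x"
    using completion_ex_borel_measurable_real[OF um] by blast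
  have [measurable]: "v \<in> borel_measurable borel" "\<Omega> \<in> sets borel"
    using v \<open>open \<Omega>\<close> by auto
  define u' where "u' = (\<lambda>x. v x * indicator \<Omega> x)"
  have [measurable]: "u' \<in> borel_measurable borel"
    unfolding u'_def by measurable
  have "AE x in lborel. x \<notin> \<Omega> \<longrightarrow> u x = 0"
    using u unfolding Ws2_0_def AE_lborel_iff_lebesgue by simp
  then have ae: "AE x in lborel. u x = u' x"
    using v(2) by eventually_elim (auto simp: u'_def indicator_def)
  define f where "f = (\<lambda>p. ennreal ((u' (fst p) - u' (snd p))\<^sup>2 * frac_kernel s (fst p - snd p)))"
  have "(\<integral>\<^sup>+y. \<integral>\<^sup>+x. ennreal (\<bar>u x - u y\<bar>\<^sup>2 / norm (x - y) powr (real DIM('a) + 2 * s))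
        \<partial>lebesgue \<partial>lebesgue) = integral\<^sup>N (lborel \<Otimes>\<^sub>M lborel) f"
  proof (rule nn_integral_lebesgue_twice)
    show "f \<in> borel_measurable (lborel \<Otimes>\<^sub>M lborel)"
      unfolding f_def by measurable
    show "AE y in lborel. AE x in lborel.
        ennreal (\<bar>u x - u y\<bar>\<^sup>2 / norm (x - y) powr (real DIM('a) + 2 * s)) = f (x, y)"
      using ae
    proof eventually_elim
      case (elim y)
      show ?case
        using ae by eventually_elim (simp add: f_def elim frac_kernel_def)
    qed
  qed
  then have "integral\<^sup>N (lborel \<Otimes>\<^sub>M lborel) f < \<infinity>"
    using u by (simp add: Ws2_0_def Ws2_def)
  then have "finite_energy s u'"
    unfolding finite_energy_def f_def
    by (intro conjI integrableI_nonneg) auto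
  then show ?thesis
    using that[of u'] ae by (simp add: u'_def)
qed

text \<open>Finite energy says nothing about the size of \<open>v\<close>; its square integrability
  comes from the bound \<open>b\<close> on the bounded set \<open>\<Omega>\<close>. This makes
  truncations admissible test functions.\<close>

lemma finite_energy_imp_Ws2_0:
  fixes v :: "'a::euclidean_space \<Rightarrow> real"
  assumes v: "finite_energy s v" and "bounded \<Omega>" "open \<Omega>"
    and zero: "\<And>x. x \<notin> \<Omega> \<Longrightarrow> v x = 0" and bd: "\<And>x. \<bar>v x\<bar> \<le> b"
  shows "v \<in> Ws2_0 s \<Omega>"
proof -
  have [measurable]: "v \<in> borel_measurable borel" "\<Omega> \<in> sets borel"
    using v \<open>open \<Omega>\<close> by (auto simp: finite_energy_def)
  have vm: "v \<in> borel_measurable lebesgue"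
    by (rule measurable_completion) measurable
  have "0 \<le> b" using bd[of undefined] by linarith
  have "integrable lborel (\<lambda>x. \<bar>v x\<bar> powr 2)"
  proof (rule Bochner_Integration.integrable_bound)
    show "integrable lborel (\<lambda>x. b powr 2 * indicator \<Omega> x)"
      using emeasure_bounded_finite[OF \<open>bounded \<Omega>\<close>]
      by (intro integrable_mult_right integrable_real_indicator) auto
    show "AE x in lborel. norm (\<bar>v x\<bar> powr 2) \<le> norm (b powr 2 * indicator \<Omega> x :: real)"
    proof (rule AE_I2)
      fix x show "norm (\<bar>v x\<bar> powr 2) \<le> norm (b powr 2 * indicator \<Omega> x :: real)"
        using zero[of x] powr_mono2[of 2 "\<bar>v x\<bar>" b] bd[of x] by (auto simp: indicator_def)
    qed
  qed measurable
  then have "integrable lebesgue (\<lambda>x. \<bar>v x\<bar> powr 2)"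
    by (subst integrable_completion) auto
  then have L: "v \<in> Lp_space 2 UNIV"
    using vm by (simp add: Lp_space_def lebesgue_on_UNIV_eq)
  define f where "f = (\<lambda>p. ennreal ((v (fst p) - v (snd p))\<^sup>2 * frac_kernel s (fst p - snd p)))"
  have "(\<integral>\<^sup>+y. \<integral>\<^sup>+x. ennreal (\<bar>v x - v y\<bar>\<^sup>2 / norm (x - y) powr (real DIM('a) + 2 * s))
        \<partial>lebesgue \<partial>lebesgue) = integral\<^sup>N (lborel \<Otimes>\<^sub>M lborel) f"
  proof (rule nn_integral_lebesgue_twice)
    show "f \<in> borel_measurable (lborel \<Otimes>\<^sub>M lborel)"
      unfolding f_def by measurable
  qed (simp add: f_def frac_kernel_def)
  also have "\<dots> < \<infinity>"
    using v unfolding finite_energy_def f_def integrable_iff_bounded by simp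
  finally show ?thesis
    using L zero by (simp add: Ws2_0_def Ws2_def)
qed

lemma frac_form_eq_frac_bilinear:
  fixes u :: "'a::euclidean_space \<Rightarrow> real"
  assumes um: "u \<in> borel_measurable lebesgue" and ae: "AE x in lborel. u x = u' x"
    and u': "finite_energy s u'" and v: "finite_energy s v"
  shows "frac_form s u v = C_frac DIM('a) s / 2 * frac_bilinear s u' v"
proof -
  have [measurable]: "v \<in> borel_measurable borel" using v by (simp add: finite_energy_def)
  have vm [measurable]: "v \<in> borel_measurable lebesgue"
    by (rule measurable_completion) measurable
  have km: "(\<lambda>x. norm (x - y) powr (real DIM('a) + 2 * s)) \<in> borel_measurable lebesgue" for y :: 'a
    by (rule measurable_completion) measurable
  have "(LINT y|lebesgue. LINT x|lebesgue.
        (u x - u y) * (v x - v y) / norm (x - y) powr (real DIM('a) + 2 * s)) = frac_bilinear s u' v"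
    unfolding frac_bilinear_def
  proof (rule integral_lebesgue_twice)
    show "integrable (lborel \<Otimes>\<^sub>M lborel)
      (\<lambda>p. (u' (fst p) - u' (snd p)) * (v (fst p) - v (snd p)) * frac_kernel s (fst p - snd p))"
      by (rule integrable_frac_bilinear[OF u' v])
    show "(\<lambda>x. (u x - u y) * (v x - v y) / norm (x - y) powr (real DIM('a) + 2 * s))
        \<in> borel_measurable lebesgue" for y
      by (intro borel_measurable_divide borel_measurable_times borel_measurable_diff
          borel_measurable_const um vm km)
    show "AE y in lborel. AE x in lborel.
       (u x - u y) * (v x - v y) / norm (x - y) powr (real DIM('a) + 2 * s) =
       (u' (fst (x, y)) - u' (snd (x, y))) * (v (fst (x, y)) - v (snd (x, y))) *
         frac_kernel s (fst (x, y) - snd (x, y))"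
      using ae
    proof eventually_elim
      case (elim y)
      show ?case
        using ae by eventually_elim (simp add: elim frac_kernel_def)
    qed
  qed
  then show ?thesis
    by (simp add: frac_form_def)
qed

lemma C_frac_pos:
  assumes "0 < s" "s < 1" "0 < N"
  shows "0 < C_frac N s"
  using assms unfolding C_frac_def by (intro divide_pos_pos mult_pos_pos Gamma_real_pos) auto

section \<open>Moments of the kernel\<close>

lemma dyadic_shell:
  fixes t :: real
  assumes "1 \<le> t"
  obtains n :: nat where "2 ^ n \<le> t" "t < 2 ^ Suc n"
proof -
  obtain m :: nat where m: "t < 2 ^ m" using real_arch_pow[of 2 t] by auto
  have "\<not> t < 2 ^ 0" using assms by simp
  then obtain k where "\<not> t < 2 ^ k" "t < 2 ^ Suc k"
    using ex_least_nat_less[of "\<lambda>m. t < 2 ^ m" m] m by blast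
  then show ?thesis using that[of k] by simp
qed

text \<open>The function is dominated by the sum of \<open>a n\<close> times the indicators of the
  balls of radius \<open>r n\<close>, and the integrals of these terms are bounded by a geometric
  series.\<close>

lemma nn_integral_dyadic_bound:
  fixes f :: "'a::euclidean_space \<Rightarrow> ennreal"
  assumes r: "\<And>n. 0 < r n" and a: "\<And>n. 0 \<le> a n" and q: "0 < q" "q < 1"
    and le: "\<And>n. a n * r n ^ DIM('a) \<le> A * q ^ n"
    and f: "\<And>h. f h \<noteq> 0 \<Longrightarrow> \<exists>n. norm h \<le> r n \<and> f h \<le> ennreal (a n)"
  shows "(\<integral>\<^sup>+h. f h \<partial>lborel) \<le> ennreal (unit_ball_vol DIM('a) * A / (1 - q))"
proof -
  have "0 \<le> A"
  proof -
    have "0 \<le> a 0 * r 0 ^ DIM('a)" using a[of 0] r[of 0] by simp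
    also have "\<dots> \<le> A * q ^ 0" by (rule le)
    finally show ?thesis by simp
  qed
  have le_sum: "f h \<le> (\<Sum>n. ennreal (a n) * indicator (cball 0 (r n)) h)" for h
  proof (cases "f h = 0")
    case False
    then obtain n where n: "norm h \<le> r n" "f h \<le> ennreal (a n)" using f by blast
    have "f h \<le> ennreal (a n) * indicator (cball 0 (r n)) h" using n by simp
    also have "\<dots> = (\<Sum>i\<in>{n}. ennreal (a i) * indicator (cball 0 (r i)) h)"
      by (subst sum.insert) (simp_all only: sum.empty add_0_right finite.emptyI empty_iff not_False_eq_True)
    also have "\<dots> \<le> (\<Sum>n. ennreal (a n) * indicator (cball 0 (r n)) h)"
      by (rule sum_le_suminf) auto
    finally show ?thesis .
  qed auto
  have [measurable]: "cball (0::'a) (r n) \<in> sets borel" for n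
    by (simp add: borel_closed)
  have "(\<integral>\<^sup>+h. f h \<partial>lborel) \<le> (\<integral>\<^sup>+(h::'a). (\<Sum>n. ennreal (a n) * indicator (cball 0 (r n)) h) \<partial>lborel)"
    by (rule nn_integral_mono) (rule le_sum)
  also have "\<dots> = (\<Sum>n. \<integral>\<^sup>+(h::'a). ennreal (a n) * indicator (cball 0 (r n)) h \<partial>lborel)"
    by (rule nn_integral_suminf) measurable
  also have "\<dots> = (\<Sum>n. ennreal (a n) * emeasure lborel (cball (0::'a) (r n)))"
    by (simp add: nn_integral_cmult)
  also have "\<dots> \<le> (\<Sum>n. ennreal (unit_ball_vol DIM('a) * A * q ^ n))"
  proof (intro suminf_le)
    fix n
    have "ennreal (a n) * emeasure lborel (cball (0::'a) (r n))
        = ennreal (unit_ball_vol DIM('a) * (a n * r n ^ DIM('a)))"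
      using r[of n] a[of n] by (subst emeasure_cball) (simp_all add: ennreal_mult'[symmetric] mult_ac less_imp_le)
    also have "\<dots> \<le> ennreal (unit_ball_vol DIM('a) * (A * q ^ n))"
      by (intro ennreal_leI mult_left_mono le) (simp add: unit_ball_vol_nonneg)
    finally show "ennreal (a n) * emeasure lborel (cball (0::'a) (r n))
        \<le> ennreal (unit_ball_vol DIM('a) * A * q ^ n)"
      by (simp add: mult_ac)
  qed auto
  also have "\<dots> = ennreal (\<Sum>n. unit_ball_vol DIM('a) * A * q ^ n)"
    using q \<open>0 \<le> A\<close> by (intro suminf_ennreal2) (auto simp: unit_ball_vol_nonneg)
  also have "(\<Sum>n. unit_ball_vol DIM('a) * A * q ^ n) = unit_ball_vol DIM('a) * A / (1 - q)"
    using q by (subst suminf_mult) (auto simp: suminf_geometric)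
  finally show ?thesis .
qed


lemma power_powr_commute:
  fixes x :: real
  assumes "0 < x"
  shows "(x ^ n) powr c = (x powr c) ^ n"
  using assms by (induction n) (simp_all add: powr_mult)

lemma powr_dim_split:
  fixes x :: real
  assumes "0 < x"
  shows "1 / x powr (real n + 2 * s) = x powr (- 2 * s) / x ^ n"
  using assms by (simp add: powr_add powr_realpow powr_minus divide_simps)

text \<open>Inside radius \<rho> the quadratic factor compensates the singularity because s < 1;
  outside, the kernel decays because s > 0. On dyadic shells the two parts become geometric series
  with ratios \<open>q1\<close> = 2^(2s)/4 and \<open>q2\<close> = 2^(-2s). The power of \<rho> is
  forced by scaling.\<close>

lemma kernel_moment_bound:
  assumes s: "0 < s" "s < 1"
  obtains C where "0 < C" "\<And>\<rho>. 0 < \<rho> \<Longrightarrow>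
    (\<integral>\<^sup>+h. ennreal (min ((norm h / \<rho>)\<^sup>2) 1 * frac_kernel s (h::'a::euclidean_space)) \<partial>lborel)
      \<le> ennreal (C * \<rho> powr (- 2 * s))"
proof -
  let ?N = "DIM('a)"
  let ?v = "unit_ball_vol ?N"
  define q1 where "q1 = 2 powr (2 * s) / 4"
  define q2 where "q2 = 2 powr (- 2 * s)"
  have "2 powr (2 * s) < 2 powr (2::real)" using s by (intro powr_less_mono) auto
  then have q1: "0 < q1" "q1 < 1" by (auto simp: q1_def)
  have "2 powr (- 2 * s) < 2 powr (0::real)" using s by (intro powr_less_mono) auto
  then have q2: "0 < q2" "q2 < 1" by (auto simp: q2_def)
  define C where "C = ?v * (2 ^ ?N * 2 powr (2 * s)) / (1 - q1) + ?v * 2 ^ ?N / (1 - q2)"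
  have v: "0 < ?v" by (simp add: unit_ball_vol_pos)
  have "0 < C"
    unfolding C_def using q1 q2 v by (intro add_pos_pos divide_pos_pos mult_pos_pos) auto
  moreover have "(\<integral>\<^sup>+h. ennreal (min ((norm h / \<rho>)\<^sup>2) 1 * frac_kernel s (h::'a)) \<partial>lborel)
      \<le> ennreal (C * \<rho> powr (- 2 * s))" if \<rho>: "0 < \<rho>" for \<rho>
  proof -
    define g where "g = (\<lambda>h::'a. ennreal (min ((norm h / \<rho>)\<^sup>2) 1 * frac_kernel s h))"
    define f1 where "f1 = (\<lambda>h::'a. if norm h \<le> \<rho> then g h else 0)"
    define f2 where "f2 = (\<lambda>h::'a. if norm h \<le> \<rho> then 0 else g h)"
    have [measurable]: "g \<in> borel_measurable borel" unfolding g_def by measurable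
    have [measurable]: "f1 \<in> borel_measurable borel" "f2 \<in> borel_measurable borel"
      unfolding f1_def f2_def by measurable
    have I1: "(\<integral>\<^sup>+h. f1 h \<partial>lborel)
        \<le> ennreal (?v * (2 ^ ?N * 2 powr (2 * s) * \<rho> powr (- 2 * s)) / (1 - q1))"
    proof (rule nn_integral_dyadic_bound)
      show "0 < \<rho> / 2 ^ n" for n :: nat using \<rho> by simp
      \<comment> \<open>On the shell between \<rho>/2^(n+1) and \<rho>/2^n the quadratic factor is
        largest at the outer radius and the kernel at the inner one; hence the mixture of
        \<open>n\<close> and \<open>Suc n\<close>.\<close>
      show "0 \<le> (1 / 2 ^ n)\<^sup>2 * (1 / (\<rho> / 2 ^ Suc n) powr (real ?N + 2 * s))" for n :: nat by simp
      show "0 < q1" "q1 < 1" by fact+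
      show "(1 / 2 ^ n)\<^sup>2 * (1 / (\<rho> / 2 ^ Suc n) powr (real ?N + 2 * s)) * (\<rho> / 2 ^ n) ^ ?N
         \<le> 2 ^ ?N * 2 powr (2 * s) * \<rho> powr (- 2 * s) * q1 ^ n" for n :: nat
      proof -
        have "(\<rho> / 2 ^ Suc n) powr (- 2 * s) = \<rho> powr (- 2 * s) * (2 ^ Suc n) powr (2 * s)"
          using \<rho> by (subst powr_divide) (auto simp: powr_minus field_simps)
        also have "(2 ^ Suc n) powr (2 * s) = 2 powr (2 * s) * (2 powr (2 * s)) ^ n"
          by (subst power_powr_commute) auto
        finally have A: "(\<rho> / 2 ^ Suc n) powr (- 2 * s) = \<rho> powr (- 2 * s) * (2 powr (2 * s) * (2 powr (2 * s)) ^ n)" .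
        have B: "(\<rho> / 2 ^ n) ^ ?N = 2 ^ ?N * (\<rho> / 2 ^ Suc n) ^ ?N"
          by (subst power_mult_distrib[symmetric]) simp
        have C: "q1 ^ n = (2 powr (2 * s)) ^ n * (1 / 2 ^ n)\<^sup>2"
          unfolding q1_def power_divide by (simp add: power2_eq_square power_mult_distrib[symmetric])
        have D: "(\<rho> / 2 ^ Suc n) ^ ?N \<noteq> 0" using \<rho> by simp
        have "1 / (\<rho> / 2 ^ Suc n) powr (real ?N + 2 * s) = (\<rho> / 2 ^ Suc n) powr (- 2 * s) / (\<rho> / 2 ^ Suc n) ^ ?N"
          using \<rho> by (intro powr_dim_split) simp
        then show ?thesis
          unfolding A B C using D by (simp add: field_simps del: power_Suc)
      qed
      show "\<exists>n. norm h \<le> \<rho> / 2 ^ n \<and>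
          f1 h \<le> ennreal ((1 / 2 ^ n)\<^sup>2 * (1 / (\<rho> / 2 ^ Suc n) powr (real ?N + 2 * s)))"
        if "f1 h \<noteq> 0" for h :: 'a
      proof -
        have h: "norm h \<le> \<rho>" "h \<noteq> 0"
          using that by (auto simp: f1_def g_def split: if_splits)
        then obtain n where n: "2 ^ n \<le> \<rho> / norm h" "\<rho> / norm h < 2 ^ Suc n"
          using dyadic_shell[of "\<rho> / norm h"] by auto
        have n1: "norm h \<le> \<rho> / 2 ^ n" and n2: "\<rho> / 2 ^ Suc n < norm h"
          using n h by (auto simp: field_simps)
        have "min ((norm h / \<rho>)\<^sup>2) 1 * frac_kernel s h
            \<le> (1 / 2 ^ n)\<^sup>2 * (1 / (\<rho> / 2 ^ Suc n) powr (real ?N + 2 * s))"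
          unfolding frac_kernel_def
        proof (rule mult_mono)
          have "(norm h / \<rho>)\<^sup>2 \<le> (1 / 2 ^ n)\<^sup>2"
            using n1 \<rho> by (intro power_mono) (auto simp: field_simps)
          then show "min ((norm h / \<rho>)\<^sup>2) 1 \<le> (1 / 2 ^ n)\<^sup>2" by linarith
          show "1 / norm h powr (real ?N + 2 * s) \<le> 1 / (\<rho> / 2 ^ Suc n) powr (real ?N + 2 * s)"
            using n2 \<rho> s h by (intro divide_left_mono powr_mono2) auto
        qed auto
        then show ?thesis
          using h n1 by (intro exI[of _ n]) (simp add: f1_def g_def ennreal_leI)
      qed
    qed
    have I2: "(\<integral>\<^sup>+h. f2 h \<partial>lborel)
        \<le> ennreal (?v * (2 ^ ?N * \<rho> powr (- 2 * s)) / (1 - q2))"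
    proof (rule nn_integral_dyadic_bound)
      show "0 < \<rho> * 2 ^ Suc n" for n :: nat using \<rho> by simp
      show "0 \<le> 1 / (\<rho> * 2 ^ n) powr (real ?N + 2 * s)" for n :: nat by simp
      show "0 < q2" "q2 < 1" by fact+
      show "1 / (\<rho> * 2 ^ n) powr (real ?N + 2 * s) * (\<rho> * 2 ^ Suc n) ^ ?N
         \<le> 2 ^ ?N * \<rho> powr (- 2 * s) * q2 ^ n" for n :: nat
      proof -
        have "(\<rho> * 2 ^ n) powr (- 2 * s) = \<rho> powr (- 2 * s) * (2 ^ n) powr (- 2 * s)"
          using \<rho> by (subst powr_mult) auto
        also have "(2 ^ n) powr (- 2 * s) = q2 ^ n"
          unfolding q2_def by (subst power_powr_commute) auto
        finally have A: "(\<rho> * 2 ^ n) powr (- 2 * s) = \<rho> powr (- 2 * s) * q2 ^ n" .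
        have B: "(\<rho> * 2 ^ Suc n) ^ ?N = 2 ^ ?N * (\<rho> * 2 ^ n) ^ ?N"
          by (subst power_mult_distrib[symmetric]) (simp add: mult_ac)
        have D: "(\<rho> * 2 ^ n) ^ ?N \<noteq> 0" using \<rho> by simp
        have "1 / (\<rho> * 2 ^ n) powr (real ?N + 2 * s) = (\<rho> * 2 ^ n) powr (- 2 * s) / (\<rho> * 2 ^ n) ^ ?N"
          using \<rho> by (intro powr_dim_split) simp
        then show ?thesis
          unfolding A B using D by (simp add: field_simps)
      qed
      show "\<exists>n. norm h \<le> \<rho> * 2 ^ Suc n \<and>
          f2 h \<le> ennreal (1 / (\<rho> * 2 ^ n) powr (real ?N + 2 * s))"
        if "f2 h \<noteq> 0" for h :: 'a
      proof -
        have h: "\<rho> < norm h"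
          using that by (auto simp: f2_def split: if_splits)
        then have "h \<noteq> 0" "1 \<le> norm h / \<rho>" using \<rho> by auto
        then obtain n where n: "2 ^ n \<le> norm h / \<rho>" "norm h / \<rho> < 2 ^ Suc n"
          using dyadic_shell by metis
        have n1: "norm h \<le> \<rho> * 2 ^ Suc n" and n2: "\<rho> * 2 ^ n \<le> norm h"
          using n \<rho> by (auto simp: field_simps)
        have "min ((norm h / \<rho>)\<^sup>2) 1 * frac_kernel s h \<le> 1 * (1 / (\<rho> * 2 ^ n) powr (real ?N + 2 * s))"
          unfolding frac_kernel_def
        proof (rule mult_mono)
          show "1 / norm h powr (real ?N + 2 * s) \<le> 1 / (\<rho> * 2 ^ n) powr (real ?N + 2 * s)"
            using n2 \<rho> s \<open>h \<noteq> 0\<close> by (intro divide_left_mono powr_mono2) auto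
        qed auto
        then show ?thesis
          using h n1 by (intro exI[of _ n]) (simp add: f2_def g_def ennreal_leI)
      qed
    qed
    have "(\<integral>\<^sup>+h. g h \<partial>lborel) = (\<integral>\<^sup>+h. f1 h + f2 h \<partial>lborel)"
      by (intro nn_integral_cong) (simp add: f1_def f2_def)
    also have "\<dots> = (\<integral>\<^sup>+h. f1 h \<partial>lborel) + (\<integral>\<^sup>+h. f2 h \<partial>lborel)"
      by (rule nn_integral_add) auto
    also have "\<dots> \<le> ennreal (?v * (2 ^ ?N * 2 powr (2 * s) * \<rho> powr (- 2 * s)) / (1 - q1))
        + ennreal (?v * (2 ^ ?N * \<rho> powr (- 2 * s)) / (1 - q2))"
      by (intro add_mono I1 I2)
    also have "\<dots> = ennreal (?v * (2 ^ ?N * 2 powr (2 * s) * \<rho> powr (- 2 * s)) / (1 - q1)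
        + ?v * (2 ^ ?N * \<rho> powr (- 2 * s)) / (1 - q2))"
      using q1 q2 v by (intro ennreal_plus[symmetric] divide_nonneg_nonneg mult_nonneg_nonneg) auto
    also have "?v * (2 ^ ?N * 2 powr (2 * s) * \<rho> powr (- 2 * s)) / (1 - q1)
        + ?v * (2 ^ ?N * \<rho> powr (- 2 * s)) / (1 - q2) = C * \<rho> powr (- 2 * s)"
      using q1 q2 by (simp add: C_def field_simps)
    finally show ?thesis by (simp add: g_def)
  qed
  ultimately show ?thesis using that by blast
qed

section \<open>Cutoff functions\<close>

text \<open>For a fixed first component the shear translates the second one, so every slice keeps
  its measure. It turns integrals over (x, y) into integrals over (x, h) with h = y - x, in which
  the kernel depends on h alone.\<close>

lemma distr_lborel_shear:
  "distr (lborel \<Otimes>\<^sub>M lborel) (lborel \<Otimes>\<^sub>M lborel) (\<lambda>p. (fst p, fst p + snd p))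
     = (lborel \<Otimes>\<^sub>M lborel :: ('a::euclidean_space \<times> 'a) measure)" (is "distr ?P ?P ?f = _")
proof (rule measure_eqI)
  have f [measurable]: "?f \<in> measurable ?P ?P" by measurable
  show "sets (distr ?P ?P ?f) = sets ?P" by simp
  fix A assume "A \<in> sets (distr ?P ?P ?f)"
  then have A [measurable]: "A \<in> sets ?P" by simp
  have "emeasure (distr ?P ?P ?f) A = emeasure ?P (?f -` A \<inter> space ?P)"
    by (rule emeasure_distr) measurable
  also have "\<dots> = (\<integral>\<^sup>+x. emeasure lborel (Pair x -` (?f -` A \<inter> space ?P)) \<partial>lborel)"
    by (rule lborel.emeasure_pair_measure_alt) measurable
  also have "\<dots> = (\<integral>\<^sup>+x. emeasure lborel (Pair x -` A) \<partial>lborel)"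
  proof (rule nn_integral_cong)
    fix x :: 'a
    have [measurable]: "Pair x -` A \<in> sets borel"
      using sets_Pair1[OF A, of x] by simp
    have "emeasure lborel (Pair x -` A) = emeasure (distr lborel borel ((+) x)) (Pair x -` A)"
      by (simp add: lborel_distr_plus)
    also have "\<dots> = emeasure lborel ((+) x -` (Pair x -` A))"
      by (subst emeasure_distr) auto
    also have "(+) x -` (Pair x -` A) = Pair x -` (?f -` A \<inter> space ?P)"
      by (auto simp: space_pair_measure)
    finally show "emeasure lborel (Pair x -` (?f -` A \<inter> space ?P)) = emeasure lborel (Pair x -` A)"
      by simp
  qed
  also have "\<dots> = emeasure ?P A"
    by (rule lborel.emeasure_pair_measure_alt[symmetric]) measurable
  finally show "emeasure (distr ?P ?P ?f) A = emeasure ?P A" .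
qed

lemma integral_shear:
  fixes f :: "'a::euclidean_space \<times> 'a \<Rightarrow> real"
  assumes "integrable (lborel \<Otimes>\<^sub>M lborel) f"
  shows "integrable (lborel \<Otimes>\<^sub>M lborel) (\<lambda>p. f (fst p, fst p + snd p))"
    and "(LINT p|(lborel \<Otimes>\<^sub>M lborel). f (fst p, fst p + snd p)) = integral\<^sup>L (lborel \<Otimes>\<^sub>M lborel) f"
proof -
  let ?P = "lborel \<Otimes>\<^sub>M lborel :: ('a \<times> 'a) measure"
  have [measurable]: "f \<in> borel_measurable ?P" using assms by auto
  have "integrable (distr ?P ?P (\<lambda>p. (fst p, fst p + snd p))) f"
    using assms by (simp add: distr_lborel_shear)
  then show "integrable ?P (\<lambda>p. f (fst p, fst p + snd p))"
    by (rule integrable_distr[rotated]) measurable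
  have "integral\<^sup>L (distr ?P ?P (\<lambda>p. (fst p, fst p + snd p))) f = (LINT p|?P. f (fst p, fst p + snd p))"
    by (rule integral_distr) measurable
  then show "(LINT p|?P. f (fst p, fst p + snd p)) = integral\<^sup>L ?P f"
    by (simp add: distr_lborel_shear)
qed

lemma nn_integral_shear:
  fixes f :: "'a::euclidean_space \<times> 'a \<Rightarrow> ennreal"
  assumes [measurable]: "f \<in> borel_measurable (lborel \<Otimes>\<^sub>M lborel)"
  shows "integral\<^sup>N (lborel \<Otimes>\<^sub>M lborel) f = (\<integral>\<^sup>+h. \<integral>\<^sup>+x. f (x, x + h) \<partial>lborel \<partial>lborel)"
proof -
  let ?P = "lborel \<Otimes>\<^sub>M lborel :: ('a \<times> 'a) measure"
  have "integral\<^sup>N ?P f = integral\<^sup>N (distr ?P ?P (\<lambda>p. (fst p, fst p + snd p))) f"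
    by (simp add: distr_lborel_shear)
  also have "\<dots> = (\<integral>\<^sup>+p. f (fst p, fst p + snd p) \<partial>?P)"
    by (rule nn_integral_distr) measurable
  also have "\<dots> = (\<integral>\<^sup>+h. \<integral>\<^sup>+x. f (x, x + h) \<partial>lborel \<partial>lborel)"
    by (subst lborel_pair.nn_integral_snd[symmetric]) auto
  finally show ?thesis .
qed

lemma integral_lborel_translate:
  fixes f :: "'a::euclidean_space \<Rightarrow> real"
  assumes [measurable]: "f \<in> borel_measurable borel"
  shows "(LINT x|lborel. f (x + h)) = (LINT x|lborel. f x)"
proof -
  have "(LINT x|lborel. f x) = (LINT x|distr lborel borel ((+) h). f x)"
    by (simp add: lborel_distr_plus)
  also have "\<dots> = (LINT x|lborel. f (h + x))"
    by (rule integral_distr) measurable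
  finally show ?thesis by (simp add: add.commute)
qed

lemma integrable_lborel_translate:
  fixes f :: "'a::euclidean_space \<Rightarrow> real"
  assumes "integrable lborel f"
  shows "integrable lborel (\<lambda>x. f (x + h))"
proof -
  have "integrable (distr lborel borel ((+) h)) f"
    using assms by (simp add: lborel_distr_plus)
  then have "integrable lborel (\<lambda>x. f (h + x))"
    by (rule integrable_distr[rotated]) measurable
  then show ?thesis by (simp add: add.commute)
qed

text \<open>A truncated paraboloid is preferred to a smooth bump because its second differences can
  be computed exactly. At the edge of the ball it has a kink, but a convex one, which does no harm
  to the one-sided bound that is needed.\<close>

definition cutoff :: "'a::euclidean_space \<Rightarrow> real \<Rightarrow> 'a \<Rightarrow> real" where
  "cutoff a \<rho> x = max 0 (1 - (norm (x - a) / \<rho>)\<^sup>2)"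

lemma cutoff_nonneg [simp]: "0 \<le> cutoff a \<rho> x"
  by (simp add: cutoff_def)

lemma cutoff_le_1 [simp]: "cutoff a \<rho> x \<le> 1"
  by (simp add: cutoff_def)

lemma cutoff_eq_0:
  assumes "0 < \<rho>" "x \<notin> ball a \<rho>"
  shows "cutoff a \<rho> x = 0"
proof -
  have "1 \<le> norm (x - a) / \<rho>" using assms by (simp add: dist_norm norm_minus_commute)
  then show ?thesis by (simp add: cutoff_def one_le_power)
qed

lemma cutoff_ge: "1 - (norm (x - a) / \<rho>)\<^sup>2 \<le> cutoff a \<rho> x"
  by (simp add: cutoff_def)

lemma cutoff_measurable [measurable]: "cutoff a \<rho> \<in> borel_measurable borel"
  unfolding cutoff_def by measurable

text \<open>The cutoff is 1 - t^2, where \<open>t\<close> takes values in [0, 1] and has Lipschitz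
  constant 1/\<rho>; the difference factors as (t' - t)(t' + t). The 1 in the minimum comes from the
  range of the cutoff.\<close>

lemma cutoff_diff_le:
  assumes "0 < \<rho>"
  shows "(cutoff a \<rho> x - cutoff a \<rho> (x + h))\<^sup>2 \<le> 4 * min ((norm h / \<rho>)\<^sup>2) 1"
proof -
  define t where "t = (\<lambda>x. min (norm (x - a) / \<rho>) 1)"
  have t: "0 \<le> t x" "t x \<le> 1" for x using assms by (auto simp: t_def)
  have c: "cutoff a \<rho> x = 1 - (t x)\<^sup>2" for x
  proof (cases "norm (x - a) / \<rho> \<le> 1")
    case True
    moreover from this have "(norm (x - a) / \<rho>)\<^sup>2 \<le> 1"
      using assms by (intro power_le_one) auto
    ultimately show ?thesis by (simp add: cutoff_def t_def)
  next
    case False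
    then have "1 \<le> (norm (x - a) / \<rho>)\<^sup>2" by (intro one_le_power) auto
    then show ?thesis using False by (simp add: cutoff_def t_def)
  qed
  have "\<bar>norm (x + h - a) - norm (x - a)\<bar> \<le> norm h"
    using norm_triangle_ineq3[of "x + h - a" "x - a"] by (simp add: algebra_simps)
  then have "\<bar>norm (x + h - a) / \<rho> - norm (x - a) / \<rho>\<bar> \<le> norm h / \<rho>"
    using assms by (simp add: diff_divide_distrib[symmetric] divide_right_mono)
  then have dt: "\<bar>t (x + h) - t x\<bar> \<le> norm h / \<rho>"
    unfolding t_def by (simp add: min_def abs_le_iff)
  have "cutoff a \<rho> x - cutoff a \<rho> (x + h) = (t (x + h) - t x) * (t (x + h) + t x)"
    by (simp add: c power2_eq_square algebra_simps)
  then have "\<bar>cutoff a \<rho> x - cutoff a \<rho> (x + h)\<bar> = \<bar>t (x + h) - t x\<bar> * \<bar>t (x + h) + t x\<bar>"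
    by (simp add: abs_mult)
  also have "\<dots> \<le> norm h / \<rho> * 2"
    using dt t[of x] t[of "x + h"] assms by (intro mult_mono) auto
  finally have "\<bar>cutoff a \<rho> x - cutoff a \<rho> (x + h)\<bar>\<^sup>2 \<le> (norm h / \<rho> * 2)\<^sup>2"
    by (intro power_mono) auto
  then have 1: "(cutoff a \<rho> x - cutoff a \<rho> (x + h))\<^sup>2 \<le> 4 * (norm h / \<rho>)\<^sup>2"
    by (simp add: power_mult_distrib power_divide mult.commute)
  have "\<bar>cutoff a \<rho> x - cutoff a \<rho> (x + h)\<bar> \<le> 1"
    using cutoff_nonneg[of a \<rho> x] cutoff_nonneg[of a \<rho> "x + h"]
      cutoff_le_1[of a \<rho> x] cutoff_le_1[of a \<rho> "x + h"] by linarith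
  then have "\<bar>cutoff a \<rho> x - cutoff a \<rho> (x + h)\<bar>\<^sup>2 \<le> 1"
    by (intro power_le_one) auto
  then show ?thesis using 1 by (auto simp: min_def)
qed

text \<open>Where the cutoff is positive, it equals the paraboloid at \<open>x\<close> and lies
  above it at both neighbours, so the parallelogram law gives the bound. Where it vanishes, the
  left-hand side is not positive.\<close>

lemma cutoff_second_difference_le:
  assumes "0 < \<rho>"
  shows "2 * cutoff a \<rho> x - cutoff a \<rho> (x + h) - cutoff a \<rho> (x - h) \<le> 2 * min ((norm h / \<rho>)\<^sup>2) 1"
proof -
  have 1: "2 * cutoff a \<rho> x - cutoff a \<rho> (x + h) - cutoff a \<rho> (x - h) \<le> 2"
    using cutoff_le_1[of a \<rho> x] cutoff_nonneg[of a \<rho> "x + h"] cutoff_nonneg[of a \<rho> "x - h"] by linarith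
  have "2 * cutoff a \<rho> x - cutoff a \<rho> (x + h) - cutoff a \<rho> (x - h) \<le> 2 * (norm h / \<rho>)\<^sup>2"
  proof (cases "cutoff a \<rho> x = 0")
    case True
    have "0 \<le> 2 * (norm h / \<rho>)\<^sup>2" by simp
    then show ?thesis
      using True cutoff_nonneg[of a \<rho> "x + h"] cutoff_nonneg[of a \<rho> "x - h"] by linarith
  next
    case False
    then have "cutoff a \<rho> x = 1 - (norm (x - a) / \<rho>)\<^sup>2"
      by (auto simp: cutoff_def max_def split: if_splits)
    moreover have "(norm (x + h - a) / \<rho>)\<^sup>2 + (norm (x - h - a) / \<rho>)\<^sup>2
        = 2 * (norm (x - a) / \<rho>)\<^sup>2 + 2 * (norm h / \<rho>)\<^sup>2"
      by (simp add: power_divide add_divide_distrib[symmetric] power2_norm_eq_inner algebra_simps inner_commute)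
    ultimately show ?thesis
      using cutoff_ge[of "x + h" a \<rho>] cutoff_ge[of "x - h" a \<rho>] by linarith
  qed
  then show ?thesis using 1 by (auto simp: min_def)
qed

lemma frac_kernel_minus [simp]: "frac_kernel s (- h) = frac_kernel s h"
  by (simp add: frac_kernel_def)

text \<open>After the shear the integrand vanishes unless \<open>x\<close> or \<open>x + h\<close>
  lies in the ball. For each \<open>h\<close> this leaves at most twice the measure of the ball,
  multiplied by an integrand that the kernel moment controls.\<close>

lemma finite_energy_cutoff:
  fixes a :: "'a::euclidean_space"
  assumes s: "0 < s" "s < 1" and \<rho>: "0 < \<rho>"
  shows "finite_energy s (cutoff a \<rho>)"
  unfolding finite_energy_def
proof (intro conjI integrableI_nonneg)
  let ?m = "\<lambda>h. min ((norm (h::'a) / \<rho>)\<^sup>2) 1"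
  let ?f = "\<lambda>p. (cutoff a \<rho> (fst p) - cutoff a \<rho> (snd p))\<^sup>2 * frac_kernel s (fst p - snd p)"
  let ?B = "ball a \<rho>"
  obtain C where C: "(\<integral>\<^sup>+h. ennreal (?m h * frac_kernel s h) \<partial>lborel) \<le> ennreal (C * \<rho> powr (- 2 * s))"
    using kernel_moment_bound[OF s] \<rho> by metis
  have [measurable]: "?B \<in> sets borel" by (simp add: borel_open)
  show "cutoff a \<rho> \<in> borel_measurable borel" by measurable
  show "?f \<in> borel_measurable (lborel \<Otimes>\<^sub>M lborel)" by measurable
  show "AE p in lborel \<Otimes>\<^sub>M lborel. 0 \<le> ?f p" by simp
  have shift: "(\<integral>\<^sup>+x. indicator ?B (x + h) \<partial>lborel) = emeasure lborel ?B" for h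
  proof -
    have "(\<integral>\<^sup>+x. indicator ?B x \<partial>distr lborel borel ((+) h)) = (\<integral>\<^sup>+x. indicator ?B (h + x) \<partial>lborel)"
      by (rule nn_integral_distr) measurable
    then show ?thesis by (simp add: lborel_distr_plus add.commute)
  qed
  have le: "ennreal (?f (x, x + h)) \<le> 4 * ennreal (?m h * frac_kernel s h) * (indicator ?B x + indicator ?B (x + h))" for x h
  proof (cases "x \<in> ?B \<or> x + h \<in> ?B")
    case True
    have "?f (x, x + h) \<le> 4 * ?m h * frac_kernel s h"
      using cutoff_diff_le[OF \<rho>, of a x h] by (auto intro!: mult_right_mono)
    then have "ennreal (?f (x, x + h)) \<le> ennreal (4 * (?m h * frac_kernel s h))"
      by (intro ennreal_leI) (simp add: mult.assoc)
    also have "\<dots> = 4 * ennreal (?m h * frac_kernel s h)"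
      by (simp add: ennreal_mult')
    also have "\<dots> = 4 * ennreal (?m h * frac_kernel s h) * 1" by simp
    also have "\<dots> \<le> 4 * ennreal (?m h * frac_kernel s h) * (indicator ?B x + indicator ?B (x + h))"
      using True by (intro mult_left_mono) (auto simp: indicator_def)
    finally show ?thesis .
  next
    case False
    then show ?thesis using \<rho> by (simp add: cutoff_eq_0)
  qed
  have "integral\<^sup>N (lborel \<Otimes>\<^sub>M lborel) (\<lambda>p. ennreal (?f p)) = (\<integral>\<^sup>+h. \<integral>\<^sup>+x. ennreal (?f (x, x + h)) \<partial>lborel \<partial>lborel)"
    by (rule nn_integral_shear) measurable
  also have "\<dots> \<le> (\<integral>\<^sup>+h. \<integral>\<^sup>+x. 4 * ennreal (?m h * frac_kernel s h) * (indicator ?B x + indicator ?B (x + h)) \<partial>lborel \<partial>lborel)"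
    by (intro nn_integral_mono le)
  also have "\<dots> = (\<integral>\<^sup>+h. (4 * ennreal (?m h * frac_kernel s h)) * (2 * emeasure lborel ?B) \<partial>lborel)"
  proof (rule nn_integral_cong)
    fix h :: 'a
    have "(\<integral>\<^sup>+x. 4 * ennreal (?m h * frac_kernel s h) * (indicator ?B x + indicator ?B (x + h)) \<partial>lborel)
      = 4 * ennreal (?m h * frac_kernel s h) * (\<integral>\<^sup>+x. indicator ?B x + indicator ?B (x + h) \<partial>lborel)"
      by (rule nn_integral_cmult) measurable
    also have "(\<integral>\<^sup>+x. indicator ?B x + indicator ?B (x + h) \<partial>lborel)
      = (\<integral>\<^sup>+x. indicator ?B x \<partial>lborel) + (\<integral>\<^sup>+x. indicator ?B (x + h) \<partial>lborel)"
      by (rule nn_integral_add) measurable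
    also have "\<dots> = 2 * emeasure lborel ?B"
      by (simp add: shift mult_2)
    finally show "(\<integral>\<^sup>+x. 4 * ennreal (?m h * frac_kernel s h) * (indicator ?B x + indicator ?B (x + h)) \<partial>lborel)
      = (4 * ennreal (?m h * frac_kernel s h)) * (2 * emeasure lborel ?B)" .
  qed
  also have "\<dots> = 4 * (\<integral>\<^sup>+h. ennreal (?m h * frac_kernel s h) \<partial>lborel) * (2 * emeasure lborel ?B)"
    by (subst nn_integral_multc, measurable) (subst nn_integral_cmult, auto)
  also have "\<dots> \<le> 4 * ennreal (C * \<rho> powr (- 2 * s)) * (2 * emeasure lborel ?B)"
    by (intro mult_right_mono mult_left_mono C) auto
  also have "\<dots> < \<infinity>"
    using emeasure_lborel_ball_finite[of a \<rho>] by (auto simp: ennreal_mult_less_top)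
  finally show "integral\<^sup>N (lborel \<Otimes>\<^sub>M lborel) (\<lambda>p. ennreal (?f p)) < \<infinity>" .
qed

text \<open>This is an integration by parts at fixed \<open>h\<close>: substituting
  \<open>x - h\<close> for \<open>x\<close> in the term with \<open>v (x + h)\<close> moves the
  difference onto the cutoff and leaves its second difference multiplied by \<open>v x\<close>. At
  fixed \<open>h\<close> all integrals converge, so no principal value occurs. As \<open>v\<close>
  is nonnegative, the one-sided bound on the second difference suffices.\<close>

lemma frac_bilinear_cutoff_le:
  fixes a :: "'a::euclidean_space"
  assumes s: "0 < s" "s < 1" and \<rho>: "0 < \<rho>" and "0 < C"
    and C: "(\<integral>\<^sup>+h. ennreal (min ((norm h / \<rho>)\<^sup>2) 1 * frac_kernel s (h::'a)) \<partial>lborel)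
      \<le> ennreal (C * \<rho> powr (- 2 * s))"
    and v: "finite_energy s v" "\<And>x. 0 \<le> v x" "integrable lborel v"
  shows "frac_bilinear s (cutoff a \<rho>) v \<le> 2 * C * \<rho> powr (- 2 * s) * (LINT x|lborel. v x)"
proof -
  let ?m = "\<lambda>h. min ((norm (h::'a) / \<rho>)\<^sup>2) 1"
  let ?c = "cutoff a \<rho>"
  define F where "F = (\<lambda>p. (?c (fst p) - ?c (snd p)) * (v (fst p) - v (snd p)) * frac_kernel s (fst p - snd p))"
  have [measurable]: "v \<in> borel_measurable borel" using v(1) by (simp add: finite_energy_def)
  have F: "integrable (lborel \<Otimes>\<^sub>M lborel) F"
    unfolding F_def by (rule integrable_frac_bilinear[OF finite_energy_cutoff[OF s \<rho>] v(1)])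
  have I: "0 \<le> (LINT x|lborel. v x)" using v by simp
  have mK: "integrable lborel (\<lambda>h. ?m h * frac_kernel s h)"
    using C by (intro integrableI_nonneg) (auto simp: le_less_trans)
  have mK_le: "(LINT h|lborel. ?m h * frac_kernel s h) \<le> C * \<rho> powr (- 2 * s)"
  proof -
    have "ennreal (LINT h|lborel. ?m h * frac_kernel s h) = (\<integral>\<^sup>+h. ennreal (?m h * frac_kernel s h) \<partial>lborel)"
      by (rule nn_integral_eq_integral[symmetric]) (use mK in auto)
    also have "\<dots> \<le> ennreal (C * \<rho> powr (- 2 * s))" by (rule C)
    finally show ?thesis using \<open>0 < C\<close> by (simp add: ennreal_le_iff)
  qed
  have inner: "(LINT x|lborel. F (x, x + h)) \<le> 2 * (?m h * frac_kernel s h) * (LINT x|lborel. v x)" for h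
  proof -
    define d where "d = (\<lambda>x. ?c x - ?c (x + h))"
    have [measurable]: "d \<in> borel_measurable borel" unfolding d_def by measurable
    have d: "\<bar>d x\<bar> \<le> 1" for x
      using cutoff_nonneg[of a \<rho> x] cutoff_nonneg[of a \<rho> "x + h"]
        cutoff_le_1[of a \<rho> x] cutoff_le_1[of a \<rho> "x + h"] unfolding d_def by linarith
    have bd: "integrable lborel (\<lambda>x. e x * w x)"
      if [measurable]: "e \<in> borel_measurable borel" and e: "\<And>x. \<bar>e x\<bar> \<le> 1" and w: "integrable lborel w"
      for e w :: "'a \<Rightarrow> real"
    proof (rule Bochner_Integration.integrable_bound[OF w])
      show "(\<lambda>x. e x * w x) \<in> borel_measurable lborel" using w by measurable
      show "AE x in lborel. norm (e x * w x) \<le> norm (w x)"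
        using e by (intro AE_I2) (simp add: abs_mult mult_left_le_one_le)
    qed
    have i1: "integrable lborel (\<lambda>x. d x * v x)" by (rule bd) (use d v in auto)
    have i2: "integrable lborel (\<lambda>x. d x * v (x + h))"
      by (rule bd) (use d integrable_lborel_translate[OF v(3)] in auto)
    have i3: "integrable lborel (\<lambda>x. d (x - h) * v x)" by (rule bd) (use d v in auto)
    have "(LINT x|lborel. F (x, x + h)) = (LINT x|lborel. (d x * v x - d x * v (x + h)) * frac_kernel s h)"
      by (intro Bochner_Integration.integral_cong) (auto simp: F_def d_def algebra_simps)
    also have "\<dots> = ((LINT x|lborel. d x * v x) - (LINT x|lborel. d x * v (x + h))) * frac_kernel s h"
      using i1 i2 by simp
    also have "(LINT x|lborel. d x * v (x + h)) = (LINT x|lborel. d (x - h) * v x)"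
      using integral_lborel_translate[of "\<lambda>x. d (x - h) * v x" h] by simp
    also have "(LINT x|lborel. d x * v x) - (LINT x|lborel. d (x - h) * v x)
        = (LINT x|lborel. (2 * ?c x - ?c (x + h) - ?c (x - h)) * v x)"
      using i1 i3 by (subst Bochner_Integration.integral_diff[symmetric])
        (auto simp: d_def algebra_simps intro!: Bochner_Integration.integral_cong)
    also have "\<dots> \<le> (LINT x|lborel. 2 * ?m h * v x)"
    proof (rule integral_mono)
      have "integrable lborel (\<lambda>x. d x * v x - d (x - h) * v x)"
        using i1 i3 by (rule Bochner_Integration.integrable_diff)
      then show "integrable lborel (\<lambda>x. (2 * ?c x - ?c (x + h) - ?c (x - h)) * v x)"
        by (rule Bochner_Integration.integrable_cong[THEN iffD1, rotated 2]) (auto simp: d_def algebra_simps)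
      show "integrable lborel (\<lambda>x. 2 * ?m h * v x)"
        using v(3) by (rule integrable_mult_right)
      show "(2 * ?c x - ?c (x + h) - ?c (x - h)) * v x \<le> 2 * ?m h * v x" for x
        by (intro mult_right_mono cutoff_second_difference_le \<rho> v)
    qed
    also have "(LINT x|lborel. 2 * ?m h * v x) = 2 * ?m h * (LINT x|lborel. v x)" by simp
    finally show ?thesis
      by (simp add: mult_ac mult_right_mono)
  qed
  have sF: "integrable (lborel \<Otimes>\<^sub>M lborel) (\<lambda>(x, h). F (x, x + h))"
    using integral_shear(1)[OF F] by (simp add: case_prod_unfold)
  have "frac_bilinear s ?c v = integral\<^sup>L (lborel \<Otimes>\<^sub>M lborel) F"
    by (simp add: frac_bilinear_def F_def)
  also have "\<dots> = (LINT p|(lborel \<Otimes>\<^sub>M lborel). F (fst p, fst p + snd p))"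
    by (rule integral_shear(2)[OF F, symmetric])
  also have "\<dots> = (LINT h|lborel. LINT x|lborel. F (x, x + h))"
    using lborel_pair.integral_snd[OF sF] by (simp add: case_prod_unfold)
  also have "\<dots> \<le> (LINT h|lborel. 2 * (?m h * frac_kernel s h) * (LINT x|lborel. v x))"
  proof (rule integral_mono)
    show "integrable lborel (\<lambda>h. LINT x|lborel. F (x, x + h))"
      by (rule lborel_pair.integrable_snd[OF sF])
    show "integrable lborel (\<lambda>h. 2 * (?m h * frac_kernel s h) * (LINT x|lborel. v x))"
      using mK by (intro integrable_mult_left integrable_mult_right)
  qed (rule inner)
  also have "\<dots> = 2 * (LINT h|lborel. ?m h * frac_kernel s h) * (LINT x|lborel. v x)"
    by simp
  also have "\<dots> \<le> 2 * (C * \<rho> powr (- 2 * s)) * (LINT x|lborel. v x)"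
    by (intro mult_right_mono mult_left_mono mK_le I) auto
  finally show ?thesis by (simp add: mult_ac)
qed

section \<open>The Stampacchia estimate\<close>

text \<open>Along the levels \<open>k n\<close> = d (1 - 2^(-n)) the values of \<open>A\<close>
  decrease at least like \<open>q ^ n\<close>. The ratio \<open>q\<close> is chosen with
  \<open>q powr \<kappa> = 1 / 2\<close>, which cancels the factor 2^n lost through the shrinking
  gaps between levels; the lower bound on \<open>d\<close> is exactly what the induction step asks
  for.\<close>

lemma stampacchia_iteration:
  fixes A :: "real \<Rightarrow> real"
  assumes \<kappa>: "0 < \<kappa>" and B: "0 \<le> B" and A: "\<And>k. 0 \<le> A k"
    and mono: "\<And>k h. 0 \<le> k \<Longrightarrow> k \<le> h \<Longrightarrow> A h \<le> A k"
    and decay: "\<And>k h. 0 \<le> k \<Longrightarrow> k < h \<Longrightarrow> (h - k) * A h \<le> B * A k powr (1 + \<kappa>)"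
    and d: "0 < d" "2 * 2 powr (1 / \<kappa>) * B * A 0 powr \<kappa> \<le> d"
  shows "A d = 0"
proof -
  define q where "q = 2 powr (- 1 / \<kappa>)"
  define k where "k = (\<lambda>n::nat. d * (1 - 1 / 2 ^ n))"
  have q: "0 < q" "q < 1"
    using \<kappa> powr_less_mono[of "- 1 / \<kappa>" 0 2] by (auto simp: q_def)
  have q\<kappa>: "q powr \<kappa> = 1 / 2"
    unfolding q_def powr_powr using \<kappa> by (simp add: powr_minus)
  have k: "0 \<le> k n" "k n < k (Suc n)" "k (Suc n) - k n = d / 2 ^ Suc n" "k n \<le> d" for n
    using d(1) by (auto simp: k_def field_simps)
  have step: "2 * B * A 0 powr \<kappa> \<le> d * q"
  proof -
    have "2 powr (1 / \<kappa>) * q = 1" by (simp add: q_def powr_add[symmetric])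
    then have "2 * B * A 0 powr \<kappa> = (2 * 2 powr (1 / \<kappa>) * B * A 0 powr \<kappa>) * q"
      by (simp add: algebra_simps)
    also have "\<dots> \<le> d * q" using d q by (intro mult_right_mono) auto
    finally show ?thesis .
  qed
  have bound: "A (k n) \<le> A 0 * q ^ n" for n
  proof (induction n)
    case 0
    then show ?case by (simp add: k_def)
  next
    case (Suc n)
    have "(d / 2 ^ Suc n) * A (k (Suc n)) \<le> B * A (k n) powr (1 + \<kappa>)"
      using decay[OF k(1,2), of n] by (simp add: k(3))
    also have "\<dots> \<le> B * (A 0 * q ^ n) powr (1 + \<kappa>)"
      using Suc A B \<kappa> by (intro mult_left_mono powr_mono2) auto
    also have "(A 0 * q ^ n) powr (1 + \<kappa>) = (A 0 * q ^ n) * (A 0 powr \<kappa> * (1 / 2) ^ n)"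
      using A[of 0] q power_powr_commute[of q n \<kappa>]
      by (cases "A 0 = 0") (simp_all add: powr_add powr_mult q\<kappa> power_divide)
    finally have "d * A (k (Suc n)) \<le> (2 * B * A 0 powr \<kappa>) * (A 0 * q ^ n)"
      by (simp add: field_simps)
    also have "\<dots> \<le> d * q * (A 0 * q ^ n)"
      using step A[of 0] q by (intro mult_right_mono) auto
    finally have "d * A (k (Suc n)) \<le> d * (A 0 * q ^ Suc n)" by (simp add: mult_ac)
    then show ?case using d(1) by simp
  qed
  have "(\<lambda>n. A 0 * q ^ n) \<longlonglongrightarrow> A 0 * 0"
    using q by (intro tendsto_intros LIMSEQ_realpow_zero) auto
  moreover have "A d \<le> A 0 * q ^ n" for n
    using mono[OF k(1,4), of n] bound[of n] by linarith
  ultimately have "A d \<le> A 0 * 0"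
    by (intro LIMSEQ_le_const) auto
  then show ?thesis using A[of d] by simp
qed

text \<open>The ball around \<open>x\<close> with twice the measure of \<open>A\<close> has radius
  \<open>R\<close>, and at least half of it lies outside \<open>A\<close>. There the kernel is at
  least its value at distance \<open>R\<close>. The constant \<open>c\<close> results from
  expressing \<open>R\<close> through the measure of \<open>A\<close>.\<close>

lemma kernel_mass_outside_ge:
  fixes A :: "'a::euclidean_space set" and s :: real
  defines "c \<equiv> (2 / unit_ball_vol DIM('a)) powr - (1 + 2 * s / DIM('a))"
  assumes s: "0 < s" and [measurable]: "A \<in> sets borel"
    and fin: "emeasure lborel A < \<infinity>" and pos: "0 < measure lborel A" and x: "x \<in> A"
  shows "ennreal (c * measure lborel A powr (- 2 * s / DIM('a)))
    \<le> (\<integral>\<^sup>+y. ennreal (frac_kernel s (x - y)) * indicator (- A) y \<partial>lborel)"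
proof -
  let ?N = "real DIM('a)"
  let ?v = "unit_ball_vol ?N"
  let ?m = "measure lborel A"
  have v: "0 < ?v" "?v \<noteq> 0" using unit_ball_vol_pos[of ?N, OF of_nat_0_le_iff] by (blast, metis less_irrefl)
  define R where "R = (2 * ?m / ?v) powr (1 / ?N)"
  have R: "0 < R" using v pos by (simp add: R_def)
  have [measurable]: "ball x R \<in> sets borel" by (simp add: borel_open)
  have RN: "R ^ DIM('a) = 2 * ?m / ?v"
    using v pos by (simp add: R_def powr_realpow[symmetric] powr_powr)
  have RK: "1 / R powr (?N + 2 * s) * ?m = c * ?m powr (- 2 * s / ?N)"
  proof -
    have "1 / R powr (?N + 2 * s) = R powr - (?N + 2 * s)" by (rule powr_minus_divide[symmetric])
    also have "\<dots> = (2 * ?m / ?v) powr - (1 + 2 * s / ?N)"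
      unfolding R_def powr_powr by (simp add: add_divide_distrib diff_divide_distrib)
    also have "\<dots> = c * ?m powr - (1 + 2 * s / ?N)"
      unfolding c_def using v pos by (subst powr_mult[symmetric]) auto
    also have "?m powr - (1 + 2 * s / ?N) = ?m powr (- 2 * s / ?N) / ?m"
      using pos powr_diff[of ?m "- 2 * s / ?N" 1] by (simp add: minus_diff_commute)
    finally show ?thesis using pos by simp
  qed
  have mb: "emeasure lborel (ball x R) = ennreal (2 * ?m)"
    using R v by (subst emeasure_ball) (auto simp: RN)
  have mA: "emeasure lborel A = ennreal ?m"
    using fin by (intro emeasure_eq_ennreal_measure) auto
  have "ennreal ?m = ennreal (2 * ?m) - ennreal ?m"
    using pos by (subst ennreal_minus) auto
  also have "\<dots> \<le> emeasure lborel (ball x R) - emeasure lborel (A \<inter> ball x R)"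
    unfolding mb mA[symmetric] by (intro ennreal_minus_mono emeasure_mono order_refl) auto
  also have "\<dots> = emeasure lborel (ball x R - A \<inter> ball x R)"
    by (rule emeasure_Diff[symmetric]) (use emeasure_mono[of "A \<inter> ball x R" A lborel] fin in \<open>auto simp: top_unique\<close>)
  also have "ball x R - A \<inter> ball x R = ball x R \<inter> - A" by auto
  finally have m: "ennreal ?m \<le> emeasure lborel (ball x R \<inter> - A)" .
  have "ennreal (c * ?m powr (- 2 * s / ?N)) = ennreal (1 / R powr (?N + 2 * s)) * ennreal ?m"
    by (subst RK[symmetric], subst ennreal_mult') auto
  also have "\<dots> \<le> ennreal (1 / R powr (?N + 2 * s)) * emeasure lborel (ball x R \<inter> - A)"
    by (intro mult_left_mono m) auto
  also have "\<dots> = (\<integral>\<^sup>+y. ennreal (1 / R powr (?N + 2 * s)) * indicator (ball x R \<inter> - A) y \<partial>lborel)"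
    by (rule nn_integral_cmult_indicator[symmetric]) auto
  also have "\<dots> \<le> (\<integral>\<^sup>+y. ennreal (frac_kernel s (x - y)) * indicator (- A) y \<partial>lborel)"
  proof (rule nn_integral_mono)
    fix y
    show "ennreal (1 / R powr (?N + 2 * s)) * indicator (ball x R \<inter> - A) y
        \<le> ennreal (frac_kernel s (x - y)) * indicator (- A) y"
    proof (cases "y \<in> ball x R \<inter> - A")
      case True
      then have "0 < norm (x - y)" "norm (x - y) \<le> R" using x by (auto simp: dist_norm)
      then have "1 / R powr (?N + 2 * s) \<le> frac_kernel s (x - y)"
        unfolding frac_kernel_def using s R by (intro divide_left_mono powr_mono2) auto
      then show ?thesis using True by (simp add: ennreal_leI)
    qed auto
  qed
  finally show ?thesis .
qed

text \<open>Of the double integral only the pairs with one point in \<open>A'\<close> and the other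
  outside \<open>A\<close> are kept. On them the difference of \<open>v\<close> is exactly
  \<open>t\<close>, and the kernel has the mass just estimated.\<close>

lemma fractional_Faber_Krahn:
  fixes v :: "'a::euclidean_space \<Rightarrow> real" and s :: real
  defines "c \<equiv> (2 / unit_ball_vol DIM('a)) powr - (1 + 2 * s / DIM('a))"
  assumes s: "0 < s" and v: "finite_energy s v"
    and [measurable]: "A \<in> sets borel" "A' \<in> sets borel"
    and fin: "emeasure lborel A < \<infinity>" and pos: "0 < measure lborel A" and "A' \<subseteq> A"
    and t: "\<And>x. x \<in> A' \<Longrightarrow> v x = t" and zero: "\<And>x. x \<notin> A \<Longrightarrow> v x = 0"
  shows "t\<^sup>2 * (c * measure lborel A powr (- 2 * s / DIM('a))) * measure lborel A' \<le> frac_bilinear s v v"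
proof -
  let ?g = "\<lambda>p. (v (fst p) - v (snd p))\<^sup>2 * frac_kernel s (fst p - snd p)"
  let ?m = "c * measure lborel A powr (- 2 * s / DIM('a))"
  have [measurable]: "v \<in> borel_measurable borel" using v by (simp add: finite_energy_def)
  have g: "integrable (lborel \<Otimes>\<^sub>M lborel) ?g" using v by (simp add: finite_energy_def)
  have eq: "frac_bilinear s v v = integral\<^sup>L (lborel \<Otimes>\<^sub>M lborel) ?g"
    by (simp add: frac_bilinear_def power2_eq_square)
  have "emeasure lborel A' \<le> emeasure lborel A"
    using \<open>A' \<subseteq> A\<close> by (intro emeasure_mono) auto
  then have A': "emeasure lborel A' = ennreal (measure lborel A')"
    using fin by (intro emeasure_eq_ennreal_measure) auto
  have "ennreal (t\<^sup>2 * ?m * measure lborel A') = ennreal (t\<^sup>2 * ?m) * emeasure lborel A'"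
    by (simp add: A' ennreal_mult' c_def)
  also have "\<dots> = (\<integral>\<^sup>+x. ennreal (t\<^sup>2 * ?m) * indicator A' x \<partial>lborel)"
    by (rule nn_integral_cmult_indicator[symmetric]) auto
  also have "\<dots> \<le> (\<integral>\<^sup>+x. \<integral>\<^sup>+y. ennreal (?g (x, y)) \<partial>lborel \<partial>lborel)"
  proof (rule nn_integral_mono)
    fix x
    show "ennreal (t\<^sup>2 * ?m) * indicator A' x \<le> (\<integral>\<^sup>+y. ennreal (?g (x, y)) \<partial>lborel)"
    proof (cases "x \<in> A'")
      case True
      then have x: "x \<in> A" using \<open>A' \<subseteq> A\<close> by auto
      have "ennreal (t\<^sup>2 * ?m) * indicator A' x = ennreal (t\<^sup>2) * ennreal ?m"
        using True by (simp add: ennreal_mult' c_def)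
      also have "\<dots> \<le> ennreal (t\<^sup>2) * (\<integral>\<^sup>+y. ennreal (frac_kernel s (x - y)) * indicator (- A) y \<partial>lborel)"
        unfolding c_def by (intro mult_left_mono kernel_mass_outside_ge s fin pos x) auto
      also have "\<dots> = (\<integral>\<^sup>+y. ennreal (t\<^sup>2) * (ennreal (frac_kernel s (x - y)) * indicator (- A) y) \<partial>lborel)"
        by (rule nn_integral_cmult[symmetric]) measurable
      also have "\<dots> \<le> (\<integral>\<^sup>+y. ennreal (?g (x, y)) \<partial>lborel)"
      proof (rule nn_integral_mono)
        fix y show "ennreal (t\<^sup>2) * (ennreal (frac_kernel s (x - y)) * indicator (- A) y) \<le> ennreal (?g (x, y))"
          using zero[of y] t[OF True] by (auto simp: indicator_def ennreal_mult')
      qed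
      finally show ?thesis .
    qed auto
  qed
  also have "\<dots> = (\<integral>\<^sup>+p. ennreal (?g p) \<partial>(lborel \<Otimes>\<^sub>M lborel))"
    by (rule lborel.nn_integral_fst) measurable
  also have "\<dots> = ennreal (frac_bilinear s v v)"
    unfolding eq by (rule nn_integral_eq_integral[OF g]) auto
  finally show ?thesis
    by (subst (asm) ennreal_le_iff) (auto simp: eq)
qed

section \<open>Integrals of the right-hand side over level sets\<close>

lemma Lp_integrable:
  assumes z: "z \<in> Lp_space p \<Omega>" and p: "1 \<le> p" and "bounded \<Omega>" "open \<Omega>"
  shows "integrable (lebesgue_on \<Omega>) z"
proof -
  have \<Omega>: "\<Omega> \<in> lmeasurable"
    using \<open>bounded \<Omega>\<close> \<open>open \<Omega>\<close> by (intro lmeasurable_open)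
  interpret finite_measure "lebesgue_on \<Omega>"
    by (rule finite_measure_lebesgue_on[OF \<Omega>])
  show ?thesis
  proof (rule Bochner_Integration.integrable_bound)
    show "integrable (lebesgue_on \<Omega>) (\<lambda>x. \<bar>z x\<bar> powr p + 1)"
      using z by (intro Bochner_Integration.integrable_add integrable_const) (simp add: Lp_space_def)
    show "z \<in> borel_measurable (lebesgue_on \<Omega>)" using z by (simp add: Lp_space_def)
    show "AE x in lebesgue_on \<Omega>. norm (z x) \<le> norm (\<bar>z x\<bar> powr p + 1)"
    proof (rule AE_I2)
      fix x
      show "norm (z x) \<le> norm (\<bar>z x\<bar> powr p + 1)"
      proof (cases "\<bar>z x\<bar> \<le> 1")
        case True
        then show ?thesis by (simp add: add_increasing)
      next
        case False
        then have "\<bar>z x\<bar> powr 1 \<le> \<bar>z x\<bar> powr p" using p by (intro powr_mono) auto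
        then show ?thesis using False by simp
      qed
    qed
  qed
qed

lemma Lp_norm_nonneg [simp]: "0 \<le> Lp_norm p \<Omega> z"
  by (simp add: Lp_norm_def)

text \<open>This is the Hoelder inequality up to the factor 2. It is obtained by splitting at height
  \<open>t\<close>, where |z| is at most t^(1-p) |z|^p + t, and then balancing the two terms; this
  treats p = 1 together with p > 1.\<close>

lemma Lp_integral_on_set_le:
  fixes \<Omega> :: "'a::euclidean_space set"
  assumes z: "z \<in> Lp_space p \<Omega>" and p: "1 \<le> p" and \<Omega>: "bounded \<Omega>" "open \<Omega>"
    and A[measurable]: "A \<in> sets borel" and fin: "emeasure lborel A < \<infinity>" and pos: "0 < measure lborel A"
  shows "(LINT x|lebesgue_on \<Omega>. \<bar>z x\<bar> * indicator A x)
    \<le> 2 * Lp_norm p \<Omega> z * measure lborel A powr (1 - 1 / p)"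
proof -
  let ?M = "lebesgue_on \<Omega>"
  let ?m = "measure lborel A"
  define I where "I = (LINT x|?M. \<bar>z x\<bar> powr p)"
  define Z where "Z = Lp_norm p \<Omega> z"
  have \<Omega>': "\<Omega> \<in> lmeasurable" using \<Omega> by (intro lmeasurable_open)
  interpret finite_measure ?M by (rule finite_measure_lebesgue_on[OF \<Omega>'])
  have AM [measurable]: "A \<in> sets lebesgue" by (simp add: sets_completionI_sets)
  have AM': "A \<inter> \<Omega> \<in> sets ?M" using AM \<Omega>' by (auto simp: sets_restrict_space)
  have ind: "integrable ?M (indicator A :: _ \<Rightarrow> real)"
  proof -
    have "integrable ?M (indicator (A \<inter> \<Omega>) :: _ \<Rightarrow> real)"
      using AM' by (intro integrable_real_indicator) (auto simp: emeasure_eq_measure)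
    then show ?thesis
      by (rule Bochner_Integration.integrable_cong[THEN iffD1, rotated 2]) (auto simp: indicator_def)
  qed
  have zi: "integrable ?M z" by (rule Lp_integrable[OF z p \<Omega>])
  have zA: "integrable ?M (\<lambda>x. \<bar>z x\<bar> * indicator A x)"
    using integrable_abs[OF zi]
  proof (rule Bochner_Integration.integrable_bound)
    show "(\<lambda>x. \<bar>z x\<bar> * indicator A x) \<in> borel_measurable ?M"
      using zi ind by (intro borel_measurable_times) auto
  qed (auto simp: indicator_def)
  have zp: "integrable ?M (\<lambda>x. \<bar>z x\<bar> powr p)" using z by (simp add: Lp_space_def)
  have mA: "(LINT x|?M. indicator A x) \<le> ?m"
  proof -
    have "(LINT x|?M. indicator A x) = (LINT x|?M. indicator (A \<inter> \<Omega>) x :: real)"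
      by (rule Bochner_Integration.integral_cong) (auto simp: indicator_def)
    also have "\<dots> = measure ?M (A \<inter> \<Omega>)" using AM' by simp
    also have "\<dots> = measure lebesgue (A \<inter> \<Omega>)"
      using \<Omega>' by (subst measure_restrict_space) auto
    also have "\<dots> \<le> measure lebesgue A"
      using AM \<Omega>' fin by (intro measure_mono_fmeasurable) (auto simp: fmeasurable_def)
    also have "\<dots> = ?m" by simp
    finally show ?thesis .
  qed
  have young: "(LINT x|?M. \<bar>z x\<bar> * indicator A x) \<le> t powr (1 - p) * I + t * ?m" if t: "0 < t" for t
  proof -
    have "(LINT x|?M. \<bar>z x\<bar> * indicator A x) \<le> (LINT x|?M. t powr (1 - p) * \<bar>z x\<bar> powr p + t * indicator A x)"
    proof (rule integral_mono)
      show "integrable ?M (\<lambda>x. t powr (1 - p) * \<bar>z x\<bar> powr p + t * indicator A x)"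
        using zp ind by (intro Bochner_Integration.integrable_add integrable_mult_right)
      fix x
      have "\<bar>z x\<bar> \<le> t powr (1 - p) * \<bar>z x\<bar> powr p + t"
      proof (cases "\<bar>z x\<bar> \<le> t")
        case True
        moreover have "0 \<le> t powr (1 - p) * \<bar>z x\<bar> powr p" by simp
        ultimately show ?thesis by linarith
      next
        case False
        have "\<bar>z x\<bar> = \<bar>z x\<bar> powr (1 - p) * \<bar>z x\<bar> powr p"
          using False t by (simp add: powr_add[symmetric])
        also have "\<dots> \<le> t powr (1 - p) * \<bar>z x\<bar> powr p"
          using False t p by (intro mult_right_mono powr_mono2') auto
        finally show ?thesis using t by linarith
      qed
      then show "\<bar>z x\<bar> * indicator A x \<le> t powr (1 - p) * \<bar>z x\<bar> powr p + t * indicator A x"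
        by (auto simp: indicator_def)
    qed (rule zA)
    also have "\<dots> = t powr (1 - p) * I + t * (LINT x|?M. indicator A x)"
      using zp ind by (simp add: I_def)
    also have "\<dots> \<le> t powr (1 - p) * I + t * ?m"
      using mA t by simp
    finally show ?thesis .
  qed
  have Z: "Z = I powr (1 / p)" by (simp add: Z_def Lp_norm_def I_def)
  have I0: "0 \<le> I" by (simp add: I_def)
  show ?thesis
  proof (cases "I = 0")
    case True
    \<comment> \<open>The balancing height would be 0 here, so \<open>t\<close> is sent to 0
      instead.\<close>
    have "(LINT x|?M. \<bar>z x\<bar> * indicator A x) \<le> 0 + e" if "0 < e" for e
      using young[of "e / ?m"] that pos True by simp
    then have "(LINT x|?M. \<bar>z x\<bar> * indicator A x) \<le> 0"
      by (rule field_le_epsilon)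
    also have "0 \<le> 2 * Lp_norm p \<Omega> z * ?m powr (1 - 1 / p)" by simp
    finally show ?thesis .
  next
    case False
    then have Zp: "0 < Z" "I = Z powr p" using I0 p by (auto simp: Z powr_powr)
    \<comment> \<open>At this height both terms of \<open>young\<close> equal
      \<open>Z * ?m powr (1 - 1 / p)\<close>.\<close>
    define t where "t = Z * ?m powr (- 1 / p)"
    have t: "0 < t" using Zp pos by (simp add: t_def)
    have "t powr (1 - p) * I = Z powr (1 - p) * Z powr p * (?m powr (- 1 / p)) powr (1 - p)"
      unfolding t_def Zp(2) using Zp by (subst powr_mult) auto
    also have "Z powr (1 - p) * Z powr p = Z" using Zp by (simp add: powr_add[symmetric])
    also have "(?m powr (- 1 / p)) powr (1 - p) = ?m powr (1 - 1 / p)"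
      unfolding powr_powr using p by (simp add: diff_divide_distrib right_diff_distrib)
    finally have 1: "t powr (1 - p) * I = Z * ?m powr (1 - 1 / p)" .
    have 2: "t * ?m = Z * ?m powr (1 - 1 / p)"
      unfolding t_def using pos by (simp add: powr_diff powr_minus_divide)
    show ?thesis using young[OF t] unfolding 1 2 Z_def by simp
  qed
qed

text \<open>This is the weak problem for a Borel representative. Only bounded test functions occur:
  for them finite energy already gives membership in the test space, and their product with an
  integrable \<open>z\<close> is integrable.\<close>

definition energy_solution ::
  "real \<Rightarrow> 'a::euclidean_space set \<Rightarrow> ('a \<Rightarrow> real) \<Rightarrow> ('a \<Rightarrow> real) \<Rightarrow> bool" where
  "energy_solution s \<Omega> z u \<longleftrightarrow> finite_energy s u \<and> (\<forall>x. x \<notin> \<Omega> \<longrightarrow> u x = 0) \<and>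
     (\<forall>v b. finite_energy s v \<longrightarrow> (\<forall>x. x \<notin> \<Omega> \<longrightarrow> v x = 0) \<longrightarrow> (\<forall>x. \<bar>v x\<bar> \<le> b) \<longrightarrow>
        C_frac DIM('a) s / 2 * frac_bilinear s u v = (LINT x|lebesgue_on \<Omega>. z x * v x))"

text \<open>For k < h the values lie between 0 and h - k. The cap is attained on the whole set where
  t > h, as the Faber--Krahn inequality requires of its set \<open>A'\<close>.\<close>

definition truncation :: "real \<Rightarrow> real \<Rightarrow> real \<Rightarrow> real" where
  "truncation k h t = min (max (t - k) 0) (h - k)"

lemma truncation_contraction: "\<bar>truncation k h a - truncation k h b\<bar> \<le> \<bar>a - b\<bar>"
  by (auto simp: truncation_def min_def max_def)

lemma weak_solution_representative:
  assumes sol: "weak_solution s \<Omega> (Lp_functional \<Omega> z) u" and \<Omega>: "open \<Omega>" "bounded \<Omega>"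
  obtains u' where "energy_solution s \<Omega> z u'" "AE x in lborel. u x = u' x"
proof -
  have u: "u \<in> Ws2_0 s \<Omega>" using sol by (simp add: weak_solution_def)
  have um: "u \<in> borel_measurable lebesgue"
    using u by (auto simp: Ws2_0_def Ws2_def Lp_space_def lebesgue_on_UNIV_eq)
  obtain u' where u': "finite_energy s u'" "AE x in lborel. u x = u' x" "\<And>x. x \<notin> \<Omega> \<Longrightarrow> u' x = 0"
    using Ws2_0_representative[OF u \<Omega>(1)] by blast
  have "energy_solution s \<Omega> z u'"
    unfolding energy_solution_def
  proof (intro conjI allI impI)
    fix v b
    assume v: "finite_energy s v" "\<forall>x. x \<notin> \<Omega> \<longrightarrow> v x = 0" "\<forall>x. \<bar>v x\<bar> \<le> b"
    then have "v \<in> Ws2_0 s \<Omega>"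
      using \<Omega> by (intro finite_energy_imp_Ws2_0[of s v \<Omega> b]) auto
    then have "frac_form s u v = Lp_functional \<Omega> z v"
      using sol by (simp add: weak_solution_def)
    then show "C_frac DIM('a) s / 2 * frac_bilinear s u' v = (LINT x|lebesgue_on \<Omega>. z x * v x)"
      using frac_form_eq_frac_bilinear[OF um u'(2,1) v(1)] by (simp add: Lp_functional_def)
  qed (use u' in auto)
  then show ?thesis using that u'(2) by blast
qed

lemma energy_solution_uminus:
  assumes "energy_solution s \<Omega> z u"
  shows "energy_solution s \<Omega> (\<lambda>x. - z x) (\<lambda>x. - u x)"
  using assms unfolding energy_solution_def
  by (auto simp: finite_energy_uminus frac_bilinear_uminus)

text \<open>The comparison of \<open>frac_bilinear s v v\<close> with
  \<open>frac_bilinear s u v\<close> is left as a hypothesis because it has two sources: for \<phi>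
  = 0 it holds for every truncation, for other comparison functions it needs the interaction with a
  sublevel set. The estimate chains Faber--Krahn for \<open>v\<close>, this hypothesis, the equation
  and the Hoelder bound.\<close>

lemma energy_solution_sup_bound:
  fixes s p :: real
  defines "\<kappa> \<equiv> 2 * s / DIM('a) - 1 / p"
  assumes s: "0 < s" "s < 1" and p: "1 \<le> p" and \<kappa>: "0 < \<kappa>"
  obtains C where "0 < C"
    "\<And>\<Omega> z u \<phi> D. bounded \<Omega> \<Longrightarrow> open \<Omega> \<Longrightarrow> z \<in> Lp_space p \<Omega> \<Longrightarrow> energy_solution s \<Omega> z u \<Longrightarrow>
      finite_energy s \<phi> \<Longrightarrow> (\<And>x. x \<notin> \<Omega> \<Longrightarrow> 0 \<le> \<phi> x) \<Longrightarrow>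
      D \<in> sets borel \<Longrightarrow> emeasure lborel D < \<infinity> \<Longrightarrow> (AE x in lborel. x \<notin> D \<longrightarrow> u x \<le> \<phi> x) \<Longrightarrow>
      (\<And>k h v. 0 \<le> k \<Longrightarrow> k < h \<Longrightarrow> v = (\<lambda>x. truncation k h (u x - \<phi> x)) \<Longrightarrow> finite_energy s v \<Longrightarrow>
         frac_bilinear s v v \<le> frac_bilinear s u v) \<Longrightarrow>
      AE x in lborel. u x \<le> \<phi> x + C * Lp_norm p \<Omega> z * measure lborel (D::'a::euclidean_space set) powr \<kappa>"
proof -
  let ?N = "real DIM('a)"
  let ?F = "C_frac DIM('a) s"
  define c where "c = (2 / unit_ball_vol ?N) powr - (1 + 2 * s / ?N)"
  have F: "0 < ?F" using s by (intro C_frac_pos) auto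
  have "unit_ball_vol ?N \<noteq> 0" using unit_ball_vol_pos[of ?N, OF of_nat_0_le_iff] by (metis less_irrefl)
  then have c: "0 < c" by (simp add: c_def)
  \<comment> \<open>One factor 2 comes from the prefactor C/2 of the form, the other from the
    Hoelder bound; \<open>c\<close> is the Faber--Krahn constant. The factors added in
    \<open>C\<close> are those in the threshold of the Stampacchia iteration.\<close>
  define B0 where "B0 = 4 / (?F * c)"
  define C where "C = 2 * 2 powr (1 / \<kappa>) * B0"
  have B0: "0 < B0" using F c by (simp add: B0_def)
  then have "0 < C" by (simp add: C_def)
  moreover have "AE x in lborel. u x \<le> \<phi> x + C * Lp_norm p \<Omega> z * measure lborel D powr \<kappa>"
    if \<Omega>: "bounded \<Omega>" "open \<Omega>" and z: "z \<in> Lp_space p \<Omega>" and u: "energy_solution s \<Omega> z u"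
      and \<phi>: "finite_energy s \<phi>" "\<And>x. x \<notin> \<Omega> \<Longrightarrow> 0 \<le> \<phi> x"
      and D [measurable]: "D \<in> sets borel" and Dfin: "emeasure lborel D < \<infinity>"
      and D0: "AE x in lborel. x \<notin> D \<longrightarrow> u x \<le> \<phi> x"
      and test: "\<And>k h v. 0 \<le> k \<Longrightarrow> k < h \<Longrightarrow> v = (\<lambda>x. truncation k h (u x - \<phi> x)) \<Longrightarrow> finite_energy s v \<Longrightarrow>
         frac_bilinear s v v \<le> frac_bilinear s u v"
    for \<Omega> z u \<phi> and D :: "'a set"
  proof -
    define Z where "Z = Lp_norm p \<Omega> z"
    have Z: "0 \<le> Z" by (simp add: Z_def)
    define U where "U = (\<lambda>x. u x - \<phi> x)"
    have uf: "finite_energy s u" using u by (simp add: energy_solution_def)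
    have Uf: "finite_energy s U" unfolding U_def by (rule finite_energy_diff[OF uf \<phi>(1)])
    have [measurable]: "U \<in> borel_measurable borel" using Uf by (simp add: finite_energy_def)
    have Uneg: "U x \<le> 0" if "x \<notin> \<Omega>" for x
      using that \<phi>(2)[of x] u by (simp add: U_def energy_solution_def)
    define S where "S = (\<lambda>k. {x. k < U x})"
    have S [measurable]: "S k \<in> sets borel" for k unfolding S_def by measurable
    have SD: "emeasure lborel (S k) \<le> emeasure lborel D" if "0 \<le> k" for k
    proof (rule emeasure_mono_AE)
      show "AE x in lborel. x \<in> S k \<longrightarrow> x \<in> D"
        using D0 by eventually_elim (use that in \<open>auto simp: S_def U_def\<close>)
    qed simp
    have Sfin: "emeasure lborel (S k) < \<infinity>" if "0 \<le> k" for k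
      using SD[OF that] Dfin by (rule le_less_trans)
    define A where "A = (\<lambda>k. measure lborel (S (max 0 k)))"
    have A_eq: "A k = measure lborel (S k)" if "0 \<le> k" for k
      using that by (simp add: A_def max.absorb2)
    have A_mono: "A h \<le> A k" if "0 \<le> k" "k \<le> h" for k h
    proof -
      have "measure lborel (S h) \<le> measure lborel (S k)"
        using that Sfin[of k] by (intro measure_mono_fmeasurable) (auto simp: fmeasurable_def S_def)
      then show ?thesis using that by (simp add: A_eq)
    qed
    have A0: "A 0 \<le> measure lborel D"
      using SD[of 0] Dfin unfolding A_def measure_def by (simp add: enn2real_mono)
    have decay: "(h - k) * A h \<le> (B0 * Z) * A k powr (1 + \<kappa>)" if k: "0 \<le> k" "k < h" for k h
    proof (cases "A k = 0")
      case True
      have "A h \<le> A k" using k by (intro A_mono) auto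
      moreover have "0 \<le> A h" by (simp add: A_def)
      ultimately show ?thesis using True by simp
    next
      case False
      have Ak: "A k = measure lborel (S k)" "A h = measure lborel (S h)" using k by (auto simp: A_eq)
      then have pos: "0 < measure lborel (S k)" using False by (simp add: zero_less_measure_iff)
      define v where "v = (\<lambda>x. truncation k h (U x))"
      have vf: "finite_energy s v"
        unfolding v_def
        by (rule finite_energy_bound[OF Uf]) (auto intro: truncation_contraction simp: truncation_def)
      have v0: "v x = 0" if "x \<notin> S k" for x
        using that k by (simp add: v_def truncation_def S_def)
      have vb: "0 \<le> v x" "v x \<le> h - k" for x
        using k by (auto simp: v_def truncation_def)
      have vS: "\<bar>v x\<bar> \<le> (h - k) * indicator (S k) x" for x
        using v0[of x] vb[of x] by (auto simp: indicator_def)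
      have "(h - k)\<^sup>2 * (c * measure lborel (S k) powr (- 2 * s / ?N)) * measure lborel (S h)
          \<le> frac_bilinear s v v"
        unfolding c_def
      proof (rule fractional_Faber_Krahn[OF s(1) vf])
        show "S h \<subseteq> S k" using k by (auto simp: S_def)
        show "v x = h - k" if "x \<in> S h" for x
          using that k by (simp add: v_def truncation_def S_def)
      qed (use v0 Sfin k pos in auto)
      also have "\<dots> \<le> frac_bilinear s u v"
        by (rule test[OF k _ vf]) (simp add: v_def U_def)
      also have "\<dots> = 2 / ?F * (LINT x|lebesgue_on \<Omega>. z x * v x)"
      proof -
        \<comment> \<open>Off \<open>\<Omega>\<close> the solution is 0 and \<phi> is nonnegative,
          so the truncation of the difference is an admissible test function.\<close>
        have "v x = 0" if "x \<notin> \<Omega>" for x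
          using Uneg[OF that] k by (intro v0) (auto simp: S_def)
        moreover have "\<bar>v x\<bar> \<le> h - k" for x using vb[of x] by simp
        ultimately have "?F / 2 * frac_bilinear s u v = (LINT x|lebesgue_on \<Omega>. z x * v x)"
          using u vf unfolding energy_solution_def by blast
        then show ?thesis using F by (simp add: field_simps)
      qed
      finally have lower: "(h - k)\<^sup>2 * (c * measure lborel (S k) powr (- 2 * s / ?N)) * measure lborel (S h)
          \<le> 2 / ?F * (LINT x|lebesgue_on \<Omega>. z x * v x)" .
      have upper: "(LINT x|lebesgue_on \<Omega>. z x * v x) \<le> (h - k) * (2 * Z * A k powr (1 - 1 / p))"
      proof -
        have zi: "integrable (lebesgue_on \<Omega>) z" by (rule Lp_integrable[OF z p \<Omega>])
        have "(LINT x|lebesgue_on \<Omega>. z x * v x) \<le> (LINT x|lebesgue_on \<Omega>. (h - k) * (\<bar>z x\<bar> * indicator (S k) x))"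
        proof (rule integral_mono)
          have m: "f \<in> borel_measurable (lebesgue_on \<Omega>)" if "f \<in> borel_measurable borel" for f :: "'a \<Rightarrow> real"
            using that by (intro measurable_restrict_space1 measurable_completion) auto
          have vm: "v \<in> borel_measurable borel" using vf by (simp add: finite_energy_def)
          show "integrable (lebesgue_on \<Omega>) (\<lambda>x. z x * v x)"
          proof (rule Bochner_Integration.integrable_bound)
            show "integrable (lebesgue_on \<Omega>) (\<lambda>x. (h - k) * z x)" using zi by (rule integrable_mult_right)
            show "(\<lambda>x. z x * v x) \<in> borel_measurable (lebesgue_on \<Omega>)"
              using zi m[OF vm] by (intro borel_measurable_times) auto
            show "AE x in lebesgue_on \<Omega>. norm (z x * v x) \<le> norm ((h - k) * z x)"
              using vb k by (intro AE_I2) (simp add: abs_mult mult.commute[of "h - k"] mult_left_mono)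
          qed
          show "integrable (lebesgue_on \<Omega>) (\<lambda>x. (h - k) * (\<bar>z x\<bar> * indicator (S k) x))"
          proof (intro integrable_mult_right, rule Bochner_Integration.integrable_bound[OF zi])
            show "(\<lambda>x. \<bar>z x\<bar> * indicator (S k) x) \<in> borel_measurable (lebesgue_on \<Omega>)"
              using borel_measurable_abs[OF borel_measurable_integrable[OF zi]]
              by (intro borel_measurable_times m[of "indicator (S k)"]) auto
          qed (auto simp: indicator_def)
          show "z x * v x \<le> (h - k) * (\<bar>z x\<bar> * indicator (S k) x)" for x
          proof -
            have "z x * v x \<le> \<bar>z x\<bar> * \<bar>v x\<bar>" unfolding abs_mult[symmetric] by simp
            also have "\<dots> \<le> \<bar>z x\<bar> * ((h - k) * indicator (S k) x)" by (intro mult_left_mono vS) auto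
            finally show ?thesis by (simp add: mult_ac)
          qed
        qed
        also have "\<dots> = (h - k) * (LINT x|lebesgue_on \<Omega>. \<bar>z x\<bar> * indicator (S k) x)" by simp
        also have "\<dots> \<le> (h - k) * (2 * Z * A k powr (1 - 1 / p))"
          unfolding Ak Z_def using k pos Sfin
          by (intro mult_left_mono Lp_integral_on_set_le z p \<Omega> S) auto
        finally show ?thesis .
      qed
      have "2 / ?F * (LINT x|lebesgue_on \<Omega>. z x * v x)
          \<le> 2 / ?F * ((h - k) * (2 * Z * A k powr (1 - 1 / p)))"
        using F by (intro mult_left_mono upper) simp
      with lower have "(h - k)\<^sup>2 * (c * A k powr (- 2 * s / ?N)) * A h
          \<le> 2 / ?F * ((h - k) * (2 * Z * A k powr (1 - 1 / p)))"
        unfolding Ak by (rule order_trans)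
      then have "(h - k) * ((h - k) * A h * (c * A k powr (- 2 * s / ?N)))
          \<le> (h - k) * (4 / ?F * Z * A k powr (1 - 1 / p))"
        by (simp add: power2_eq_square mult_ac)
      then have "(h - k) * A h * (c * A k powr (- 2 * s / ?N)) \<le> 4 / ?F * Z * A k powr (1 - 1 / p)"
        by (rule mult_left_le_imp_le) (use k in simp)
      then have "(h - k) * A h * (c * A k powr (- 2 * s / ?N)) * A k powr (2 * s / ?N)
          \<le> 4 / ?F * Z * A k powr (1 - 1 / p) * A k powr (2 * s / ?N)"
        by (rule mult_right_mono) simp
      moreover have "A k powr (- 2 * s / ?N) * A k powr (2 * s / ?N) = 1"
        using pos Ak by (simp add: powr_add[symmetric])
      moreover have "A k powr (1 - 1 / p) * A k powr (2 * s / ?N) = A k powr (1 + \<kappa>)"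
        by (simp add: powr_add[symmetric] \<kappa>_def algebra_simps)
      ultimately have "(h - k) * A h * c \<le> 4 / ?F * Z * A k powr (1 + \<kappa>)"
        by (simp add: mult.assoc)
      then show ?thesis using c F by (simp add: B0_def field_simps)
    qed
    define d0 where "d0 = C * Z * measure lborel D powr \<kappa>"
    have "0 \<le> d0" using \<open>0 < C\<close> Z by (simp add: d0_def)
    \<comment> \<open>The iteration needs a positive level, whereas \<open>d0\<close> is 0 when the
      norm of \<open>z\<close> or the measure of \<open>D\<close> is 0.\<close>
    have "AE x in lborel. U x \<le> d0 + 1 / Suc n" for n
    proof -
      define d where "d = d0 + 1 / Suc n"
      have d: "0 < d" using \<open>0 \<le> d0\<close> by (simp add: d_def add_nonneg_pos)
      have "A d = 0"
      proof (rule stampacchia_iteration[where A = A and B = "B0 * Z", OF \<kappa>])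
        show "0 \<le> B0 * Z" using B0 Z by simp
        show "0 \<le> A k" for k by (simp add: A_def)
        show "A h \<le> A k" if "0 \<le> k" "k \<le> h" for k h
          using that by (rule A_mono)
        have "2 * 2 powr (1 / \<kappa>) * (B0 * Z) * A 0 powr \<kappa> = C * Z * A 0 powr \<kappa>"
          by (simp add: C_def mult_ac)
        also have "\<dots> \<le> d0"
          unfolding d0_def using A0 \<kappa> \<open>0 < C\<close> Z
          by (intro mult_left_mono powr_mono2) (auto simp: A_def)
        also have "\<dots> \<le> d" by (simp add: d_def)
        finally show "2 * 2 powr (1 / \<kappa>) * (B0 * Z) * A 0 powr \<kappa> \<le> d" .
      qed (use decay d in auto)
      then have "emeasure lborel (S d) = 0"
        using d Sfin[of d] emeasure_eq_ennreal_measure[of lborel "S d"] by (simp add: A_def)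
      then have "AE x in lborel. x \<notin> S d"
        by (intro AE_not_in) (auto simp: null_sets_def)
      then show ?thesis by eventually_elim (auto simp: S_def d_def)
    qed
    then have "AE x in lborel. \<forall>n::nat. U x \<le> d0 + 1 / Suc n"
      by (subst AE_all_countable) blast
    then show ?thesis
    proof eventually_elim
      case (elim x)
      have "(\<lambda>n. d0 + 1 / Suc n) \<longlonglongrightarrow> d0 + 0"
        by (intro tendsto_intros) (rule LIMSEQ_Suc[OF lim_1_over_n])
      then have "U x \<le> d0 + 0" using elim by (intro LIMSEQ_le_const) auto
      then show ?case by (simp add: U_def d0_def Z_def)
    qed
  qed
  ultimately show ?thesis using that by blast
qed

section \<open>Decrease of the maximum\<close>

text \<open>If both arguments are positive, this is the inequality for a monotone contraction. If b
  is not positive, its truncation is 0, and expanding (a - b) T(a) leaves the extra product of T(a)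
  with -b. That product is the nonlocal gain; at most one of the two extra terms is nonzero.\<close>

lemma truncation_inequality:
  assumes "0 \<le> k" "k < h"
  shows "(truncation k h a - truncation k h b)\<^sup>2 + truncation k h a * max 0 (- b) + truncation k h b * max 0 (- a)
    \<le> (a - b) * (truncation k h a - truncation k h b)"
proof -
  have nn: "0 \<le> truncation k h a" for a using assms by (auto simp: truncation_def)
  have zero: "truncation k h a = 0" if "a \<le> 0" for a using that assms by (auto simp: truncation_def)
  have le: "truncation k h a \<le> a" if "0 \<le> a" for a using that assms by (auto simp: truncation_def)
  have one: "(truncation k h a)\<^sup>2 + truncation k h a * max 0 (- b) \<le> (a - b) * truncation k h a"
    if "b \<le> 0" for a b
  proof (cases "0 \<le> a")
    case True
    have "truncation k h a * truncation k h a \<le> a * truncation k h a"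
      using le[OF True] nn by (rule mult_right_mono)
    then show ?thesis using that by (simp add: power2_eq_square algebra_simps)
  next
    case False
    then show ?thesis using zero[of a] by simp
  qed
  consider "b \<le> 0" | "a \<le> 0" | "0 < a" "0 < b" by linarith
  then show ?thesis
  proof cases
    case 1
    then show ?thesis using one[of b a] zero[of b] by simp
  next
    case 2
    then show ?thesis using one[of a b] zero[of a] by (simp add: algebra_simps)
  next
    case 3
    have mono: "truncation k h b \<le> truncation k h a" if "b \<le> a" for a b
      using that by (auto simp: truncation_def)
    have "\<bar>truncation k h a - truncation k h b\<bar> * \<bar>truncation k h a - truncation k h b\<bar>
        \<le> \<bar>a - b\<bar> * \<bar>truncation k h a - truncation k h b\<bar>"
      by (intro mult_right_mono truncation_contraction) simp
    also have "\<dots> = (a - b) * (truncation k h a - truncation k h b)"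
      using mono[of a b] mono[of b a] unfolding abs_mult[symmetric]
      by (intro abs_of_nonneg) (cases "a \<le> b"; auto intro: mult_nonneg_nonneg mult_nonpos_nonpos)
    finally show ?thesis using 3 by (simp add: power2_eq_square)
  qed
qed

lemma integral_product_lborel:
  fixes f g :: "'a::euclidean_space \<Rightarrow> real"
  assumes f: "integrable lborel f" and g: "integrable lborel g"
  shows "integrable (lborel \<Otimes>\<^sub>M lborel) (\<lambda>p. f (fst p) * g (snd p))"
    and "(LINT p|(lborel \<Otimes>\<^sub>M lborel). f (fst p) * g (snd p)) = (LINT x|lborel. f x) * (LINT x|lborel. g x)"
proof -
  have [measurable]: "f \<in> borel_measurable borel" "g \<in> borel_measurable borel"
    using f g by auto
  show I: "integrable (lborel \<Otimes>\<^sub>M lborel) (\<lambda>p. f (fst p) * g (snd p))"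
  proof (rule lborel_pair.Fubini_integrable)
    show "(\<lambda>p. f (fst p) * g (snd p)) \<in> borel_measurable (lborel \<Otimes>\<^sub>M lborel)" by measurable
    show "integrable lborel (\<lambda>x. LINT y|lborel. norm (f (fst (x, y)) * g (snd (x, y))))"
      using f by (simp add: abs_mult)
    show "AE x in lborel. integrable lborel (\<lambda>y. f (fst (x, y)) * g (snd (x, y)))"
      using g by simp
  qed
  have "(LINT p|(lborel \<Otimes>\<^sub>M lborel). f (fst p) * g (snd p)) = (LINT x|lborel. LINT y|lborel. f x * g y)"
    using lborel_pair.integral_fst'[OF I] by simp
  then show "(LINT p|(lborel \<Otimes>\<^sub>M lborel). f (fst p) * g (snd p)) = (LINT x|lborel. f x) * (LINT x|lborel. g x)"
    by simp
qed

lemma frac_bilinear_truncation_ge: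
  fixes U :: "'a::euclidean_space \<Rightarrow> real"
  assumes kh: "0 \<le> k" "k < h" and U: "finite_energy s U"
    and v: "v = (\<lambda>x. truncation k h (U x))" "finite_energy s v"
  shows "frac_bilinear s v v \<le> frac_bilinear s U v"
  unfolding frac_bilinear_def
proof (rule integral_mono[OF integrable_frac_bilinear[OF v(2,2)] integrable_frac_bilinear[OF U v(2)]])
  fix p :: "'a \<times> 'a"
  have "0 \<le> truncation k h a" for a using kh by (auto simp: truncation_def)
  then have "0 \<le> truncation k h (U (fst p)) * max 0 (- U (snd p))"
    "0 \<le> truncation k h (U (snd p)) * max 0 (- U (fst p))"
    by simp_all
  then have "(v (fst p) - v (snd p)) * (v (fst p) - v (snd p)) \<le> (U (fst p) - U (snd p)) * (v (fst p) - v (snd p))"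
    using truncation_inequality[OF kh, of "U (fst p)" "U (snd p)"]
    unfolding v(1) power2_eq_square by linarith
  then show "(v (fst p) - v (snd p)) * (v (fst p) - v (snd p)) * frac_kernel s (fst p - snd p)
      \<le> (U (fst p) - U (snd p)) * (v (fst p) - v (snd p)) * frac_kernel s (fst p - snd p)"
    by (rule mult_right_mono) simp
qed

text \<open>The products of the truncation at one point with the negative part of \<open>U\<close>
  at the other are kept for pairs joining the ball to \<open>S\<close>. Both points lie in the ball,
  so their distance is at most 2\<rho> and the kernel has a lower bound. The factor 2 counts both
  orders of the pair.\<close>

lemma frac_bilinear_truncation_gain:
  fixes U :: "'a::euclidean_space \<Rightarrow> real" and s :: real
  assumes s: "0 < s" and kh: "0 \<le> k" "k < h" and U: "finite_energy s U"
    and v: "v = (\<lambda>x. truncation k h (U x))" "finite_energy s v" "integrable lborel v"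
    and \<rho>: "0 < \<rho>" and outside: "AE x in lborel. x \<notin> ball a \<rho> \<longrightarrow> U x \<le> 0"
    and S [measurable]: "S \<in> sets borel" and SB: "S \<subseteq> ball a \<rho>"
    and \<omega>: "0 \<le> \<omega>" "\<And>x. x \<in> S \<Longrightarrow> U x \<le> - \<omega>"
  shows "frac_bilinear s v v + 2 * \<omega> / (2 * \<rho>) powr (DIM('a) + 2 * s) * measure lborel S * (LINT x|lborel. v x)
    \<le> frac_bilinear s U v"
proof -
  let ?K = "\<lambda>p. frac_kernel s (fst p - snd p :: 'a)"
  let ?B = "ball a \<rho>"
  have [measurable]: "?B \<in> sets borel" by (simp add: borel_open)
  \<comment> \<open>Here \<kappa> is the lower bound for negative part times kernel, not the
    exponent of the sup bound.\<close>
  define \<kappa> where "\<kappa> = \<omega> / (2 * \<rho>) powr (DIM('a) + 2 * s)"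
  \<comment> \<open>The function \<open>v\<close> is known to vanish off the ball only almost
    everywhere. With \<open>w\<close>, which has the same integral, the kernel estimate holds at
    every pair of points.\<close>
  define w where "w = (\<lambda>x. v x * indicator ?B x)"
  have [measurable]: "v \<in> borel_measurable borel" using v(2) by (simp add: finite_energy_def)
  have nn: "0 \<le> truncation k h t" for t using kh by (auto simp: truncation_def)
  have wi: "integrable lborel w"
    unfolding w_def
    by (rule Bochner_Integration.integrable_bound[OF v(3)]) (auto simp: indicator_def)
  have wv: "(LINT x|lborel. w x) = (LINT x|lborel. v x)"
  proof (rule integral_cong_AE)
    show "AE x in lborel. w x = v x"
      using outside by eventually_elim (use kh in \<open>auto simp: w_def v(1) truncation_def indicator_def\<close>)
  qed (auto simp: w_def)
  have "emeasure lborel S < \<infinity>"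
    using emeasure_mono[OF SB, of lborel] emeasure_lborel_ball_finite[of a \<rho>] by (auto intro: le_less_trans)
  then have Si: "integrable lborel (indicator S :: 'a \<Rightarrow> real)" by (intro integrable_real_indicator) auto
  let ?g1 = "\<lambda>p. w (fst p) * indicator S (snd p) :: real"
  let ?g2 = "\<lambda>p. indicator S (fst p) * w (snd p) :: real"
  let ?e = "\<lambda>p. (v (fst p) - v (snd p)) * (v (fst p) - v (snd p)) * ?K p"
  note g1 = integral_product_lborel[OF wi Si] and g2 = integral_product_lborel[OF Si wi]
  note e = integrable_frac_bilinear[OF v(2,2)]
  have kernel: "\<kappa> * (truncation k h (U x) * indicator ?B x * indicator S y)
      \<le> truncation k h (U x) * max 0 (- U y) * frac_kernel s (x - y)" for x y
  proof (cases "x \<in> ?B \<and> y \<in> S \<and> 0 < truncation k h (U x)")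
    case True
    have "0 < U x" using True kh by (cases "0 < U x") (auto simp: truncation_def)
    moreover have "U y \<le> 0" using \<omega>(2)[of y] \<omega>(1) True by simp
    ultimately have "x \<noteq> y" by auto
    moreover have "norm (x - y) \<le> 2 * \<rho>"
    proof -
      have "dist a x < \<rho>" "dist a y < \<rho>" using True SB by auto
      then show ?thesis using dist_triangle3[of x y a] by (simp add: dist_norm)
    qed
    ultimately have K: "1 / (2 * \<rho>) powr (DIM('a) + 2 * s) \<le> frac_kernel s (x - y)"
      unfolding frac_kernel_def using s \<rho> by (intro divide_left_mono powr_mono2) auto
    have "\<omega> * (1 / (2 * \<rho>) powr (DIM('a) + 2 * s)) \<le> max 0 (- U y) * frac_kernel s (x - y)"
      using \<omega>(2)[of y] True \<omega>(1) by (intro mult_mono K) auto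
    then have "\<kappa> * truncation k h (U x) \<le> max 0 (- U y) * frac_kernel s (x - y) * truncation k h (U x)"
      using nn by (intro mult_right_mono) (auto simp: \<kappa>_def)
    then show ?thesis using True by (simp add: mult_ac)
  next
    case False
    then have "truncation k h (U x) * indicator ?B x * indicator S y = (0::real)"
      using nn[of "U x"] by (auto simp: indicator_def)
    moreover have "0 \<le> truncation k h (U x) * max 0 (- U y) * frac_kernel s (x - y)"
      using nn by simp
    ultimately show ?thesis by (simp only: mult_zero_right)
  qed
  have "frac_bilinear s v v + 2 * \<kappa> * measure lborel S * (LINT x|lborel. v x)
     = (LINT p|(lborel \<Otimes>\<^sub>M lborel). ?e p + \<kappa> * (?g1 p + ?g2 p))"
  proof -
    have "(LINT p|(lborel \<Otimes>\<^sub>M lborel). f p + \<kappa> * (g p + g' p))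
        = (LINT p|(lborel \<Otimes>\<^sub>M lborel). f p) + \<kappa> * ((LINT p|(lborel \<Otimes>\<^sub>M lborel). g p)
            + (LINT p|(lborel \<Otimes>\<^sub>M lborel). g' p))"
      if "integrable (lborel \<Otimes>\<^sub>M lborel) f" "integrable (lborel \<Otimes>\<^sub>M lborel) g"
        "integrable (lborel \<Otimes>\<^sub>M lborel) g'" for f g g' :: "'a \<times> 'a \<Rightarrow> real"
      using that by simp
    from this[OF e g1(1) g2(1)] show ?thesis
      unfolding g1(2) g2(2) wv frac_bilinear_def by (simp add: algebra_simps)
  qed
  also have "\<dots> \<le> frac_bilinear s U v"
    unfolding frac_bilinear_def
  proof (rule integral_mono[OF _ integrable_frac_bilinear[OF U v(2)]])
    show "integrable (lborel \<Otimes>\<^sub>M lborel) (\<lambda>p. ?e p + \<kappa> * (?g1 p + ?g2 p))"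
      by (intro Bochner_Integration.integrable_add integrable_mult_right e g1(1) g2(1))
    fix p :: "'a \<times> 'a"
    obtain x y where p: "p = (x, y)" by (cases p)
    have sym: "frac_kernel s (y - x) = frac_kernel s (x - y)"
      using frac_kernel_minus[of s "x - y"] by simp
    have "(v x - v y) * (v x - v y) * frac_kernel s (x - y) + \<kappa> * (w x * indicator S y + indicator S x * w y)
       \<le> ((v x - v y)\<^sup>2 + v x * max 0 (- U y) + v y * max 0 (- U x)) * frac_kernel s (x - y)"
      using kernel[of x y] kernel[of y x]
      by (simp add: w_def v(1) sym power2_eq_square algebra_simps)
    also have "\<dots> \<le> (U x - U y) * (v x - v y) * frac_kernel s (x - y)"
      unfolding v(1) by (intro mult_right_mono truncation_inequality kh) simp
    finally show "?e p + \<kappa> * (?g1 p + ?g2 p) \<le> (U (fst p) - U (snd p)) * (v (fst p) - v (snd p)) * ?K p"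
      by (simp add: p)
  qed
  finally show ?thesis by (simp add: \<kappa>_def)
qed

text \<open>
  The comparison function \<open>c + L - \<gamma> \<eta>\<^sub>\<rho> - L \<eta>\<^sub>r\<close> built from two cutoffs dominates \<open>u\<close> off the
  ball of radius \<open>\<rho>\<close>; the set where \<open>u \<le> l\<close> produces a term of order \<open>\<rho>\<^bsup>-2s\<^esup>\<close> that
  absorbs the energy of the comparison function, so the sup bound applies to the difference.
\<close>

lemma energy_solution_growth:
  fixes s p \<mu> :: real
  assumes s: "0 < s" "s < 1" and p: "1 \<le> p" and \<kappa>: "0 < 2 * s / DIM('a) - 1 / p" and \<mu>: "0 < \<mu>"
  obtains \<theta> where "0 < \<theta>"
    "\<And>\<Omega> z u \<Lambda> c l r (a::'a::euclidean_space). bounded \<Omega> \<Longrightarrow> open \<Omega> \<Longrightarrow> z \<in> Lp_space p \<Omega> \<Longrightarrow>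
      energy_solution s \<Omega> z u \<Longrightarrow> (AE x in lborel. u x \<le> \<Lambda>) \<Longrightarrow> l < c \<Longrightarrow> 0 < r \<Longrightarrow>
      (AE x in lborel. x \<in> ball a r \<longrightarrow> u x \<le> c) \<Longrightarrow> ball a r \<subseteq> \<Omega> \<or> 0 \<le> l \<Longrightarrow>
      \<forall>\<^sub>F \<rho> in at_right 0. \<mu> * \<rho> ^ DIM('a) \<le> measure lborel {x \<in> ball a \<rho>. u x \<le> l} \<longrightarrow>
        (AE x in lborel. x \<in> ball a (\<rho> / 2) \<longrightarrow> u x \<le> c - \<theta> * (c - l))"
proof -
  let ?N = "real DIM('a)"
  let ?\<kappa> = "2 * s / ?N - 1 / p"
  obtain C where C: "0 < C" "\<And>\<rho>. 0 < \<rho> \<Longrightarrow>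
    (\<integral>\<^sup>+h. ennreal (min ((norm h / \<rho>)\<^sup>2) 1 * frac_kernel s (h::'a)) \<partial>lborel) \<le> ennreal (C * \<rho> powr (- 2 * s))"
    using kernel_moment_bound[OF s, where 'a = 'a] by blast
  obtain C' where C': "0 < C'"
    "\<And>\<Omega> z u \<phi> D. bounded \<Omega> \<Longrightarrow> open \<Omega> \<Longrightarrow> z \<in> Lp_space p \<Omega> \<Longrightarrow> energy_solution s \<Omega> z u \<Longrightarrow>
      finite_energy s \<phi> \<Longrightarrow> (\<And>x. x \<notin> \<Omega> \<Longrightarrow> 0 \<le> \<phi> x) \<Longrightarrow>
      D \<in> sets borel \<Longrightarrow> emeasure lborel D < \<infinity> \<Longrightarrow> (AE x in lborel. x \<notin> D \<longrightarrow> u x \<le> \<phi> x) \<Longrightarrow>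
      (\<And>k h v. 0 \<le> k \<Longrightarrow> k < h \<Longrightarrow> v = (\<lambda>x. truncation k h (u x - \<phi> x)) \<Longrightarrow> finite_energy s v \<Longrightarrow>
         frac_bilinear s v v \<le> frac_bilinear s u v) \<Longrightarrow>
      AE x in lborel. u x \<le> \<phi> x + C' * Lp_norm p \<Omega> z * measure lborel (D::'a set) powr ?\<kappa>"
    using energy_solution_sup_bound[OF s p \<kappa>] by blast
  define c1 where "c1 = 2 powr - (?N + 2 * s)"
  have c1: "0 < c1" by (simp add: c1_def)
  have c1': "c1 = 1 / 2 powr (?N + 2 * s)" unfolding c1_def by (rule powr_minus_divide)
  \<comment> \<open>The bound 1/2 leaves \<open>U\<close> at most -\<omega>/2 on the sublevel set.
    The other bound lets half of the gain \<omega> \<mu> \<open>c1\<close> \<rho>^(-2s) absorb the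
    energy of the inner cutoff; \<open>c1\<close> comes from the distance 2\<rho> in the kernel. No
    level and no function enters \<tau>.\<close>
  define \<tau> where "\<tau> = min (1 / 2) (\<mu> * c1 / (4 * C))"
  have \<tau>: "0 < \<tau>" "\<tau> \<le> 1 / 2" "\<tau> \<le> \<mu> * c1 / (4 * C)" using \<mu> c1 C(1) by (auto simp: \<tau>_def)
  then have \<tau>C: "2 * C * \<tau> \<le> \<mu> * c1 / 2" using C(1) by (simp add: field_simps)
  have "0 < \<tau> / 2" using \<tau> by simp
  have growth: "\<forall>\<^sub>F \<rho> in at_right 0. \<mu> * \<rho> ^ DIM('a) \<le> measure lborel {x \<in> ball a \<rho>. u x \<le> l} \<longrightarrow>
        (AE x in lborel. x \<in> ball a (\<rho> / 2) \<longrightarrow> u x \<le> c - \<tau> / 2 * (c - l))"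
    if \<Omega>: "bounded \<Omega>" "open \<Omega>" and z: "z \<in> Lp_space p \<Omega>" and u: "energy_solution s \<Omega> z u"
      and \<Lambda>: "AE x in lborel. u x \<le> \<Lambda>" and lc: "l < c" and r: "0 < r"
      and uc: "AE x in lborel. x \<in> ball a r \<longrightarrow> u x \<le> c" and inside: "ball a r \<subseteq> \<Omega> \<or> 0 \<le> l"
    for \<Omega> z u \<Lambda> c l r and a :: 'a
  proof -
    define \<omega> where "\<omega> = c - l"
    define \<gamma> where "\<gamma> = \<tau> * \<omega>"
    \<comment> \<open>Off the ball of radius \<open>r\<close> the comparison function is c + L,
      which is at least \<Lambda> and at least 0.\<close>
    define L where "L = \<bar>c\<bar> + \<bar>\<Lambda>\<bar>"
    define Z where "Z = Lp_norm p \<Omega> z"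
    have \<omega>: "0 < \<omega>" using lc by (simp add: \<omega>_def)
    have \<gamma>: "0 < \<gamma>" "\<gamma> \<le> \<omega> / 2" using \<tau> \<omega> by (simp_all add: \<gamma>_def)
    have L: "0 \<le> L" "\<Lambda> \<le> c + L" "0 \<le> c + L" by (auto simp: L_def)
    have uf: "finite_energy s u" and u0: "\<And>x. x \<notin> \<Omega> \<Longrightarrow> u x = 0"
      using u by (auto simp: energy_solution_def)
    have [measurable]: "u \<in> borel_measurable borel" using uf by (simp add: finite_energy_def)
    \<comment> \<open>The energy of the outer cutoff has the fixed size r^(-2s), so for small \<rho>
      the other half of the gain, of order \<rho>^(-2s), absorbs it.\<close>
    have "((\<lambda>\<rho>. 2 * C * L * r powr (- 2 * s) * \<rho> powr (2 * s)) \<longlongrightarrow> 2 * C * L * r powr (- 2 * s) * 0) (at_right 0)"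
      using s by (intro tendsto_intros tendsto_zero_powrI[of _ _ _ "2 * s"])
        (auto simp: eventually_at_right_less eventually_mono[OF eventually_at_right_less] intro!: tendsto_intros)
    then have E1: "\<forall>\<^sub>F \<rho> in at_right 0. 2 * C * L * r powr (- 2 * s) * \<rho> powr (2 * s) < \<omega> * \<mu> * c1 / 2"
      using \<omega> \<mu> c1 by (intro order_tendstoD(2)) auto
    \<comment> \<open>On the half ball the inner cutoff is at least 3/4. The rise of the outer part
      and the error of the sup bound, which tends to 0 because \<kappa> > 0, together cost less than
      \<gamma>/4, so a drop of \<gamma>/2 remains; this is why \<theta> is \<tau>/2.\<close>
    have "((\<lambda>\<rho>. L * (\<rho> / 2 / r)\<^sup>2 + C' * Z * (unit_ball_vol ?N * \<rho> ^ DIM('a)) powr ?\<kappa>)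
        \<longlongrightarrow> L * (0 / 2 / r)\<^sup>2 + C' * Z * 0) (at_right 0)"
    proof (intro tendsto_intros tendsto_zero_powrI[of _ _ _ ?\<kappa>])
      have "((\<lambda>\<rho>. unit_ball_vol ?N * \<rho> ^ DIM('a)) \<longlongrightarrow> unit_ball_vol ?N * 0 ^ DIM('a)) (at_right 0)"
        by (intro tendsto_intros)
      then show "((\<lambda>\<rho>. unit_ball_vol ?N * \<rho> ^ DIM('a)) \<longlongrightarrow> 0) (at_right 0)"
        by (simp only: zero_power[OF DIM_positive] mult_zero_right)
      show "\<forall>\<^sub>F \<rho> in at_right 0. 0 \<le> unit_ball_vol ?N * \<rho> ^ DIM('a)"
        using eventually_at_right_less[of "0::real"] by eventually_elim (simp add: unit_ball_vol_nonneg)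
    qed (use r \<kappa> in auto)
    then have E2: "\<forall>\<^sub>F \<rho> in at_right 0.
        L * (\<rho> / 2 / r)\<^sup>2 + C' * Z * (unit_ball_vol ?N * \<rho> ^ DIM('a)) powr ?\<kappa> < \<gamma> / 4"
      using \<gamma> by (intro order_tendstoD(2)) auto
    have E3: "\<forall>\<^sub>F \<rho> in at_right 0. \<rho> < r"
      using r by (intro order_tendstoD(2)[OF tendsto_ident_at]) auto
    have E0: "\<forall>\<^sub>F \<rho> in at_right 0. 0 < (\<rho>::real)" by (rule eventually_at_right_less)
    show ?thesis
      using E0 E1 E2 E3
    proof eventually_elim
      fix \<rho>
      assume \<rho>: "0 < \<rho>" and e1: "2 * C * L * r powr (- 2 * s) * \<rho> powr (2 * s) < \<omega> * \<mu> * c1 / 2"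
        and e2: "L * (\<rho> / 2 / r)\<^sup>2 + C' * Z * (unit_ball_vol ?N * \<rho> ^ DIM('a)) powr ?\<kappa> < \<gamma> / 4"
        and e3: "\<rho> < r"
      let ?S = "{x \<in> ball a \<rho>. u x \<le> l}"
      show "\<mu> * \<rho> ^ DIM('a) \<le> measure lborel ?S \<longrightarrow>
        (AE x in lborel. x \<in> ball a (\<rho> / 2) \<longrightarrow> u x \<le> c - \<tau> / 2 * (c - l))"
      proof
        assume dens: "\<mu> * \<rho> ^ DIM('a) \<le> measure lborel ?S"
        let ?\<eta> = "cutoff a \<rho>" and ?\<eta>' = "cutoff a r"
        define \<phi> where "\<phi> = (\<lambda>x. (c + L) + ((- \<gamma>) * ?\<eta> x + (- L) * ?\<eta>' x))"
        have \<eta>f: "finite_energy s ?\<eta>" "finite_energy s ?\<eta>'"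
          using finite_energy_cutoff[OF s] \<rho> r by auto
        have \<phi>f: "finite_energy s \<phi>"
          unfolding \<phi>_def by (intro finite_energy_add finite_energy_const finite_energy_cmult \<eta>f)
        have \<phi>_ge: "c - \<gamma> \<le> \<phi> x" for x
          using mult_left_le[of "?\<eta> x" \<gamma>, OF _ less_imp_le[OF \<gamma>(1)]] mult_left_le[of "?\<eta>' x" L] L
          by (simp add: \<phi>_def)
        have \<phi>_out: "\<phi> x = c + L" if "x \<notin> ball a r" for x
          using that cutoff_eq_0[OF r that] cutoff_eq_0[OF \<rho>, of x a] e3 by (simp add: \<phi>_def)
        have \<phi>_mid: "c \<le> \<phi> x" if "x \<notin> ball a \<rho>" for x
          using cutoff_eq_0[OF \<rho> that] mult_left_le[of "?\<eta>' x" L] L by (simp add: \<phi>_def)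
        \<comment> \<open>Nonnegativity off \<open>\<Omega>\<close> makes the truncations
          admissible. It holds because such points lie off the larger ball, where \<phi> is c + L,
          or else because \<phi> is at least c - \<gamma>, which exceeds l and hence 0.\<close>
        have \<phi>0: "0 \<le> \<phi> x" if "x \<notin> \<Omega>" for x
        proof (cases "ball a r \<subseteq> \<Omega>")
          case True
          then have "x \<notin> ball a r" using that by blast
          then show ?thesis using \<phi>_out[of x] L by simp
        next
          case False
          then have "0 \<le> l" using inside by simp
          then show ?thesis using \<phi>_ge[of x] \<gamma> \<omega> by (simp add: \<omega>_def)
        qed
        have out: "AE x in lborel. x \<notin> ball a \<rho> \<longrightarrow> u x \<le> \<phi> x"
          using \<Lambda> uc
        proof eventually_elim
          case (elim x)
          show ?case
          proof
            assume "x \<notin> ball a \<rho>"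
            then show "u x \<le> \<phi> x"
              using elim \<phi>_mid[of x] \<phi>_out[of x] L by (cases "x \<in> ball a r") auto
          qed
        qed
        define U where "U = (\<lambda>x. u x - \<phi> x)"
        have Uf: "finite_energy s U" unfolding U_def by (rule finite_energy_diff[OF uf \<phi>f])
        have "AE x in lborel. u x \<le> \<phi> x + C' * Lp_norm p \<Omega> z * measure lborel (ball a \<rho>) powr ?\<kappa>"
        proof (rule C'(2)[OF \<Omega> z u \<phi>f \<phi>0 _ _ out])
          show "ball a \<rho> \<in> sets borel" by (simp add: borel_open)
          show "emeasure lborel (ball a \<rho>) < \<infinity>" by (rule emeasure_lborel_ball_finite)
          fix k h v
          assume kh: "0 \<le> k" "k < h" and v: "v = (\<lambda>x. truncation k h (u x - \<phi> x))" and vf: "finite_energy s v"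
          have v': "v = (\<lambda>x. truncation k h (U x))" by (simp add: v U_def)
          have vnn: "0 \<le> v x" and vb: "v x \<le> h - k" for x using kh by (auto simp: v truncation_def)
          have v0: "v x = 0" if "x \<notin> \<Omega>" for x
            using \<phi>0[OF that] u0[OF that] kh by (auto simp: v truncation_def)
          have [measurable]: "v \<in> borel_measurable borel" using vf by (simp add: finite_energy_def)
          have vi: "integrable lborel v"
          proof (rule Bochner_Integration.integrable_bound)
            show "integrable lborel (\<lambda>x. (h - k) * indicator \<Omega> x)"
              using emeasure_bounded_finite[OF \<Omega>(1)] \<Omega>(2)
              by (intro integrable_mult_right integrable_real_indicator) auto
            show "AE x in lborel. norm (v x) \<le> norm ((h - k) * indicator \<Omega> x :: real)"
              using v0 vnn vb kh by (intro AE_I2) (auto simp: indicator_def)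
          qed measurable
          define J where "J = (LINT x|lborel. v x)"
          have J: "0 \<le> J" using vnn by (simp add: J_def)
          have "frac_bilinear s v v + 2 * (\<omega> / 2) / (2 * \<rho>) powr (?N + 2 * s) * measure lborel ?S * J
              \<le> frac_bilinear s U v"
            unfolding J_def
          proof (rule frac_bilinear_truncation_gain[OF s(1) kh Uf v' vf vi \<rho>])
            show "AE x in lborel. x \<notin> ball a \<rho> \<longrightarrow> U x \<le> 0"
              using out by eventually_elim (simp add: U_def)
            show "?S \<in> sets borel" by measurable
            show "0 \<le> \<omega> / 2" using \<omega> by simp
            show "U x \<le> - (\<omega> / 2)" if "x \<in> ?S" for x
            proof -
              have "u x \<le> l" using that by simp
              then show ?thesis using \<phi>_ge[of x] \<gamma>(2) unfolding U_def \<omega>_def by argo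
            qed
          qed auto
          moreover have "\<omega> * \<mu> * c1 * \<rho> powr (- 2 * s) * J
              \<le> 2 * (\<omega> / 2) / (2 * \<rho>) powr (?N + 2 * s) * measure lborel ?S * J"
          proof -
            have "1 / (2 * \<rho>) powr (?N + 2 * s) = c1 * (1 / \<rho> powr (?N + 2 * s))"
              using \<rho> c1' by (simp add: powr_mult)
            also have "\<dots> = c1 * (\<rho> powr (- 2 * s) / \<rho> ^ DIM('a))"
              using powr_dim_split[OF \<rho>] by simp
            finally have "\<omega> * (1 / (2 * \<rho>) powr (?N + 2 * s)) * (\<mu> * \<rho> ^ DIM('a)) = \<omega> * \<mu> * c1 * \<rho> powr (- 2 * s)"
              using \<rho> by simp
            moreover have "\<omega> * (1 / (2 * \<rho>) powr (?N + 2 * s)) * (\<mu> * \<rho> ^ DIM('a))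
               \<le> \<omega> * (1 / (2 * \<rho>) powr (?N + 2 * s)) * measure lborel ?S"
              using \<omega> by (intro mult_left_mono dens) auto
            ultimately have "\<omega> * \<mu> * c1 * \<rho> powr (- 2 * s)
                \<le> \<omega> * (1 / (2 * \<rho>) powr (?N + 2 * s)) * measure lborel ?S"
              by (simp only:)
            then have "\<omega> * \<mu> * c1 * \<rho> powr (- 2 * s) * J
                \<le> \<omega> * (1 / (2 * \<rho>) powr (?N + 2 * s)) * measure lborel ?S * J"
              using J by (rule mult_right_mono)
            then show ?thesis by simp
          qed
          moreover have "frac_bilinear s u v = frac_bilinear s U v + frac_bilinear s \<phi> v"
            using frac_bilinear_add[OF Uf \<phi>f vf] by (simp add: U_def)
          moreover have "frac_bilinear s \<phi> v = - \<gamma> * frac_bilinear s ?\<eta> v - L * frac_bilinear s ?\<eta>' v"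
          proof -
            have f: "finite_energy s (\<lambda>x. (- \<gamma>) * ?\<eta> x)" "finite_energy s (\<lambda>x. (- L) * ?\<eta>' x)"
              by (rule finite_energy_cmult[OF \<eta>f(1)], rule finite_energy_cmult[OF \<eta>f(2)])
            have "frac_bilinear s \<phi> v = frac_bilinear s (\<lambda>_. c + L) v
                + (frac_bilinear s (\<lambda>x. (- \<gamma>) * ?\<eta> x) v + frac_bilinear s (\<lambda>x. (- L) * ?\<eta>' x) v)"
              unfolding \<phi>_def frac_bilinear_add[OF f vf, symmetric]
              by (rule frac_bilinear_add[OF finite_energy_const finite_energy_add[OF f] vf])
            then show ?thesis
              unfolding frac_bilinear_cmult frac_bilinear_const by simp
          qed
          moreover have "\<gamma> * frac_bilinear s ?\<eta> v \<le> \<gamma> * (2 * C * \<rho> powr (- 2 * s) * J)"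
            unfolding J_def using \<gamma>
            by (intro mult_left_mono frac_bilinear_cutoff_le[OF s \<rho> C(1) C(2)[OF \<rho>] vf vnn vi]) simp
          moreover have "L * frac_bilinear s ?\<eta>' v \<le> L * (2 * C * r powr (- 2 * s) * J)"
            unfolding J_def using L
            by (intro mult_left_mono frac_bilinear_cutoff_le[OF s r C(1) C(2)[OF r] vf vnn vi]) simp
          moreover have "\<gamma> * (2 * C * \<rho> powr (- 2 * s) * J) + L * (2 * C * r powr (- 2 * s) * J)
              \<le> \<omega> * \<mu> * c1 * \<rho> powr (- 2 * s) * J"
          proof -
            have "\<gamma> * (2 * C) = \<omega> * (2 * C * \<tau>)" by (simp add: \<gamma>_def)
            also have "\<dots> \<le> \<omega> * (\<mu> * c1 / 2)" using \<omega> by (intro mult_left_mono \<tau>C) auto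
            finally have 1: "\<gamma> * (2 * C) * \<rho> powr (- 2 * s) \<le> \<omega> * (\<mu> * c1 / 2) * \<rho> powr (- 2 * s)"
              by (rule mult_right_mono) simp
            have "2 * C * L * r powr (- 2 * s) * \<rho> powr (2 * s) * \<rho> powr (- 2 * s)
                \<le> \<omega> * \<mu> * c1 / 2 * \<rho> powr (- 2 * s)"
              using e1 by (intro mult_right_mono) auto
            then have *: "2 * C * L * r powr (- 2 * s) * (\<rho> powr (2 * s) * \<rho> powr (- 2 * s))
                \<le> \<omega> * \<mu> * c1 / 2 * \<rho> powr (- 2 * s)"
              by (simp only: mult.assoc)
            have "\<rho> powr (2 * s) * \<rho> powr (- 2 * s) = 1"
              using \<rho> by (simp add: powr_add[symmetric])
            from *[unfolded this] have 2: "L * (2 * C * r powr (- 2 * s)) \<le> \<omega> * \<mu> * c1 / 2 * \<rho> powr (- 2 * s)"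
              by (simp add: mult_ac)
            have "(\<gamma> * (2 * C) * \<rho> powr (- 2 * s) + L * (2 * C * r powr (- 2 * s))) * J
                \<le> (\<omega> * \<mu> * c1 * \<rho> powr (- 2 * s)) * J"
              using 1 2 by (intro mult_right_mono J) (simp add: algebra_simps)
            then show ?thesis by (simp add: algebra_simps)
          qed
          ultimately show "frac_bilinear s v v \<le> frac_bilinear s u v" by linarith
        qed
        then show "AE x in lborel. x \<in> ball a (\<rho> / 2) \<longrightarrow> u x \<le> c - \<tau> / 2 * (c - l)"
        proof eventually_elim
          case (elim x)
          show ?case
          proof
            assume x: "x \<in> ball a (\<rho> / 2)"
            then have nx: "norm (x - a) \<le> \<rho> / 2" by (simp add: dist_norm norm_minus_commute)
            have "(norm (x - a) / \<rho>)\<^sup>2 \<le> (1 / 2)\<^sup>2"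
              using nx \<rho> by (intro power_mono) (auto simp: field_simps)
            then have "3 / 4 \<le> ?\<eta> x" using cutoff_ge[of x a \<rho>] by (simp add: power2_eq_square)
            then have 1: "\<gamma> * (3 / 4) \<le> \<gamma> * ?\<eta> x" using \<gamma> by (intro mult_left_mono) auto
            have "(norm (x - a) / r)\<^sup>2 \<le> (\<rho> / 2 / r)\<^sup>2"
              using nx r by (intro power_mono divide_right_mono) auto
            then have "1 - (\<rho> / 2 / r)\<^sup>2 \<le> ?\<eta>' x" using cutoff_ge[of x a r] by linarith
            then have 2: "L * (1 - (\<rho> / 2 / r)\<^sup>2) \<le> L * ?\<eta>' x" using L by (intro mult_left_mono) auto
            have 3: "measure lborel (ball a \<rho>) = unit_ball_vol ?N * \<rho> ^ DIM('a)"
              using \<rho> by (simp add: content_ball)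
            have 4: "u x \<le> \<phi> x + C' * Z * (unit_ball_vol ?N * \<rho> ^ DIM('a)) powr ?\<kappa>"
              using elim unfolding 3 Z_def .
            have 5: "\<phi> x \<le> c + L * (\<rho> / 2 / r)\<^sup>2 - \<gamma> * (3 / 4)"
              using 1 2 unfolding \<phi>_def right_diff_distrib by linarith
            have "u x \<le> c - \<gamma> * (3 / 4) + \<gamma> / 4" using 4 5 e2 by linarith
            also have "\<dots> = c - \<tau> / 2 * (c - l)" unfolding \<gamma>_def \<omega>_def by argo
            finally show "u x \<le> c - \<tau> / 2 * (c - l)" .
          qed
        qed
      qed
    qed
  qed
  show ?thesis by (rule that[OF \<open>0 < \<tau> / 2\<close>]) (rule growth)
qed

section \<open>Essential limits\<close>

lemma AE_open_ex:
  fixes W :: "'a::euclidean_space set"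
  assumes ae: "AE x in lborel. x \<in> W \<longrightarrow> P x" and W: "open W" "W \<noteq> {}"
  shows "\<exists>x\<in>W. P x"
proof (rule ccontr)
  assume neg: "\<not> (\<exists>x\<in>W. P x)"
  have "AE x in lborel. x \<notin> W"
    using ae by (rule eventually_mono) (use neg in blast)
  then have "W \<in> null_sets lborel"
    using AE_iff_null_sets[of W lborel] \<open>open W\<close> by simp
  then have "negligible W"
    by (simp add: negligible_iff_null_sets null_sets_completionI)
  then show False using open_not_negligible[OF W] by simp
qed

text \<open>The infimum is taken in the reals, so it has its meaning only for essentially bounded
  functions, for which the set of admissible levels is nonempty and bounded below.\<close>

definition ess_limsup :: "('a::euclidean_space \<Rightarrow> real) \<Rightarrow> 'a \<Rightarrow> real" where
  "ess_limsup f a = Inf {t. \<exists>\<rho>>0. AE x in lborel. x \<in> ball a \<rho> \<longrightarrow> f x \<le> t}"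

lemma
  fixes f :: "'a::euclidean_space \<Rightarrow> real"
  assumes "AE x in lborel. \<bar>f x\<bar> \<le> \<Lambda>"
  shows ess_limsup_upper:
      "0 < \<epsilon> \<Longrightarrow> \<exists>\<rho>>0. AE x in lborel. x \<in> ball a \<rho> \<longrightarrow> f x \<le> ess_limsup f a + \<epsilon>"
    and ess_limsup_le:
      "0 < \<rho> \<Longrightarrow> AE x in lborel. x \<in> ball a \<rho> \<longrightarrow> f x \<le> t \<Longrightarrow> ess_limsup f a \<le> t"
proof -
  define P where "P = (\<lambda>t \<rho>. AE x in lborel. x \<in> ball a \<rho> \<longrightarrow> f x \<le> t)"
  define T where "T = {t. \<exists>\<rho>>0. P t \<rho>}"
  have "P \<Lambda> 1"
    unfolding P_def using assms by eventually_elim (simp add: abs_le_iff)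
  then have "\<Lambda> \<in> T" unfolding T_def using zero_less_one[where 'a = real] by blast
  have lower: "- \<Lambda> \<le> t" if t: "t \<in> T" for t
  proof -
    obtain \<rho> where \<rho>: "0 < \<rho>" "P t \<rho>"
      using t unfolding T_def by blast
    have ae: "AE x in lborel. x \<in> ball a \<rho> \<longrightarrow> - \<Lambda> \<le> t"
      using assms \<rho>(2) unfolding P_def by eventually_elim (auto simp: abs_le_iff)
    have "ball a \<rho> \<noteq> {}" using \<rho>(1) by simp
    from AE_open_ex[OF ae open_ball this] show ?thesis by (elim bexE)
  qed
  have "bdd_below T" by (rule bdd_belowI) (rule lower)
  have eq: "ess_limsup f a = Inf T" by (simp add: ess_limsup_def T_def P_def)
  {
    assume "0 < \<rho>" "AE x in lborel. x \<in> ball a \<rho> \<longrightarrow> f x \<le> t"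
    then have "0 < \<rho> \<and> P t \<rho>" by (simp only: P_def simp_thms)
    then have "t \<in> T" unfolding T_def by blast
    then show "ess_limsup f a \<le> t" unfolding eq using \<open>bdd_below T\<close> by (rule cInf_lower)
  next
    assume "0 < \<epsilon>"
    then have "Inf T < Inf T + \<epsilon>" by simp
    then obtain t where t: "t \<in> T" "t < Inf T + \<epsilon>"
      using cInf_lessD[of T "Inf T + \<epsilon>"] \<open>\<Lambda> \<in> T\<close> by blast
    then obtain \<rho> where \<rho>: "0 < \<rho>" "P t \<rho>"
      unfolding T_def by blast
    from \<rho>(2) have "P (Inf T + \<epsilon>) \<rho>"
      unfolding P_def by eventually_elim (use t(2) in auto)
    then show "\<exists>\<rho>>0. AE x in lborel. x \<in> ball a \<rho> \<longrightarrow> f x \<le> ess_limsup f a + \<epsilon>"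
      using \<rho>(1) unfolding P_def eq by (intro exI conjI)
  }
qed

text \<open>Were the sublevel set to fill the fraction \<mu> of a small enough ball, the growth
  estimate would push \<open>u\<close> below its essential limsup on a concentric ball. The
  alternative for \<open>a\<close> and \<open>l\<close> is the one under which a comparison function
  exists.\<close>

lemma energy_solution_sublevel_density:
  fixes s p :: real and a :: "'a::euclidean_space"
  assumes s: "0 < s" "s < 1" and p: "1 \<le> p" and \<kappa>: "0 < 2 * s / DIM('a) - 1 / p"
    and \<Omega>: "bounded \<Omega>" "open \<Omega>" and z: "z \<in> Lp_space p \<Omega>" and u: "energy_solution s \<Omega> z u"
    and \<Lambda>: "AE x in lborel. \<bar>u x\<bar> \<le> \<Lambda>"
    and l: "l < ess_limsup u a" "a \<in> \<Omega> \<or> 0 \<le> l" and \<mu>: "0 < \<mu>"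
  shows "\<forall>\<^sub>F \<rho> in at_right 0. measure lborel {x \<in> ball a \<rho>. u x \<le> l} < \<mu> * \<rho> ^ DIM('a)"
proof -
  obtain \<theta> where \<theta>: "0 < \<theta>"
    "\<And>\<Omega> z u \<Lambda> c l r (a::'a). bounded \<Omega> \<Longrightarrow> open \<Omega> \<Longrightarrow> z \<in> Lp_space p \<Omega> \<Longrightarrow>
      energy_solution s \<Omega> z u \<Longrightarrow> (AE x in lborel. u x \<le> \<Lambda>) \<Longrightarrow> l < c \<Longrightarrow> 0 < r \<Longrightarrow>
      (AE x in lborel. x \<in> ball a r \<longrightarrow> u x \<le> c) \<Longrightarrow> ball a r \<subseteq> \<Omega> \<or> 0 \<le> l \<Longrightarrow>
      \<forall>\<^sub>F \<rho> in at_right 0. \<mu> * \<rho> ^ DIM('a) \<le> measure lborel {x \<in> ball a \<rho>. u x \<le> l} \<longrightarrow>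
        (AE x in lborel. x \<in> ball a (\<rho> / 2) \<longrightarrow> u x \<le> c - \<theta> * (c - l))"
    using energy_solution_growth[OF s p \<kappa> \<mu>] by blast
  define M where "M = ess_limsup u a"
  have l': "l < M" using l(1) by (simp add: M_def)
  have \<Lambda>': "AE x in lborel. u x \<le> \<Lambda>" using \<Lambda> by eventually_elim auto
  \<comment> \<open>With c = M + \<delta> the drop leads to the bound M + \<delta> - \<theta>(M +
    \<delta> - l), which is M - \<theta>\<delta>. The choice is not circular, as \<theta> was fixed
    before c.\<close>
  define \<delta> where "\<delta> = \<theta> * (M - l)"
  have \<delta>: "0 < \<delta>" using \<theta>(1) l' by (simp add: \<delta>_def)
  obtain r1 where r1: "0 < r1" "AE x in lborel. x \<in> ball a r1 \<longrightarrow> u x \<le> M + \<delta>"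
    using ess_limsup_upper[OF \<Lambda> \<delta>, of a, folded M_def] by (elim exE conjE) (rule that)
  obtain r where r: "0 < r" "r \<le> r1" "ball a r \<subseteq> \<Omega> \<or> 0 \<le> l"
  proof (cases "a \<in> \<Omega>")
    case True
    then obtain r2 where r2: "0 < r2" "ball a r2 \<subseteq> \<Omega>" using \<Omega>(2) openE by blast
    then have "ball a (min r1 r2) \<subseteq> \<Omega>" by auto
    then show ?thesis using that[of "min r1 r2"] r1(1) r2(1) by simp
  next
    case False
    then show ?thesis using that[of r1] r1 l by auto
  qed
  have "AE x in lborel. x \<in> ball a r \<longrightarrow> u x \<le> M + \<delta>"
    using r1(2) by eventually_elim (use r in auto)
  then have "\<forall>\<^sub>F \<rho> in at_right 0. \<mu> * \<rho> ^ DIM('a) \<le> measure lborel {x \<in> ball a \<rho>. u x \<le> l} \<longrightarrow>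
        (AE x in lborel. x \<in> ball a (\<rho> / 2) \<longrightarrow> u x \<le> M + \<delta> - \<theta> * (M + \<delta> - l))"
    using \<delta> l' by (intro \<theta>(2)[OF \<Omega> z u \<Lambda>' _ r(1) _ r(3)]) auto
  moreover have "\<forall>\<^sub>F \<rho> in at_right 0. 0 < (\<rho>::real)" by (rule eventually_at_right_less)
  ultimately show ?thesis
  proof eventually_elim
    case (elim \<rho>)
    show ?case
    proof (rule ccontr)
      assume "\<not> ?thesis"
      then have "AE x in lborel. x \<in> ball a (\<rho> / 2) \<longrightarrow> u x \<le> M + \<delta> - \<theta> * (M + \<delta> - l)"
        using elim by simp
      then have "M \<le> M + \<delta> - \<theta> * (M + \<delta> - l)"
        unfolding M_def using elim by (intro ess_limsup_le[OF \<Lambda>, of "\<rho> / 2"]) auto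
      then have "\<theta> * \<delta> \<le> 0" by (simp add: \<delta>_def algebra_simps)
      then show False using \<theta>(1) \<delta> by (simp add: mult_le_0_iff)
    qed
  qed
qed

lemma sublevel_density_outside:
  fixes w :: "'a::euclidean_space \<Rightarrow> real"
  assumes "open \<Omega>" and w: "w \<in> borel_measurable borel" "\<And>x. x \<notin> \<Omega> \<Longrightarrow> w x = 0"
    and dens: "\<forall>\<^sub>F \<rho> in F. \<mu> * \<rho> ^ DIM('a) \<le> measure lborel (ball a \<rho> - \<Omega>)"
  shows "\<forall>\<^sub>F \<rho> in F. \<mu> * \<rho> ^ DIM('a) \<le> measure lborel {x \<in> ball a \<rho>. w x \<le> 0}"
  using dens
proof (rule eventually_mono)
  fix \<rho>
  have S: "{x \<in> ball a \<rho>. w x \<le> 0} \<in> sets lborel"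
    using w(1) by simp
  have "emeasure lborel {x \<in> ball a \<rho>. w x \<le> 0} \<le> emeasure lborel (ball a \<rho>)"
    by (rule emeasure_mono) auto
  also have "\<dots> < \<infinity>" by (rule emeasure_lborel_ball_finite)
  finally have "measure lborel (ball a \<rho> - \<Omega>) \<le> measure lborel {x \<in> ball a \<rho>. w x \<le> 0}"
    using S w(2) \<open>open \<Omega>\<close> by (intro measure_mono_fmeasurable fmeasurableI) auto
  moreover assume "\<mu> * \<rho> ^ DIM('a) \<le> measure lborel (ball a \<rho> - \<Omega>)"
  ultimately show "\<mu> * \<rho> ^ DIM('a) \<le> measure lborel {x \<in> ball a \<rho>. w x \<le> 0}"
    by linarith
qed

text \<open>The number \<open>- m\<close> is the essential liminf of \<open>u\<close>, so the
  inequality \<open>M + m \<le> 0\<close> says that limsup and liminf agree. Off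
  \<open>\<Omega>\<close> both \<open>u\<close> and \<open>- u\<close> vanish on a set of positive
  density, and neither limsup can be positive.\<close>

lemma energy_solution_ess_limit:
  fixes s p :: real and a :: "'a::euclidean_space"
  assumes s: "0 < s" "s < 1" and p: "1 \<le> p" and \<kappa>: "0 < 2 * s / DIM('a) - 1 / p"
    and \<Omega>: "bounded \<Omega>" "open \<Omega>" and z: "z \<in> Lp_space p \<Omega>" and u: "energy_solution s \<Omega> z u"
    and \<Lambda>: "AE x in lborel. \<bar>u x\<bar> \<le> \<Lambda>"
    and dens: "a \<notin> \<Omega> \<Longrightarrow> \<exists>\<mu>>0. \<forall>\<^sub>F \<rho> in at_right 0. \<mu> * \<rho> ^ DIM('a) \<le> measure lborel (ball a \<rho> - \<Omega>)"
  shows "\<exists>l. (a \<notin> \<Omega> \<longrightarrow> l = 0) \<and>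
    (\<forall>\<epsilon>>0. \<exists>\<rho>>0. AE x in lborel. x \<in> ball a \<rho> \<longrightarrow> \<bar>u x - l\<bar> \<le> \<epsilon>)"
proof -
  let ?z = "\<lambda>x. - z x" and ?u = "\<lambda>x. - u x"
  have z': "?z \<in> Lp_space p \<Omega>" using z by (simp add: Lp_space_def)
  have u': "energy_solution s \<Omega> ?z ?u" by (rule energy_solution_uminus[OF u])
  have [measurable]: "u \<in> borel_measurable borel"
    using u by (simp add: energy_solution_def finite_energy_def)
  have u0: "u x = 0" if "x \<notin> \<Omega>" for x using u that by (simp add: energy_solution_def)
  have \<Lambda>': "AE x in lborel. \<bar>?u x\<bar> \<le> \<Lambda>" using \<Lambda> by simp
  define M where "M = ess_limsup u a"
  define m where "m = ess_limsup ?u a"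
  note M = ess_limsup_upper[OF \<Lambda>, of _ a, folded M_def] and m = ess_limsup_upper[OF \<Lambda>', of _ a, folded m_def]
  note small = energy_solution_sublevel_density[OF s p \<kappa> \<Omega> z u \<Lambda>, of _ a, folded M_def]
  note small' = energy_solution_sublevel_density[OF s p \<kappa> \<Omega> z' u' \<Lambda>', of _ a, folded m_def]
  have outside: "a \<notin> \<Omega> \<Longrightarrow> M \<le> 0 \<and> m \<le> 0"
  proof -
    assume a: "a \<notin> \<Omega>"
    obtain \<mu> where \<mu>: "0 < \<mu>" "\<forall>\<^sub>F \<rho> in at_right 0. \<mu> * \<rho> ^ DIM('a) \<le> measure lborel (ball a \<rho> - \<Omega>)"
      using dens[OF a] by (elim exE conjE) (rule that)
    note sub = sublevel_density_outside[OF \<Omega>(2) _ _ \<mu>(2)]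
    have "\<not> 0 < M"
    proof
      assume "0 < M"
      have "\<forall>\<^sub>F \<rho> in at_right 0. \<mu> * \<rho> ^ DIM('a) \<le> measure lborel {x \<in> ball a \<rho>. u x \<le> 0}"
        by (rule sub) (use u0 in auto)
      with small[OF \<open>0 < M\<close> disjI2[OF order_refl] \<mu>(1)]
      have "\<forall>\<^sub>F \<rho>::real in at_right 0. False"
        by eventually_elim linarith
      then show False by simp
    qed
    moreover have "\<not> 0 < m"
    proof
      assume "0 < m"
      have "\<forall>\<^sub>F \<rho> in at_right 0. \<mu> * \<rho> ^ DIM('a) \<le> measure lborel {x \<in> ball a \<rho>. ?u x \<le> 0}"
        by (rule sub) (use u0 in auto)
      with small'[OF \<open>0 < m\<close> disjI2[OF order_refl] \<mu>(1)]
      have "\<forall>\<^sub>F \<rho>::real in at_right 0. False"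
        by eventually_elim linarith
      then show False by simp
    qed
    ultimately show ?thesis by simp
  qed
  have inside: "M + m \<le> 0"
  proof (cases "a \<in> \<Omega>")
    case False
    then show ?thesis using outside by simp
  next
    case True
    show ?thesis
    proof (rule ccontr)
      assume neg: "\<not> M + m \<le> 0"
      \<comment> \<open>This is the midpoint of the essential limsup \<open>M\<close> and liminf
        \<open>- m\<close>. The sublevel sets of \<open>u\<close> at \<open>l\<close> and of
        \<open>- u\<close> at \<open>- l\<close> cover each ball, so they cannot both have less than
        half of its measure.\<close>
      define l where "l = (M - m) / 2"
      let ?v = "unit_ball_vol DIM('a)"
      have v: "0 < ?v / 2" by (simp add: unit_ball_vol_pos)
      have l: "l < M" "- l < m" using neg by (auto simp: l_def field_simps)
      have "\<forall>\<^sub>F \<rho>::real in at_right 0. False"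
        using small[OF l(1) disjI1[OF True] v] small'[OF l(2) disjI1[OF True] v]
          eventually_at_right_less[of "0::real"]
      proof eventually_elim
        case (elim \<rho>)
        have "?v * \<rho> ^ DIM('a) = measure lborel (ball a \<rho>)"
          using elim by (simp add: content_ball)
        also have "ball a \<rho> = {x \<in> ball a \<rho>. u x \<le> l} \<union> {x \<in> ball a \<rho>. ?u x \<le> - l}" by auto
        also have "measure lborel \<dots> \<le> measure lborel {x \<in> ball a \<rho>. u x \<le> l} + measure lborel {x \<in> ball a \<rho>. ?u x \<le> - l}"
          by (rule measure_Un_le) measurable
        finally show ?case using elim by simp
      qed
      then show False by simp
    qed
  qed
  have lim: "\<exists>\<rho>>0. AE x in lborel. x \<in> ball a \<rho> \<longrightarrow> \<bar>u x - M\<bar> \<le> \<epsilon>" if \<epsilon>: "0 < \<epsilon>" for \<epsilon>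
  proof -
    obtain \<rho>1 where 1: "0 < \<rho>1" "AE x in lborel. x \<in> ball a \<rho>1 \<longrightarrow> u x \<le> M + \<epsilon>"
      using M[OF \<epsilon>] by (elim exE conjE) (rule that)
    obtain \<rho>2 where 2: "0 < \<rho>2" "AE x in lborel. x \<in> ball a \<rho>2 \<longrightarrow> ?u x \<le> m + \<epsilon>"
      using m[OF \<epsilon>] by (elim exE conjE) (rule that)
    have "AE x in lborel. x \<in> ball a (min \<rho>1 \<rho>2) \<longrightarrow> \<bar>u x - M\<bar> \<le> \<epsilon>"
      using 1(2) 2(2) by eventually_elim (use inside in \<open>auto simp: abs_le_iff\<close>)
    then show ?thesis using 1(1) 2(1) by (intro exI[of _ "min \<rho>1 \<rho>2"]) auto
  qed
  have M0: "M = 0" if a: "a \<notin> \<Omega>"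
  proof (rule antisym)
    show "M \<le> 0" using outside[OF a] by simp
    \<comment> \<open>Near \<open>a\<close> the values of \<open>u\<close> are close to
      \<open>M\<close> and, as \<open>m \<le> 0\<close>, not much below 0; comparing the two bounds
      at a single point suffices.\<close>
    have "- M \<le> 0 + \<epsilon>" if \<epsilon>: "0 < \<epsilon>" for \<epsilon>
    proof -
      obtain \<rho> where \<rho>: "0 < \<rho>" "AE x in lborel. x \<in> ball a \<rho> \<longrightarrow> \<bar>u x - M\<bar> \<le> \<epsilon> / 2"
        using lim[OF half_gt_zero[OF \<epsilon>]] by (elim exE conjE) (rule that)
      obtain \<rho>' where \<rho>': "0 < \<rho>'" "AE x in lborel. x \<in> ball a \<rho>' \<longrightarrow> ?u x \<le> m + \<epsilon> / 2"
        using m[OF half_gt_zero[OF \<epsilon>]] by (elim exE conjE) (rule that)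
      have ae: "AE x in lborel. x \<in> ball a (min \<rho> \<rho>') \<longrightarrow> - M \<le> \<epsilon>"
        using \<rho>(2) \<rho>'(2)
      proof eventually_elim
        case (elim x)
        show ?case
        proof
          assume "x \<in> ball a (min \<rho> \<rho>')"
          then have "\<bar>u x - M\<bar> \<le> \<epsilon> / 2" "- u x \<le> m + \<epsilon> / 2" using elim by auto
          then show "- M \<le> \<epsilon>" using outside[OF a] by linarith
        qed
      qed
      have "ball a (min \<rho> \<rho>') \<noteq> {}" using \<rho>(1) \<rho>'(1) by simp
      from AE_open_ex[OF ae open_ball this] have "- M \<le> \<epsilon>" by (elim bexE)
      then show ?thesis by simp
    qed
    then have "- M \<le> 0" by (rule field_le_epsilon)
    then show "0 \<le> M" by simp
  qed
  show ?thesis by (intro exI[of _ M] conjI impI allI M0 lim)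
qed

section \<open>Continuity\<close>

text \<open>A point off the closure has whole balls outside. At a boundary point the cone contains,
  for every small \<rho>, a ball of radius proportional to \<rho> centred on its axis, and the cone
  meets the closure of \<open>\<Omega>\<close> only in its vertex \<open>a\<close>, which is not in
  \<open>\<Omega>\<close>.\<close>

lemma exterior_cone_imp_density:
  fixes \<Omega> :: "'a::euclidean_space set"
  assumes "open \<Omega>" "exterior_cone_condition \<Omega>" "a \<notin> \<Omega>"
  shows "\<exists>\<mu>>0. \<forall>\<^sub>F \<rho> in at_right 0. \<mu> * \<rho> ^ DIM('a) \<le> measure lborel (ball a \<rho> - \<Omega>)"
proof -
  let ?v = "unit_ball_vol DIM('a)"
  have mono: "measure lborel B \<le> measure lborel (ball a \<rho> - \<Omega>)"
    if "B \<in> sets borel" "B \<subseteq> ball a \<rho> - \<Omega>" for B \<rho>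
  proof (rule measure_mono_fmeasurable)
    have "emeasure lborel (ball a \<rho> - \<Omega>) \<le> emeasure lborel (ball a \<rho>)"
      by (rule emeasure_mono) auto
    also have "\<dots> < \<infinity>" by (rule emeasure_lborel_ball_finite)
    finally show "ball a \<rho> - \<Omega> \<in> fmeasurable lborel"
      using \<open>open \<Omega>\<close> by (intro fmeasurableI) auto
  qed (use that in auto)
  have pos: "\<forall>\<^sub>F \<rho> in at_right 0. 0 < (\<rho>::real)" by (rule eventually_at_right_less)
  show ?thesis
  proof (cases "a \<in> closure \<Omega>")
    case False
    then obtain r where r: "0 < r" "ball a r \<subseteq> - closure \<Omega>"
      using openE[of "- closure \<Omega>" a] by auto
    have "\<forall>\<^sub>F \<rho> in at_right 0. \<rho> < r"
      using r by (intro order_tendstoD(2)[OF tendsto_ident_at]) auto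
    with pos have "\<forall>\<^sub>F \<rho> in at_right 0. ?v * \<rho> ^ DIM('a) \<le> measure lborel (ball a \<rho> - \<Omega>)"
    proof eventually_elim
      case (elim \<rho>)
      have "?v * \<rho> ^ DIM('a) = measure lborel (ball a \<rho>)" using elim by (simp add: content_ball)
      also have "\<dots> \<le> measure lborel (ball a \<rho> - \<Omega>)"
      proof (rule mono)
        have "ball a \<rho> \<subseteq> ball a r" using elim by auto
        then show "ball a \<rho> \<subseteq> ball a \<rho> - \<Omega>" using r(2) closure_subset[of \<Omega>] by blast
      qed (simp add: borel_open)
      finally show ?case .
    qed
    moreover have "0 < ?v" by (simp add: unit_ball_vol_pos)
    ultimately show ?thesis by blast
  next
    case True
    then have "a \<in> frontier \<Omega>"
      using assms by (simp add: frontier_def interior_open)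
    then obtain e \<theta> h where e: "norm e = 1" and \<theta>: "0 < \<theta>" "\<theta> < pi / 2" and h: "0 < h"
      and cone: "finite_cone a e \<theta> h \<inter> closure \<Omega> = {a}"
      using assms(2) unfolding exterior_cone_condition_def by blast
    define c where "c = cos \<theta>"
    have c: "0 < c" "c < 1"
      using \<theta> cos_gt_zero[of \<theta>] cos_monotone_0_pi[of 0 \<theta>] by (auto simp: c_def)
    \<comment> \<open>With this value 1 - \<sigma> exceeds c (1 + \<sigma>) by (1 - c)^2 / 2, so the
      ball of radius \<sigma>\<rho>/2 about the axis point at distance \<rho>/2 from the vertex
      stays in the cone.\<close>
    define \<sigma> where "\<sigma> = (1 - c) / 2"
    have \<sigma>: "0 < \<sigma>" "\<sigma> < 1" using c by (auto simp: \<sigma>_def)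
    have "0 \<le> (1 - c)\<^sup>2" by simp
    then have c\<sigma>: "c * (1 + \<sigma>) \<le> 1 - \<sigma>"
      by (simp add: \<sigma>_def power2_eq_square field_simps)
    have "\<forall>\<^sub>F \<rho> in at_right 0. \<rho> < h"
      using h by (intro order_tendstoD(2)[OF tendsto_ident_at]) auto
    with pos have "\<forall>\<^sub>F \<rho> in at_right 0. (?v * (\<sigma> / 2) ^ DIM('a)) * \<rho> ^ DIM('a) \<le> measure lborel (ball a \<rho> - \<Omega>)"
    proof eventually_elim
      case (elim \<rho>)
      let ?b = "a + (\<rho> / 2) *\<^sub>R e"
      have "(?v * (\<sigma> / 2) ^ DIM('a)) * \<rho> ^ DIM('a) = measure lborel (ball ?b (\<sigma> * \<rho> / 2))"
        using elim \<sigma> by (simp add: content_ball power_mult_distrib power_divide)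
      also have "\<dots> \<le> measure lborel (ball a \<rho> - \<Omega>)"
      proof (rule mono)
        show "ball ?b (\<sigma> * \<rho> / 2) \<subseteq> ball a \<rho> - \<Omega>"
        proof
          fix x assume "x \<in> ball ?b (\<sigma> * \<rho> / 2)"
          define w where "w = x - ?b"
          have w: "norm w < \<sigma> * \<rho> / 2"
            using \<open>x \<in> ball ?b (\<sigma> * \<rho> / 2)\<close> by (simp add: w_def dist_norm norm_minus_commute)
          have xa: "x - a = (\<rho> / 2) *\<^sub>R e + w" by (simp add: w_def)
          have "norm (x - a) \<le> norm ((\<rho> / 2) *\<^sub>R e) + norm w"
            unfolding xa by (rule norm_triangle_ineq)
          then have n: "norm (x - a) < \<rho> / 2 * (1 + \<sigma>)"
            using w e elim by (simp add: algebra_simps)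
          also have "\<dots> < \<rho> / 2 * 2" using \<sigma> elim by (intro mult_strict_left_mono) auto
          finally have n': "norm (x - a) < \<rho>" by simp
          have "e \<bullet> e = 1" using e by (simp add: norm_eq_1)
          then have "(x - a) \<bullet> e = \<rho> / 2 + w \<bullet> e" by (simp add: xa inner_add_left)
          moreover have "\<bar>w \<bullet> e\<bar> \<le> norm w" using Cauchy_Schwarz_ineq2[of w e] e by simp
          ultimately have "\<rho> / 2 * (1 - \<sigma>) \<le> (x - a) \<bullet> e" using w by (simp add: algebra_simps)
          moreover have "c * norm (x - a) \<le> c * (\<rho> / 2 * (1 + \<sigma>))"
            using n c by (intro mult_left_mono) auto
          moreover have "\<rho> / 2 * (c * (1 + \<sigma>)) \<le> \<rho> / 2 * (1 - \<sigma>)"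
            using c\<sigma> elim by (intro mult_left_mono) auto
          moreover have "c * (\<rho> / 2 * (1 + \<sigma>)) = \<rho> / 2 * (c * (1 + \<sigma>))" by simp
          ultimately have "c * norm (x - a) \<le> (x - a) \<bullet> e" by linarith
          then have "x \<in> finite_cone a e \<theta> h"
            using n' elim by (simp add: finite_cone_def c_def)
          have "x \<notin> \<Omega>"
          proof
            assume "x \<in> \<Omega>"
            then have "x \<in> finite_cone a e \<theta> h \<inter> closure \<Omega>"
              using \<open>x \<in> finite_cone a e \<theta> h\<close> closure_subset[of \<Omega>] by auto
            then have "x = a" unfolding cone by simp
            then show False using \<open>x \<in> \<Omega>\<close> \<open>a \<notin> \<Omega>\<close> by simp
          qed
          then show "x \<in> ball a \<rho> - \<Omega>" using n' by (simp add: dist_norm norm_minus_commute)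
        qed
      qed (simp add: borel_open)
      finally show ?case .
    qed
    moreover have "0 < ?v * (\<sigma> / 2) ^ DIM('a)" using \<sigma> by (simp add: unit_ball_vol_pos)
    ultimately show ?thesis by blast
  qed
qed

text \<open>Balls around two nearby points meet in a nonempty open set, which is not null, so the
  two limits are compared at a common point. This gives continuity of \<open>g\<close> from bounds
  on \<open>u\<close> that hold only almost everywhere.\<close>

lemma continuous_representative:
  fixes u :: "'a::euclidean_space \<Rightarrow> real"
  assumes lim: "\<And>a \<epsilon>. 0 < \<epsilon> \<Longrightarrow> \<exists>\<rho>>0. AE x in lborel. x \<in> ball a \<rho> \<longrightarrow> \<bar>u x - g a\<bar> \<le> \<epsilon>"
  shows "continuous_on UNIV g" and "AE x in lborel. u x = g x"
proof -
  have close: "\<bar>g y - g a\<bar> \<le> 2 * \<epsilon>"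
    if "0 < \<epsilon>" and ae: "AE x in lborel. x \<in> ball a \<rho> \<longrightarrow> \<bar>u x - g a\<bar> \<le> \<epsilon>" and y: "y \<in> ball a \<rho>"
    for a y \<rho> \<epsilon>
  proof -
    obtain \<rho>' where \<rho>': "0 < \<rho>'" "AE x in lborel. x \<in> ball y \<rho>' \<longrightarrow> \<bar>u x - g y\<bar> \<le> \<epsilon>"
      using lim[OF \<open>0 < \<epsilon>\<close>, of y] by (elim exE conjE) (rule that)
    have ae2: "AE x in lborel. x \<in> ball a \<rho> \<inter> ball y \<rho>' \<longrightarrow> \<bar>g y - g a\<bar> \<le> 2 * \<epsilon>"
      using ae \<rho>'(2) by eventually_elim auto
    have "y \<in> ball a \<rho> \<inter> ball y \<rho>'" using y \<rho>'(1) by simp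
    then have ne: "ball a \<rho> \<inter> ball y \<rho>' \<noteq> {}" by blast
    from AE_open_ex[OF ae2 open_Int[OF open_ball open_ball] ne] show ?thesis by (elim bexE)
  qed
  show "continuous_on UNIV g"
    unfolding continuous_on_iff
  proof (intro ballI allI impI)
    fix a :: 'a and e :: real
    assume "0 < e"
    then have e: "0 < e / 3" by simp
    obtain \<rho> where \<rho>: "0 < \<rho>" "AE x in lborel. x \<in> ball a \<rho> \<longrightarrow> \<bar>u x - g a\<bar> \<le> e / 3"
      using lim[OF e, of a] by (elim exE conjE) (rule that)
    have "dist (g y) (g a) < e" if "dist y a < \<rho>" for y
    proof -
      have "\<bar>g y - g a\<bar> \<le> 2 * (e / 3)"
        using close[OF e \<rho>(2)] that by (simp add: dist_commute)
      then show ?thesis using \<open>0 < e\<close> by (simp add: dist_real_def)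
    qed
    then show "\<exists>d>0. \<forall>x'\<in>UNIV. dist x' a < d \<longrightarrow> dist (g x') (g a) < e"
      using \<rho>(1) by blast
  qed
  have near: "AE x in lborel. \<bar>u x - g x\<bar> \<le> 3 * \<epsilon>" if \<epsilon>: "0 < \<epsilon>" for \<epsilon>
  proof -
    define r where "r = (\<lambda>a. SOME \<rho>. 0 < \<rho> \<and> (AE x in lborel. x \<in> ball a \<rho> \<longrightarrow> \<bar>u x - g a\<bar> \<le> \<epsilon>))"
    have r: "0 < r a" "AE x in lborel. x \<in> ball a (r a) \<longrightarrow> \<bar>u x - g a\<bar> \<le> \<epsilon>" for a
      using someI_ex[OF lim[OF \<epsilon>, of a]] unfolding r_def by (rule conjunct1, rule conjunct2)
    define \<F> where "\<F> = (\<lambda>a. ball a (r a)) ` UNIV"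
    \<comment> \<open>Each centre has its own exceptional null set; a countable subcover makes their
      union null again.\<close>
    obtain \<F>' where \<F>': "\<F>' \<subseteq> \<F>" "countable \<F>'" "\<Union>\<F>' = \<Union>\<F>"
      using Lindelof[of \<F>] by (auto simp: \<F>_def)
    have "\<Union>\<F> = UNIV" unfolding \<F>_def using r(1) centre_in_ball by blast
    have "AE x in lborel. \<forall>B\<in>\<F>'. x \<in> B \<longrightarrow> \<bar>u x - g x\<bar> \<le> 3 * \<epsilon>"
    proof (rule AE_ball_countable'[OF _ \<F>'(2)])
      fix B assume "B \<in> \<F>'"
      then obtain a where B: "B = ball a (r a)" using \<F>'(1) by (auto simp: \<F>_def)
      show "AE x in lborel. x \<in> B \<longrightarrow> \<bar>u x - g x\<bar> \<le> 3 * \<epsilon>"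
        using r(2)[of a]
      proof eventually_elim
        case (elim x)
        show ?case
        proof
          assume "x \<in> B"
          then have "\<bar>u x - g a\<bar> \<le> \<epsilon>" "\<bar>g x - g a\<bar> \<le> 2 * \<epsilon>"
            using elim close[OF \<epsilon> r(2)[of a], of x] by (auto simp: B)
          then show "\<bar>u x - g x\<bar> \<le> 3 * \<epsilon>" by linarith
        qed
      qed
    qed
    then show ?thesis
    proof eventually_elim
      case (elim x)
      have "x \<in> \<Union>\<F>'" using \<open>\<Union>\<F> = UNIV\<close> \<F>'(3) by simp
      then show ?case using elim by blast
    qed
  qed
  have "AE x in lborel. \<bar>u x - g x\<bar> \<le> 3 * (1 / Suc n)" for n
    by (rule near) simp
  then have "AE x in lborel. \<forall>n::nat. \<bar>u x - g x\<bar> \<le> 3 * (1 / Suc n)"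
    unfolding AE_all_countable by (rule allI)
  then show "AE x in lborel. u x = g x"
  proof eventually_elim
    case (elim x)
    have "(\<lambda>n. 3 * (1 / Suc n)) \<longlonglongrightarrow> 3 * (0::real)"
      by (intro tendsto_intros) (rule LIMSEQ_Suc[OF lim_1_over_n])
    then have "\<bar>u x - g x\<bar> \<le> 3 * 0" using elim by (intro LIMSEQ_le_const) auto
    then show ?case by simp
  qed
qed

section \<open>The sup bound on \<open>\<Omega>\<close> and the continuous representative\<close>

theorem theorem3p4:
  fixes \<Omega> :: "'a::euclidean_space set" and s p :: real
  assumes "0 < s" and "s < 1"
    and "bounded_lipschitz_domain \<Omega>"
    and "exterior_cone_condition \<Omega>"
    and "real DIM('a) > 2 * s \<Longrightarrow> p > real DIM('a) / (2 * s)"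
    and "real DIM('a) = 2 * s \<Longrightarrow> p > 1"
    and "real DIM('a) < 2 * s \<Longrightarrow> p = 1"
  shows "\<exists>C>0. \<forall>z \<in> Lp_space p \<Omega>. \<forall>u. weak_solution s \<Omega> (Lp_functional \<Omega> z) u \<longrightarrow>
           (\<exists>g \<in> C0 \<Omega>. (AE x in lebesgue. u x = g x) \<and> C0_norm \<Omega> g \<le> C * Lp_norm p \<Omega> z)"
proof -
  let ?N = "real DIM('a)"
  let ?\<kappa> = "2 * s / ?N - 1 / p"
  have s: "0 < s" "s < 1" by fact+
  have \<Omega>: "bounded \<Omega>" "open \<Omega>" "\<Omega> \<noteq> {}"
    using assms(3) by (auto simp: bounded_lipschitz_domain_def domain_def)
  have N: "0 < ?N" by simp
  have p: "1 \<le> p" and \<kappa>: "0 < ?\<kappa>"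
  proof -
    \<comment> \<open>Positivity of \<kappa> means p > N/(2s). For N = 2s this reads p > 1, and for
      N < 2s it holds with p = 1.\<close>
    consider "?N > 2 * s" | "?N = 2 * s" | "?N < 2 * s" by linarith
    then have "1 \<le> p \<and> 0 < ?\<kappa>"
    proof cases
      case 1
      then have *: "?N / (2 * s) < p" by (rule assms(5))
      have "1 < ?N / (2 * s)" using 1 s by simp
      then have "1 \<le> p" using * by linarith
      moreover from this have "1 / p < 2 * s / ?N"
        using * s N by (simp add: field_simps)
      ultimately show ?thesis by simp
    next
      case 2
      then show ?thesis using assms(6) s by simp
    next
      case 3
      then show ?thesis using assms(7) s N by simp
    qed
    then show "1 \<le> p" "0 < ?\<kappa>" by auto
  qed
  obtain C where C: "0 < C"
    "\<And>\<Omega> z u \<phi> D. bounded \<Omega> \<Longrightarrow> open \<Omega> \<Longrightarrow> z \<in> Lp_space p \<Omega> \<Longrightarrow> energy_solution s \<Omega> z u \<Longrightarrow>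
      finite_energy s \<phi> \<Longrightarrow> (\<And>x. x \<notin> \<Omega> \<Longrightarrow> 0 \<le> \<phi> x) \<Longrightarrow>
      D \<in> sets borel \<Longrightarrow> emeasure lborel D < \<infinity> \<Longrightarrow> (AE x in lborel. x \<notin> D \<longrightarrow> u x \<le> \<phi> x) \<Longrightarrow>
      (\<And>k h v. 0 \<le> k \<Longrightarrow> k < h \<Longrightarrow> v = (\<lambda>x. truncation k h (u x - \<phi> x)) \<Longrightarrow> finite_energy s v \<Longrightarrow>
         frac_bilinear s v v \<le> frac_bilinear s u v) \<Longrightarrow>
      AE x in lborel. u x \<le> \<phi> x + C * Lp_norm p \<Omega> z * measure lborel (D::'a set) powr ?\<kappa>"
    using energy_solution_sup_bound[OF s p \<kappa>] by blast
  define m where "m = measure lborel \<Omega> powr ?\<kappa>"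
  have bound: "AE x in lborel. u x \<le> C * m * Lp_norm p \<Omega> z"
    if z: "z \<in> Lp_space p \<Omega>" and u: "energy_solution s \<Omega> z u" for z and u :: "'a \<Rightarrow> real"
  proof -
    have "AE x in lborel. u x \<le> 0 + C * Lp_norm p \<Omega> z * measure lborel \<Omega> powr ?\<kappa>"
    proof (rule C(2)[OF \<Omega>(1,2) z u finite_energy_const])
      show "\<Omega> \<in> sets borel" using \<Omega>(2) by simp
      show "emeasure lborel \<Omega> < \<infinity>" using \<Omega>(1) by (rule emeasure_bounded_finite)
      show "AE x in lborel. x \<notin> \<Omega> \<longrightarrow> u x \<le> 0" using u by (simp add: energy_solution_def)
      show "frac_bilinear s v v \<le> frac_bilinear s u v"
        if "0 \<le> k" "k < h" "v = (\<lambda>x. truncation k h (u x - 0))" "finite_energy s v" for k h v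
        using that u by (intro frac_bilinear_truncation_ge) (auto simp: energy_solution_def)
    qed simp
    then show ?thesis by (simp add: m_def mult_ac)
  qed
  show ?thesis
  \<comment> \<open>The added 1 makes the constant visibly positive.\<close>
  proof (intro exI[of _ "C * m + 1"] conjI ballI allI impI)
    show "0 < C * m + 1" using C(1) by (simp add: m_def add_nonneg_pos)
    fix z u
    assume z: "z \<in> Lp_space p \<Omega>" and weak: "weak_solution s \<Omega> (Lp_functional \<Omega> z) u"
    obtain u' where u': "energy_solution s \<Omega> z u'" and uu': "AE x in lborel. u x = u' x"
      by (rule weak_solution_representative[OF weak \<Omega>(2,1)])
    define \<Lambda> where "\<Lambda> = C * m * Lp_norm p \<Omega> z"
    have z': "(\<lambda>x. - z x) \<in> Lp_space p \<Omega>" "Lp_norm p \<Omega> (\<lambda>x. - z x) = Lp_norm p \<Omega> z"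
      using z by (simp_all add: Lp_space_def Lp_norm_def)
    have \<Lambda>: "AE x in lborel. \<bar>u' x\<bar> \<le> \<Lambda>"
      using bound[OF z u'] bound[OF z'(1) energy_solution_uminus[OF u']]
      by eventually_elim (simp add: \<Lambda>_def z'(2) abs_le_iff)
    have "\<exists>l. (a \<notin> \<Omega> \<longrightarrow> l = 0) \<and> (\<forall>\<epsilon>>0. \<exists>\<rho>>0. AE x in lborel. x \<in> ball a \<rho> \<longrightarrow> \<bar>u' x - l\<bar> \<le> \<epsilon>)" for a
      by (rule energy_solution_ess_limit[OF s p \<kappa> \<Omega>(1,2) z u' \<Lambda>
            exterior_cone_imp_density[OF \<Omega>(2) assms(4)]])
    then have "\<forall>a. \<exists>l. (a \<notin> \<Omega> \<longrightarrow> l = 0) \<and> (\<forall>\<epsilon>>0. \<exists>\<rho>>0. AE x in lborel. x \<in> ball a \<rho> \<longrightarrow> \<bar>u' x - l\<bar> \<le> \<epsilon>)"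
      by (rule allI)
    from choice[OF this] obtain g where
      g: "\<forall>a. (a \<notin> \<Omega> \<longrightarrow> g a = 0) \<and> (\<forall>\<epsilon>>0. \<exists>\<rho>>0. AE x in lborel. x \<in> ball a \<rho> \<longrightarrow> \<bar>u' x - g a\<bar> \<le> \<epsilon>)"
      by (elim exE) (rule that)
    have lim: "\<exists>\<rho>>0. AE x in lborel. x \<in> ball a \<rho> \<longrightarrow> \<bar>u' x - g a\<bar> \<le> \<epsilon>" if "0 < \<epsilon>" for a \<epsilon>
      using spec[OF g, of a, THEN conjunct2, THEN spec, THEN mp, OF that] .
    have cont: "continuous_on UNIV g"
      by (rule continuous_representative(1)[OF lim])
    have u'g: "AE x in lborel. u' x = g x"
      by (rule continuous_representative(2)[OF lim])
    have gC0: "g \<in> C0 \<Omega>" using cont g by (simp add: C0_def)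
    have ug: "AE x in lborel. u x = g x"
      using uu' u'g by eventually_elim simp
    \<comment> \<open>By continuity the set where the bound fails is open; since it is also null, it
      is empty.\<close>
    have gb: "\<bar>g x\<bar> \<le> \<Lambda>" for x
    proof (rule ccontr)
      assume "\<not> \<bar>g x\<bar> \<le> \<Lambda>"
      then have "x \<in> {x. \<Lambda> < \<bar>g x\<bar>}" by simp
      then have ne: "{x. \<Lambda> < \<bar>g x\<bar>} \<noteq> {}" by blast
      have "open {x. \<Lambda> < \<bar>g x\<bar>}"
        by (intro open_Collect_less continuous_intros cont)
      moreover have "AE y in lborel. y \<in> {x. \<Lambda> < \<bar>g x\<bar>} \<longrightarrow> False"
        using \<Lambda> u'g by eventually_elim auto
      ultimately show False using AE_open_ex[of "{x. \<Lambda> < \<bar>g x\<bar>}" "\<lambda>_. False"] ne by simp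
    qed
    have "C0_norm \<Omega> g \<le> \<Lambda>"
      unfolding C0_norm_def using \<Omega>(3) gb by (intro cSUP_least) auto
    also have "\<dots> \<le> (C * m + 1) * Lp_norm p \<Omega> z"
      unfolding \<Lambda>_def by (intro mult_right_mono) auto
    finally show "\<exists>g \<in> C0 \<Omega>. (AE x in lebesgue. u x = g x) \<and> C0_norm \<Omega> g \<le> (C * m + 1) * Lp_norm p \<Omega> z"
      using gC0 ug unfolding AE_lborel_iff_lebesgue by (intro bexI[of _ g] conjI)
  qed
qed

end
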